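(* Let $L,R,C\in\mathbb R$ with $L\ge0$, $R\ge0$, $C>0$, $L^2+R^2\neq0$, and let $V\in\widehat{\rm span}(\mathcal D_+^\prime(\mathbb R))$. Consider the initial value problem (Kirchhoff law) $LI^{\prime\prime}+RI^\prime+\frac1C I=V^\prime(t)$, $I(0)=0$, $LI^\prime(0)=0$, for $I\in\widehat{\mathcal E(\mathbb R)}$. (i) If $L=0$, then the problem reduces to $RI^\prime+\frac1C I=V^\prime(t)$, $I(0)=0$, and its solution in $\widehat{\mathcal E(\mathbb R)}$ is $$I(t)=(g\star V^\prime)(t)-(g\star V^\prime)(0)\,e^{-\frac{t}{RC}},\qquad\text{where } g(t)=\tfrac1R H(t)e^{-\frac{t}{RC}}.$$ (ii) Let $R^2-\frac{4L}{C}<0$. Then the problem reduces to $LI^{\prime\prime}+RI^\prime+\frac1C I=V^\prime(t)$, $I(0)=I^\prime(0)=0$, and its solution in $\widehat{\mathcal E(\mathbb R)}$ is $$I(t)=-(G\star V^\prime)(0)\,e^{-\frac{R}{2L}t}\cos\omega t-\frac{R\,(G\star V^\prime)(0)+2L\,(G^\prime\star V^\prime)(0)}{2L\omega}\,e^{-\frac{R}{2L}t}\sin\omega t+(G\star V^\prime)(t),$$ where $\omega=\frac1{2L}\sqrt{\frac{4L}{C}-R^2}$, $G(t)=\frac{1}{L\omega}H(t)e^{-\frac{R}{2L}t}\sin\omega t$, $\iota(G)(0)\approx0$ and $\iota(G^\prime)(0)\approx\frac1{2L}$; consequently, in $\mathcal D^\prime(\mathbb R)$, $G^\prime(t)=-\frac{R}{2L}G(t)+\frac1L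 H(t)e^{-\frac{R}{2L}t}\cos\omega t$ and $$G^{\prime\prime}=\tfrac1L\delta(t)-\tfrac RL G^\prime(t)-\tfrac1{LC}G(t)=\tfrac1L\delta(t)-\tfrac{R}{L^2}H(t)e^{-\frac{R}{2L}t}\cos\omega t+\tfrac{1}{L\omega}\Big(\tfrac{R^2}{4L^2}-\omega^2\Big)H(t)e^{-\frac{R}{2L}t}\sin\omega t.$$ (iii) Let $R=0$ and $L,C\in\mathbb R_+$. Then the problem reduces to $LI^{\prime\prime}+\frac1C I=V^\prime(t)$, $I(0)=I^\prime(0)=0$, and its solution in $\widehat{\mathcal E(\mathbb R)}$ is $$I(t)=-\frac{(G_0\star V^\prime)(0)}{L}\cos\omega t-\frac{(G_0^\prime\star V^\prime)(0)}{L\omega}\sin\omega t+\frac1L(G_0\star V^\prime)(t),$$ where $\omega=\frac1{\sqrt{LC}}$, $G_0(t)=\frac1\omega H(t)\sin\omega t$, $\iota(G_0)(0)\approx0$ and $\iota(G_0^\prime)(0)=\frac12$; consequently, in $\mathcal D^\prime(\mathbb R)$, $G_0^\prime(t)=H(t)\cos\omega t$ and $G_0^{\prime\prime}=\delta(t)-\omega^2G_0(t)=\delta(t)-\omega H(t)\sin\omega t$.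
   Context: Notation: $\mathbb R_+$ = positive reals, $\mathcal E(\mathbb R)=\mathcal C^\infty(\mathbb R)$ (complex-valued smooth functions), $\mathcal D(\mathbb R)$ = test functions (smooth, compactly supported, complex-valued), $\mathcal D^\prime(\mathbb R)$ = Schwartz distributions, $\mathcal D_+^\prime(\mathbb R)$ = distributions supported in $[0,\infty)$, $H$ = Heaviside distribution (with kernel the unit step function), $\delta$ = Dirac distribution. The algebra $\widehat{\mathcal E(\mathbb R)}$ (Todorov and Vernaeve). For $\varphi\in\mathcal D(\mathbb R)$ let $R_\varphi=\sup\{|x|:\varphi(x)\neq0\}$ if $\varphi\ne0$ and $R_\varphi=1$ if $\varphi=0$. Let $\mathcal D_0=\mathcal D(\mathbb R)$ and for $n\ge1$ let $\mathcal D_n$ be the set of real-valued even $\varphi\in\mathcal D(\mathbb R)$ with $R_\varphi\le 1/n$, $\int\varphi=1$, $\int x^j\varphi(x)\,dx=0$ for $1\le j\le n$, $\int|\varphi|\le 1+\frac1n$, and $\sup_x|\varphi^{(j)}(x)|\le R_\varphi^{-2(j+1)}$ for $0\le j\le n$. Fix an ultrafilter $\mathcal U$ on the set $\mathcal D(\mathbb R)$ which contains every $\mathcal D_n$ and is $\mathfrak c^+$-good, $\mathfrak c={\rm card}(\mathbb R)$. A property of $\varphi$ holds "a.e." if the set of $\varphi$ satisfying it belongs to $\mathcal U$. A $\varphi$-net in a set $S$ is a map $\mathcal D(\mathbb R)\to S$, written $(f_\varphi)$. A $\varphi$-net $(A_\varphi)$ in $\mathbb C$ is moderate if $|A_\varphi|\le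 R_\varphi^{-m}$ a.e. for some $m\in\mathbb N$, and negligible if for all $p\in\mathbb N$, $|A_\varphi|\le R_\varphi^{p}$ a.e. A $\varphi$-net $(f_\varphi)$ in $\mathcal E(\mathbb R)$ is moderate if for every compact $K\subset\mathbb R$ and $j\in\mathbb N_0$ there is $m\in\mathbb N$ with $\sup_{K}|f_\varphi^{(j)}|\le R_\varphi^{-m}$ a.e., and negligible if for every compact $K$, every $j\in\mathbb N_0$ and every $p\in\mathbb N$, $\sup_K|f^{(j)}_\varphi|\le R_\varphi^p$ a.e. $\widehat{\mathbb C}$ and $\widehat{\mathcal E(\mathbb R)}$ are the quotients of moderate nets by negligible nets, with class $q(\cdot)$ and componentwise operations (including differentiation in $\widehat{\mathcal E(\mathbb R)}$); $\widehat{\mathbb R}\subset\widehat{\mathbb C}$ consists of classes of real nets and is ordered by: $q(A_\varphi)\geq 0$ iff it has a representative that is $\ge0$ a.e. $\widehat{\mathbb C}$ is identified with $\{f\in\widehat{\mathcal E(\mathbb R)}:f^\prime=0\}$. For $x,y\in\widehat{\mathbb C}$, $x\approx y$ means that $x-y$ is infinitesimal, i.e. $|x-y|<1/n$ for all $n\in\mathbb N$. For $f=q(f_\varphi)\in\widehat{\mathcal E(\mathbb R)}$ and $x\in\mathbb R$, $f(x)=q(f_\varphi(x))\in\widehat{\mathbb C}$. The embedding $\iota:\mathcal D^\prime(\mathbb R)\to\widehat{\mathcal E(\mathbb R)}$ is $\iota(T)=q(T\star\varphi)$ (distributional convolution with $\varphi$). A smooth function $h\in\mathcal E(\mathbb R)$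 is identified with $\iota(h)$, which satisfies $\iota(h)(x)=h(x)$ for $x\in\mathbb R$. For $S\subseteq\mathcal D^\prime(\mathbb R)$, $\widehat{\rm span}(S)=\{\sum_{n=1}^m\alpha_n\,\iota(T_n): m\in\mathbb N,\ T_n\in S,\ \alpha_n\in\widehat{\mathbb C}\}\subseteq\widehat{\mathcal E(\mathbb R)}$. For $T\in\mathcal D_+^\prime(\mathbb R)$ and $f=\sum_{n=1}^m\alpha_n\,\iota(T_n)\in\widehat{\rm span}(\mathcal D_+^\prime(\mathbb R))$, $T\star f:=\sum_{n=1}^m\alpha_n\,\iota(T\star T_n)$, where $T\star T_n$ is the usual convolution in $\mathcal D_+^\prime(\mathbb R)$. *)

theory Defs
  imports "HOL-Analysis.Analysis" "HOL-Algebra.QuotRing"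
begin

section \<open>Smooth functions and test functions\<close>

definition nderiv :: "nat \<Rightarrow> (real \<Rightarrow> complex) \<Rightarrow> real \<Rightarrow> complex" where
  "nderiv j f = ((\<lambda>g x. vector_derivative g (at x)) ^^ j) f"

definition smooth :: "(real \<Rightarrow> complex) \<Rightarrow> bool" where
  "smooth f \<longleftrightarrow> (\<forall>j x. nderiv j f differentiable (at x))"

lemma nderiv_0 [simp]: "nderiv 0 f = f"
  by (simp add: nderiv_def)

lemma nderiv_Suc: "nderiv (Suc j) f = (\<lambda>x. vector_derivative (nderiv j f) (at x))"
  by (simp add: nderiv_def)

lemma nderiv_nderiv: "nderiv i (nderiv j f) = nderiv (i + j) f"
  by (simp add: nderiv_def funpow_add)

lemma smooth_has_nderiv:
  "smooth f \<Longrightarrow> (nderiv j f has_vector_derivative nderiv (Suc j) f x) (at x)"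
  by (simp add: smooth_def nderiv_Suc vector_derivative_works[symmetric])

lemma smooth_nderiv: "smooth f \<Longrightarrow> smooth (nderiv j f)"
  by (simp add: smooth_def nderiv_nderiv)

lemma nderiv_eqI:
  assumes "g 0 = f" "\<And>j x. (g j has_vector_derivative g (Suc j) x) (at x)"
  shows "nderiv j f = g j"
  by (induction j) (use assms in \<open>auto simp: nderiv_Suc vector_derivative_at\<close>)

lemma smoothI:
  assumes "g 0 = f" "\<And>j x. (g j has_vector_derivative g (Suc j) x) (at x)"
  shows "smooth f"
  unfolding smooth_def nderiv_eqI[of g, OF assms]
  using differentiableI_vector[OF assms(2)] by blast

lemma smooth_lincomb:
  assumes "smooth f" "smooth g"
  shows "smooth (\<lambda>x. a * f x + b * g x)"
  by (rule smoothI[where g = "\<lambda>j x. a * nderiv j f x + b * nderiv j g x"])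
    (auto intro!: derivative_eq_intros smooth_has_nderiv assms)

lemma smooth_reflect:
  assumes "smooth f"
  shows "smooth (\<lambda>y. f (x - y))"
proof (rule smoothI[where g = "\<lambda>j y. (-1) ^ j * nderiv j f (x - y)"])
  fix j y
  have "((\<lambda>y. x - y) has_vector_derivative -1) (at y)"
    by (auto intro!: derivative_eq_intros)
  from vector_diff_chain_at[OF this smooth_has_nderiv[OF assms]]
  have "((\<lambda>y. nderiv j f (x - y)) has_vector_derivative (-1) *\<^sub>R nderiv (Suc j) f (x - y)) (at y)"
    by (simp add: o_def)
  from has_vector_derivative_mult_right[OF this, of "(-1) ^ j"]
  show "((\<lambda>y. (-1) ^ j * nderiv j f (x - y)) has_vector_derivative
      (-1) ^ Suc j * nderiv (Suc j) f (x - y)) (at y)" by simp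
qed simp

lemma compact_supportI:
  fixes f g :: "real \<Rightarrow> complex"
  assumes "compact (closure {x. f x \<noteq> 0})" "{x. g x \<noteq> 0} \<subseteq> closure {x. f x \<noteq> 0}"
  shows "compact (closure {x. g x \<noteq> 0})"
  using bounded_subset[OF compact_imp_bounded[OF assms(1)] assms(2)] by (simp add: compact_closure)

typedef test_fun = "{f :: real \<Rightarrow> complex. smooth f \<and> compact (closure {x. f x \<noteq> 0})}"
  morphisms tf Abs_test_fun
proof
  show "(\<lambda>_. 0) \<in> {f :: real \<Rightarrow> complex. smooth f \<and> compact (closure {x. f x \<noteq> 0})}"
    using smoothI[of "\<lambda>_ _. 0"] by simp
qed

setup_lifting type_definition_test_fun

lift_definition test_lincomb :: "complex \<Rightarrow> complex \<Rightarrow> test_fun \<Rightarrow> test_fun \<Rightarrow> test_fun"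
  is "\<lambda>a b f g x. a * f x + b * g x"
proof (safe intro!: smooth_lincomb)
  fix a b and f g :: "real \<Rightarrow> complex"
  assume *: "compact (closure {x. f x \<noteq> 0})" "compact (closure {x. g x \<noteq> 0})"
  have "{x. a * f x + b * g x \<noteq> 0} \<subseteq> closure {x. f x \<noteq> 0} \<union> closure {x. g x \<noteq> 0}"
  proof
    fix x assume "x \<in> {x. a * f x + b * g x \<noteq> 0}"
    then have "x \<in> {x. f x \<noteq> 0} \<or> x \<in> {x. g x \<noteq> 0}" by auto
    then show "x \<in> closure {x. f x \<noteq> 0} \<union> closure {x. g x \<noteq> 0}"
      by (elim disjE) (rule UnI1 UnI2, erule subsetD[OF closure_subset])+
  qed
  from bounded_subset[OF compact_imp_bounded[OF compact_Un[OF *]] this]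
  show "compact (closure {x. a * f x + b * g x \<noteq> 0})"
    by (simp add: compact_closure)
qed

lift_definition test_deriv :: "test_fun \<Rightarrow> test_fun" is "nderiv 1"
proof (safe intro!: smooth_nderiv)
  fix f :: "real \<Rightarrow> complex"
  assume *: "compact (closure {x. f x \<noteq> 0})"
  have "nderiv 1 f x = 0" if "x \<notin> closure {x. f x \<noteq> 0}" for x
  proof -
    have "(f has_vector_derivative 0) (at x)"
    proof (rule has_vector_derivative_transform_within_open)
      show "((\<lambda>_. 0) has_vector_derivative 0) (at x)" by simp
      show "open (- closure {x. f x \<noteq> 0})" by (intro open_Compl closed_closure)
    qed (use that subsetD[OF closure_subset, of _ "{x. f x \<noteq> 0}"] in auto)
    then show ?thesis by (simp add: nderiv_def vector_derivative_at)
  qed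
  then show "compact (closure {x. nderiv 1 f x \<noteq> 0})"
    by (intro compact_supportI[OF *]) auto
qed

lift_definition test_reflect :: "real \<Rightarrow> test_fun \<Rightarrow> test_fun" is "\<lambda>x f y. f (x - y)"
proof (safe intro!: smooth_reflect)
  fix x and f :: "real \<Rightarrow> complex"
  assume *: "compact (closure {x. f x \<noteq> 0})"
  have "compact ((\<lambda>y. x - y) ` closure {x. f x \<noteq> 0})"
    by (intro compact_continuous_image continuous_intros *)
  moreover have "{y. f (x - y) \<noteq> 0} \<subseteq> (\<lambda>y. x - y) ` closure {x. f x \<noteq> 0}"
  proof
    fix y assume "y \<in> {y. f (x - y) \<noteq> 0}"
    then have "x - y \<in> closure {x. f x \<noteq> 0}"
      by (intro subsetD[OF closure_subset]) simp
    then show "y \<in> (\<lambda>y. x - y) ` closure {x. f x \<noteq> 0}"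
      by (rule rev_image_eqI) simp
  qed
  ultimately show "compact (closure {y. f (x - y) \<noteq> 0})"
    by (simp add: compact_closure bounded_subset[OF compact_imp_bounded])
qed


section \<open>Distributions\<close>

text \<open>The operations below are defined for all functionals on the test functions; the predicate
  \<open>distribution\<close> singles out the complex linear, continuous ones.\<close>

definition distribution :: "(test_fun \<Rightarrow> complex) \<Rightarrow> bool" where
  "distribution T \<longleftrightarrow>
     (\<forall>a b \<phi> \<psi>. T (test_lincomb a b \<phi> \<psi>) = a * T \<phi> + b * T \<psi>) \<and>
     (\<forall>K. compact K \<longrightarrow> (\<exists>c N. \<forall>\<phi>. closure {x. tf \<phi> x \<noteq> 0} \<subseteq> K \<longrightarrow>
        cmod (T \<phi>) \<le> c * (\<Sum>j\<le>N. SUP x. cmod (nderiv j (tf \<phi>) x))))"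

text \<open>Support in \<open>[0, \<infinity>)\<close> means vanishing on the open set \<open>(-\<infinity>, 0)\<close>.\<close>

definition distributions_plus :: "(test_fun \<Rightarrow> complex) set" where
  "distributions_plus = {T. distribution T \<and>
     (\<forall>\<phi>. closure {x. tf \<phi> x \<noteq> 0} \<subseteq> {..<0} \<longrightarrow> T \<phi> = 0)}"

definition dist_of :: "(real \<Rightarrow> complex) \<Rightarrow> test_fun \<Rightarrow> complex" where
  "dist_of h \<phi> = (LINT x|lborel. h x * tf \<phi> x)"

definition dirac :: "test_fun \<Rightarrow> complex" where
  "dirac \<phi> = tf \<phi> 0"

definition dist_deriv :: "(test_fun \<Rightarrow> complex) \<Rightarrow> test_fun \<Rightarrow> complex" where
  "dist_deriv T \<phi> = - T (test_deriv \<phi>)"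

definition heaviside :: "real \<Rightarrow> real" where
  "heaviside t = (if t \<ge> 0 then 1 else 0)"

definition conv_test :: "(test_fun \<Rightarrow> complex) \<Rightarrow> test_fun \<Rightarrow> real \<Rightarrow> complex" where
  "conv_test T \<phi> x = T (test_reflect x \<phi>)"

text \<open>The convolution of \<open>S, T\<close> supported in \<open>[0, \<infinity>)\<close> is the functional
  \<open>\<phi> \<mapsto> (S \<otimes> T) (\<phi> (x + y))\<close>. The function \<open>\<phi> (x + y)\<close> is not compactly supported in
  the plane, so it is multiplied by \<open>\<kappa> x * \<kappa> y\<close>, where \<open>\<kappa>\<close> is smooth, equal to 1 near
  \<open>[0, \<infinity>)\<close> and zero near \<open>-\<infinity>\<close>. The value does not depend on the choice of such a \<open>\<kappa>\<close>,
  and both arguments of \<open>Abs_test_fun\<close> are smooth with compact support.\<close>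

definition cutoff :: "(real \<Rightarrow> complex) \<Rightarrow> bool" where
  "cutoff \<kappa> \<longleftrightarrow> smooth \<kappa> \<and> (\<exists>a>0. \<forall>x\<ge>-a. \<kappa> x = 1) \<and> (\<exists>b. \<forall>x\<le>b. \<kappa> x = 0)"

definition conv_plus ::
    "(test_fun \<Rightarrow> complex) \<Rightarrow> (test_fun \<Rightarrow> complex) \<Rightarrow> test_fun \<Rightarrow> complex" where
  "conv_plus S T \<phi> = (let \<kappa> = (SOME \<kappa>. cutoff \<kappa>) in
     S (Abs_test_fun (\<lambda>x. \<kappa> x * T (Abs_test_fun (\<lambda>y. \<kappa> y * tf \<phi> (x + y))))))"


section \<open>The ultrafilter on the test functions\<close>

definition radius :: "test_fun \<Rightarrow> real" where
  "radius \<phi> = (if tf \<phi> = (\<lambda>_. 0) then 1 else Sup {\<bar>x\<bar> | x. tf \<phi> x \<noteq> 0})"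

definition directing_set :: "nat \<Rightarrow> test_fun set" where
  "directing_set n = (if n = 0 then UNIV else {\<phi>.
     (\<forall>x. tf \<phi> x \<in> \<real>) \<and> (\<forall>x. tf \<phi> (- x) = tf \<phi> x) \<and>
     radius \<phi> \<le> 1 / n \<and>
     (LINT x|lborel. tf \<phi> x) = 1 \<and>
     (\<forall>j\<in>{1..n}. (LINT x|lborel. complex_of_real (x ^ j) * tf \<phi> x) = 0) \<and>
     (LINT x|lborel. cmod (tf \<phi> x)) \<le> 1 + 1 / n \<and>
     (\<forall>j\<le>n. \<forall>x. cmod (nderiv j (tf \<phi>) x) \<le> 1 / radius \<phi> ^ (2 * (j + 1)))})"

definition is_ultrafilter :: "'a filter \<Rightarrow> bool" where
  "is_ultrafilter U \<longleftrightarrow>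
     U \<noteq> bot \<and> (\<forall>P. eventually P U \<or> eventually (\<lambda>x. \<not> P x) U)"

text \<open>Goodness for the successor cardinal of the continuum: every order reversing map from the
  finite subsets of a set \<open>\<Gamma>\<close> of cardinality at most the continuum into \<open>U\<close> is refined by a
  multiplicative one. Index sets of this size are, up to bijection, the sets of reals.\<close>

definition continuum_plus_good :: "'a filter \<Rightarrow> bool" where
  "continuum_plus_good U \<longleftrightarrow>
     (\<forall>(\<Gamma> :: real set) (f :: real set \<Rightarrow> 'a set).
        (\<forall>X. finite X \<and> X \<subseteq> \<Gamma> \<longrightarrow> (\<forall>\<^sub>F x in U. x \<in> f X)) \<and>
        (\<forall>X Y. finite Y \<and> X \<subseteq> Y \<and> Y \<subseteq> \<Gamma> \<longrightarrow> f Y \<subseteq> f X) \<longrightarrow>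
        (\<exists>g :: real set \<Rightarrow> 'a set.
          (\<forall>X. finite X \<and> X \<subseteq> \<Gamma> \<longrightarrow> (\<forall>\<^sub>F x in U. x \<in> g X) \<and> g X \<subseteq> f X) \<and>
          (\<forall>X Y. finite X \<and> X \<subseteq> \<Gamma> \<and> finite Y \<and> Y \<subseteq> \<Gamma> \<longrightarrow> g (X \<union> Y) = g X \<inter> g Y)))"

definition admissible_ultrafilter :: "test_fun filter \<Rightarrow> bool" where
  "admissible_ultrafilter U \<longleftrightarrow>
     is_ultrafilter U \<and> (\<forall>n. \<forall>\<^sub>F \<phi> in U. \<phi> \<in> directing_set n) \<and> continuum_plus_good U"


section \<open>Generalized numbers and generalized functions\<close>

definition cmod_nets :: "test_fun filter \<Rightarrow> (test_fun \<Rightarrow> complex) ring" where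
  "cmod_nets U = \<lparr>
     carrier = {A. \<exists>m. \<forall>\<^sub>F \<phi> in U. cmod (A \<phi>) \<le> 1 / radius \<phi> ^ m},
     mult = (\<lambda>A B \<phi>. A \<phi> * B \<phi>), one = (\<lambda>\<phi>. 1),
     zero = (\<lambda>\<phi>. 0), add = (\<lambda>A B \<phi>. A \<phi> + B \<phi>)\<rparr>"

definition cneg_nets :: "test_fun filter \<Rightarrow> (test_fun \<Rightarrow> complex) set" where
  "cneg_nets U = {A. \<forall>p. \<forall>\<^sub>F \<phi> in U. cmod (A \<phi>) \<le> radius \<phi> ^ p}"

definition emod_nets :: "test_fun filter \<Rightarrow> (test_fun \<Rightarrow> real \<Rightarrow> complex) ring" where
  "emod_nets U = \<lparr>
     carrier = {f. (\<forall>\<phi>. smooth (f \<phi>)) \<and> (\<forall>K j. compact K \<longrightarrow>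
       (\<exists>m. \<forall>\<^sub>F \<phi> in U. \<forall>x\<in>K. cmod (nderiv j (f \<phi>) x) \<le> 1 / radius \<phi> ^ m))},
     mult = (\<lambda>f g \<phi> x. f \<phi> x * g \<phi> x), one = (\<lambda>\<phi> x. 1),
     zero = (\<lambda>\<phi> x. 0), add = (\<lambda>f g \<phi> x. f \<phi> x + g \<phi> x)\<rparr>"

definition eneg_nets :: "test_fun filter \<Rightarrow> (test_fun \<Rightarrow> real \<Rightarrow> complex) set" where
  "eneg_nets U = {f. (\<forall>\<phi>. smooth (f \<phi>)) \<and> (\<forall>K j p. compact K \<longrightarrow>
     (\<forall>\<^sub>F \<phi> in U. \<forall>x\<in>K. cmod (nderiv j (f \<phi>) x) \<le> radius \<phi> ^ p))}"

type_synonym gen_num = "(test_fun \<Rightarrow> complex) set"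
type_synonym gen_fun = "(test_fun \<Rightarrow> real \<Rightarrow> complex) set"

definition Chat :: "test_fun filter \<Rightarrow> gen_num ring" where
  "Chat U = cmod_nets U Quot cneg_nets U"

definition Ehat :: "test_fun filter \<Rightarrow> gen_fun ring" where
  "Ehat U = emod_nets U Quot eneg_nets U"

definition cclass :: "test_fun filter \<Rightarrow> (test_fun \<Rightarrow> complex) \<Rightarrow> gen_num" where
  "cclass U A = cneg_nets U +>\<^bsub>cmod_nets U\<^esub> A"

definition eclass :: "test_fun filter \<Rightarrow> (test_fun \<Rightarrow> real \<Rightarrow> complex) \<Rightarrow> gen_fun" where
  "eclass U f = eneg_nets U +>\<^bsub>emod_nets U\<^esub> f"

text \<open>Operations on classes are the unions of the classes obtained from all representatives;
  these classes coincide.\<close>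

definition gfun_deriv :: "test_fun filter \<Rightarrow> gen_fun \<Rightarrow> gen_fun" where
  "gfun_deriv U F = (\<Union>f\<in>F. eclass U (\<lambda>\<phi>. nderiv 1 (f \<phi>)))"

definition gval :: "test_fun filter \<Rightarrow> gen_fun \<Rightarrow> real \<Rightarrow> gen_num" where
  "gval U F x = (\<Union>f\<in>F. cclass U (\<lambda>\<phi>. f \<phi> x))"

definition num :: "test_fun filter \<Rightarrow> complex \<Rightarrow> gen_num" where
  "num U c = cclass U (\<lambda>\<phi>. c)"

text \<open>Through this map generalized numbers are identified with the generalized functions of
  derivative zero.\<close>

definition const_fun :: "test_fun filter \<Rightarrow> gen_num \<Rightarrow> gen_fun" where
  "const_fun U A = (\<Union>a\<in>A. eclass U (\<lambda>\<phi> x. a \<phi>))"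

definition gscale :: "test_fun filter \<Rightarrow> gen_num \<Rightarrow> gen_fun \<Rightarrow> gen_fun"
    (\<open>(_ \<cdot>\<index> _)\<close> [71, 71] 70) where
  "A \<cdot>\<^bsub>U\<^esub> F = const_fun U A \<otimes>\<^bsub>Ehat U\<^esub> F"

definition Rhat :: "test_fun filter \<Rightarrow> gen_num set" where
  "Rhat U = {cclass U A | A. A \<in> carrier (cmod_nets U) \<and> (\<forall>\<phi>. A \<phi> \<in> \<real>)}"

definition gnonneg :: "test_fun filter \<Rightarrow> gen_num \<Rightarrow> bool" where
  "gnonneg U X \<longleftrightarrow> X \<in> Rhat U \<and> (\<exists>A\<in>X. \<forall>\<^sub>F \<phi> in U. A \<phi> \<in> \<real> \<and> Re (A \<phi>) \<ge> 0)"

definition gless :: "test_fun filter \<Rightarrow> gen_num \<Rightarrow> gen_num \<Rightarrow> bool" where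
  "gless U X Y \<longleftrightarrow> X \<in> Rhat U \<and> Y \<in> Rhat U \<and> X \<noteq> Y \<and> gnonneg U (Y \<ominus>\<^bsub>Chat U\<^esub> X)"

definition gabs :: "test_fun filter \<Rightarrow> gen_num \<Rightarrow> gen_num" where
  "gabs U X = (\<Union>A\<in>X. cclass U (\<lambda>\<phi>. complex_of_real (cmod (A \<phi>))))"

definition gapprox :: "test_fun filter \<Rightarrow> gen_num \<Rightarrow> gen_num \<Rightarrow> bool" where
  "gapprox U X Y \<longleftrightarrow> X \<in> carrier (Chat U) \<and> Y \<in> carrier (Chat U) \<and>
     (\<forall>n::nat. n \<ge> 1 \<longrightarrow> gless U (gabs U (X \<ominus>\<^bsub>Chat U\<^esub> Y)) (num U (1 / of_nat n)))"


section \<open>Embedding of distributions, span and convolution\<close>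

definition iota :: "test_fun filter \<Rightarrow> (test_fun \<Rightarrow> complex) \<Rightarrow> gen_fun" where
  "iota U T = eclass U (\<lambda>\<phi>. conv_test T \<phi>)"

definition span_hat :: "test_fun filter \<Rightarrow> (test_fun \<Rightarrow> complex) set \<Rightarrow> gen_fun set" where
  "span_hat U S = {f. \<exists>(m::nat) \<alpha> T. m \<ge> 1 \<and>
     (\<forall>n\<in>{1..m}. \<alpha> n \<in> carrier (Chat U) \<and> T n \<in> S) \<and>
     f = (\<Oplus>\<^bsub>Ehat U\<^esub>n\<in>{1..m}. \<alpha> n \<cdot>\<^bsub>U\<^esub> iota U (T n))}"

definition gconv :: "test_fun filter \<Rightarrow> (test_fun \<Rightarrow> complex) \<Rightarrow> gen_fun \<Rightarrow> gen_fun" where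
  "gconv U T f = (THE h. \<exists>(m::nat) \<alpha> S. m \<ge> 1 \<and>
     (\<forall>n\<in>{1..m}. \<alpha> n \<in> carrier (Chat U) \<and> S n \<in> distributions_plus) \<and>
     f = (\<Oplus>\<^bsub>Ehat U\<^esub>n\<in>{1..m}. \<alpha> n \<cdot>\<^bsub>U\<^esub> iota U (S n)) \<and>
     h = (\<Oplus>\<^bsub>Ehat U\<^esub>n\<in>{1..m}. \<alpha> n \<cdot>\<^bsub>U\<^esub> iota U (conv_plus T (S n))))"


section \<open>The initial value problem\<close>

definition kirchhoff_ivp ::
    "test_fun filter \<Rightarrow> real \<Rightarrow> real \<Rightarrow> real \<Rightarrow> gen_fun \<Rightarrow> gen_fun \<Rightarrow> bool" where
  "kirchhoff_ivp U L R C V I \<longleftrightarrow> I \<in> carrier (Ehat U) \<and>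
     num U L \<cdot>\<^bsub>U\<^esub> gfun_deriv U (gfun_deriv U I) \<oplus>\<^bsub>Ehat U\<^esub> num U R \<cdot>\<^bsub>U\<^esub> gfun_deriv U I
       \<oplus>\<^bsub>Ehat U\<^esub> num U (1 / C) \<cdot>\<^bsub>U\<^esub> I = gfun_deriv U V \<and>
     gval U I 0 = \<zero>\<^bsub>Chat U\<^esub> \<and>
     num U L \<otimes>\<^bsub>Chat U\<^esub> gval U (gfun_deriv U I) 0 = \<zero>\<^bsub>Chat U\<^esub>"

end

theory Submission
  imports Defs "HOL-Library.Function_Algebras"
begin

text \<open>
  Every object in the theorem is the class of a net indexed by test functions \<open>\<phi>\<close>, and the proof
  works with representatives. The derivative of \<open>V = \<Sum> \<alpha>\<^sub>n \<iota>(T\<^sub>n)\<close> is represented by the smooth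
  functions \<open>h\<^sub>\<phi> = \<Sum> a\<^sub>n(\<phi>) (T\<^sub>n' \<star> \<phi>)\<close>, which vanish to the left of minus the radius of \<open>\<phi>\<close>.

  The kernels \<open>g, G, G', G\<^sub>0, G\<^sub>0'\<close> all have the form \<open>H(t) (c exp (l t) + d exp (m t))\<close>, where
  \<open>l\<close> and \<open>m\<close> are the characteristic roots of the equation. Convolution with \<open>H(t) exp (l t)\<close> acts on
  representatives as the integral operator \<open>u(x) = \<integral>\<^sub>0\<^sup>\<infinity> exp (l t) h(x - t) dt\<close>
  (\<open>conv_test_conv_plus\<close>), and \<open>u\<close> is the solution of \<open>u' = l u + h\<close> that vanishes on the left.
  Hence the convolution of \<open>V'\<close> with the fundamental solution \<open>g\<close>, \<open>G\<close> or \<open>G\<^sub>0 / L\<close> solves the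
  equation exactly, for every single \<open>\<phi>\<close>, and subtracting a solution of the homogeneous
  equation corrects the initial values.

  The analytic core is one estimate, \<open>controlled_linear_ode\<close>: if \<open>u' = l u + h\<close>, then moderateness or
  negligibility of \<open>h\<close> and of the values of \<open>u\<close> at one point is inherited by \<open>u\<close> with all its
  derivatives. From a point to the left of all supports it shows that convolution with the kernels
  preserves moderate and negligible nets, so that the convolution does not depend on how a
  generalized function is written as a sum (\<open>gconv_causal_dist\<close>). From the point 0, and after
  factoring \<open>L D\<^sup>2 + R D + 1/C = L (D - l) (D - m)\<close>, it shows that a solution with negligible data is
  negligible, which is uniqueness (\<open>second_order_ivp_iff\<close>).

  The remaining claims are about values at the origin. The vanishing moments of \<open>\<phi>\<close> give
  \<open>\<integral> exp (l y) \<phi>(y) dy = 1\<close> up to a negligible error, so an embedded exponential is the class of the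
  exponential itself (\<open>iota_exp_kernel\<close>). Since \<open>\<phi>\<close> is even, it has half of its mass on each side of
  the origin, and an embedded causal kernel takes at 0 half of the value to which it jumps,
  up to an infinitesimal (\<open>gapprox_causal_dist\<close>) that vanishes for the cosine
  (\<open>gval_even_causal_dist\<close>).
\<close>

section \<open>Calculus of smooth functions\<close>

lemma smooth_isCont: "smooth f \<Longrightarrow> isCont (nderiv j f) x"
  by (meson smooth_has_nderiv has_vector_derivative_continuous)

lemma smooth_continuous_on: "smooth f \<Longrightarrow> continuous_on S (nderiv j f)"
  by (simp add: continuous_at_imp_continuous_on smooth_isCont)

lemma smooth_imp_continuous_on: "smooth f \<Longrightarrow> continuous_on S f"
  using smooth_continuous_on[of f S 0] by simp

lemma smooth_has_vector_derivative:
  "smooth f \<Longrightarrow> (f has_vector_derivative nderiv 1 f x) (at x)"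
  using smooth_has_nderiv[of f 0 x] by simp

lemma nderiv_1I: "(\<And>x. (f has_vector_derivative f' x) (at x)) \<Longrightarrow> nderiv 1 f = f'"
  by (auto simp: nderiv_Suc vector_derivative_at)

lemma nderiv_lincomb:
  assumes "smooth f" "smooth g"
  shows "nderiv j (\<lambda>x. a * f x + b * g x) = (\<lambda>x. a * nderiv j f x + b * nderiv j g x)"
  by (rule nderiv_eqI[where g = "\<lambda>j x. a * nderiv j f x + b * nderiv j g x"])
    (auto intro!: derivative_eq_intros smooth_has_nderiv assms)

lemma nderiv_const: "nderiv j (\<lambda>x. c) = (\<lambda>x. if j = 0 then c else 0)"
  by (rule nderiv_eqI[where g = "\<lambda>j x. if j = 0 then c else 0"]) auto

lemma smooth_const: "smooth (\<lambda>x. c)"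
  by (rule smoothI[where g = "\<lambda>j x. if j = 0 then c else 0"]) auto

lemma smooth_add: "smooth f \<Longrightarrow> smooth g \<Longrightarrow> smooth (\<lambda>x. f x + g x)"
  using smooth_lincomb[of f g 1 1] by simp

lemma nderiv_add:
  "smooth f \<Longrightarrow> smooth g \<Longrightarrow> nderiv j (\<lambda>x. f x + g x) = (\<lambda>x. nderiv j f x + nderiv j g x)"
  using nderiv_lincomb[of f g j 1 1] by simp

lemma smooth_cmult: "smooth f \<Longrightarrow> smooth (\<lambda>x. c * f x)"
  using smooth_lincomb[of f f c 0] by simp

lemma nderiv_cmult: "smooth f \<Longrightarrow> nderiv j (\<lambda>x. c * f x) = (\<lambda>x. c * nderiv j f x)"
  using nderiv_lincomb[of f f j c 0] by simp

lemma smooth_sum: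
  "(\<And>i. i \<in> A \<Longrightarrow> smooth (f i)) \<Longrightarrow> smooth (\<lambda>x. \<Sum>i\<in>A. f i x)"
  by (induction A rule: infinite_finite_induct) (auto intro: smooth_add smooth_const)

lemma nderiv_sum:
  "(\<And>i. i \<in> A \<Longrightarrow> smooth (f i)) \<Longrightarrow>
    nderiv j (\<lambda>x. \<Sum>i\<in>A. f i x) = (\<lambda>x. \<Sum>i\<in>A. nderiv j (f i) x)"
  by (induction A rule: infinite_finite_induct) (auto simp: nderiv_add smooth_sum nderiv_const)

text \<open>The derivatives of a product, spread out one differentiation at a time. Compared with the binomial
  form, both the derivative rule and the estimates become plain inductions.\<close>

primrec leibniz :: "nat \<Rightarrow> (real \<Rightarrow> complex) \<Rightarrow> (real \<Rightarrow> complex) \<Rightarrow> real \<Rightarrow> complex" where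
  "leibniz 0 f g = (\<lambda>x. f x * g x)"
| "leibniz (Suc j) f g = (\<lambda>x. leibniz j (nderiv 1 f) g x + leibniz j f (nderiv 1 g) x)"

lemma leibniz_has_derivative:
  "smooth f \<Longrightarrow> smooth g \<Longrightarrow>
    (leibniz j f g has_vector_derivative leibniz (Suc j) f g x) (at x)"
proof (induction j arbitrary: f g)
  case 0
  show ?case
    using has_vector_derivative_mult[OF smooth_has_vector_derivative[OF 0(1)]
        smooth_has_vector_derivative[OF 0(2)], of x] by (simp add: add.commute)
next
  case (Suc j)
  show ?case
    using has_vector_derivative_add[OF Suc.IH[OF smooth_nderiv[OF Suc(2), of 1] Suc(3)]
        Suc.IH[OF Suc(2) smooth_nderiv[OF Suc(3), of 1]]] by simp
qed

lemma smooth_mult: "smooth f \<Longrightarrow> smooth g \<Longrightarrow> smooth (\<lambda>x. f x * g x)"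
  by (rule smoothI[where g = "\<lambda>j. leibniz j f g"]) (simp_all add: leibniz_has_derivative del: leibniz.simps(2))

lemma nderiv_mult: "smooth f \<Longrightarrow> smooth g \<Longrightarrow> nderiv j (\<lambda>x. f x * g x) = leibniz j f g"
  by (rule nderiv_eqI[where g = "\<lambda>j. leibniz j f g"]) (simp_all add: leibniz_has_derivative del: leibniz.simps(2))

text \<open>The equation expresses each derivative of \<open>u\<close> by the preceding one and by \<open>h\<close>, so a single
  differentiability assumption yields all of them.\<close>

lemma smooth_of_linear_ode:
  assumes "\<And>x. (u has_vector_derivative l * u x + h x) (at x)" "smooth h"
  shows "smooth u" "nderiv (Suc j) u = (\<lambda>x. l * nderiv j u x + nderiv j h x)"
proof -
  define g where "g = rec_nat u (\<lambda>j g x. l * g x + nderiv j h x)"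
  have g0: "g 0 = u" and gS: "g (Suc j) = (\<lambda>x. l * g j x + nderiv j h x)" for j
    by (simp_all add: g_def)
  have d: "(g j has_vector_derivative g (Suc j) x) (at x)" for j x
  proof (induction j arbitrary: x)
    case 0 then show ?case using assms(1) by (simp add: gS g0)
  next
    case (Suc j)
    show ?case
      unfolding gS[of "Suc j"]
      by (subst gS) (auto intro!: derivative_eq_intros Suc smooth_has_nderiv assms(2))
  qed
  show "smooth u" by (rule smoothI[OF g0 d])
  show "nderiv (Suc j) u = (\<lambda>x. l * nderiv j u x + nderiv j h x)"
    unfolding nderiv_eqI[of g, OF g0 d] gS by simp
qed

lemma exp_has_vector_derivative:
  "((\<lambda>x. exp (l * complex_of_real x)) has_vector_derivative l * exp (l * of_real x)) (at x)"
proof -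
  have "((\<lambda>x. exp (l * x)) has_field_derivative exp (l * of_real x) * l) (at (of_real x))"
    by (auto intro!: derivative_eq_intros)
  from has_vector_derivative_real_field[OF this] show ?thesis by (simp add: mult.commute)
qed

lemma smooth_exp: "smooth (\<lambda>x. exp (l * complex_of_real x))"
  by (rule smoothI[where g = "\<lambda>j x. l ^ j * exp (l * complex_of_real x)"])
    (auto intro!: derivative_eq_intros exp_has_vector_derivative)

text \<open>Integration starts one unit to the left of \<open>b\<close>, so that all points that are not to the left of
  \<open>b\<close> are interior to the interval of integration.\<close>

lemma antiderivative_vanishing_left:
  fixes h :: "real \<Rightarrow> complex"
  assumes cont: "continuous_on UNIV h" and zero: "\<And>x. x < b \<Longrightarrow> h x = 0"
  shows "\<exists>P. (\<forall>x. (P has_vector_derivative h x) (at x)) \<and> (\<forall>x<b. P x = 0)"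
proof -
  define P where "P x = integral {b - 1..x} h" for x
  have P0: "P x = 0" if "x < b" for x
    unfolding P_def using that zero integral_cong[of "{b - 1..x}" h "\<lambda>_. 0"] by simp
  have "(P has_vector_derivative h x) (at x)" for x
  proof (cases "x < b")
    case True
    have "((\<lambda>_. 0) has_vector_derivative 0) (at x)" by simp
    then have "(P has_vector_derivative 0) (at x)"
      by (rule has_vector_derivative_transform_within_open[where S = "{..<b}"])
        (use True P0 in auto)
    then show ?thesis using zero True by simp
  next
    case False
    have "((\<lambda>x. integral {b - 1..x} h) has_vector_derivative h x) (at x within {b - 1..x + 1})"
      by (rule integral_has_vector_derivative)
        (use False cont continuous_on_subset in auto)
    moreover have "at x within {b - 1..x + 1} = at x"
      by (rule at_within_interior) (use False in auto)
    ultimately show ?thesis unfolding P_def by simp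
  qed
  with P0 show ?thesis by blast
qed

text \<open>Variation of constants: \<open>exp (-l s) * u s\<close> has the derivative \<open>exp (-l s) * h s\<close>, and the mean
  value inequality bounds its increment between \<open>x0\<close> and \<open>x\<close>.\<close>

lemma linear_ode_bound:
  fixes u h :: "real \<Rightarrow> complex"
  assumes ode: "\<And>x. (u has_vector_derivative l * u x + h x) (at x)"
    and h: "\<And>s. \<bar>s\<bar> \<le> M \<Longrightarrow> cmod (h s) \<le> B"
    and x: "\<bar>x\<bar> \<le> M" and x0: "\<bar>x0\<bar> \<le> M"
  shows "cmod (u x) \<le> exp (cmod l * (2 * M)) * (cmod (u x0) + exp (cmod l * (2 * M)) * B * (2 * M))"
proof -
  define e where "e = exp (cmod l * (2 * M))"
  define w where "w s = exp (- l * of_real s) * (exp (l * of_real x0) * u s)" for s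
  have w': "(w has_vector_derivative exp (- l * of_real s) * (exp (l * of_real x0) * h s)) (at s)" for s
    unfolding w_def
    by (rule derivative_eq_intros exp_has_vector_derivative ode refl)+ (simp add: algebra_simps)
  have exp_le: "cmod (exp (- l * of_real s) * (exp (l * of_real t) * z)) \<le> e * cmod z"
    if "\<bar>s\<bar> \<le> M" "\<bar>t\<bar> \<le> M" for s t z
  proof -
    have "cmod (exp (- l * of_real s) * exp (l * of_real t)) = cmod (exp (l * of_real (t - s)))"
      by (simp add: exp_add[symmetric] algebra_simps)
    also have "\<dots> \<le> exp (cmod (l * of_real (t - s)))" by (rule norm_exp)
    also have "\<dots> \<le> e"
      unfolding e_def norm_mult norm_of_real using that by (auto intro!: mult_left_mono)
    finally have "cmod (exp (- l * of_real s) * exp (l * of_real t)) * cmod z \<le> e * cmod z"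
      by (rule mult_right_mono) simp
    then show ?thesis by (simp add: norm_mult mult.assoc)
  qed
  have "norm (w x - w x0) \<le> e * B * norm (x - x0)"
  proof (rule differentiable_bound[where S = "{-M..M}"])
    fix s assume s: "s \<in> {-M..M}"
    show "(w has_derivative (\<lambda>t. t *\<^sub>R (exp (- l * of_real s) * (exp (l * of_real x0) * h s))))
        (at s within {-M..M})"
      using w'[of s] by (auto simp: has_vector_derivative_def intro: has_derivative_at_withinI)
    have "cmod (exp (- l * of_real s) * (exp (l * of_real x0) * h s)) \<le> e * cmod (h s)"
      using s x0 by (intro exp_le) auto
    also have "\<dots> \<le> e * B" using s by (intro mult_left_mono h) (auto simp: e_def)
    finally show "onorm (\<lambda>t. t *\<^sub>R (exp (- l * of_real s) * (exp (l * of_real x0) * h s))) \<le> e * B"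
      by (intro onorm_le) (auto simp: mult.commute[of "\<bar>_\<bar>"] intro!: mult_right_mono)
  qed (use x x0 in auto)
  also have "\<dots> \<le> e * B * (2 * M)"
  proof -
    have "0 \<le> B" using h[OF x] norm_ge_zero[of "h x"] by linarith
    then show ?thesis using x x0 by (intro mult_left_mono) (auto simp: e_def)
  qed
  finally have 1: "cmod (w x) \<le> cmod (w x0) + e * B * (2 * M)"
    using norm_triangle_ineq2[of "w x" "w x0"] by linarith
  have wx0: "w x0 = u x0" by (simp add: w_def mult.assoc[symmetric] exp_add[symmetric])
  have "u x = exp (- l * of_real x0) * (exp (l * of_real x) * w x)"
    unfolding w_def by (simp add: exp_minus field_simps)
  then have "cmod (u x) \<le> e * cmod (w x)" using exp_le[OF x0 x] by simp
  also have "\<dots> \<le> e * (cmod (u x0) + e * B * (2 * M))"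
    using 1 wx0 by (intro mult_left_mono) (auto simp: e_def)
  finally show ?thesis by (simp add: e_def)
qed

section \<open>The size of nets\<close>

lemma smooth_tf: "smooth (tf \<phi>)"
  using tf[of \<phi>] by simp

lemma compact_support_tf: "compact (closure {x. tf \<phi> x \<noteq> 0})"
  using tf[of \<phi>] by simp

lemma abs_le_radius: "tf \<phi> x \<noteq> 0 \<Longrightarrow> \<bar>x\<bar> \<le> radius \<phi>"
proof -
  assume x: "tf \<phi> x \<noteq> 0"
  have "bounded {x. tf \<phi> x \<noteq> 0}"
    using compact_imp_bounded[OF compact_support_tf] closure_subset by (rule bounded_subset)
  then obtain b where "\<And>x. tf \<phi> x \<noteq> 0 \<Longrightarrow> \<bar>x\<bar> \<le> b" by (auto simp: bounded_real)
  then have "bdd_above {\<bar>x\<bar> |x. tf \<phi> x \<noteq> 0}" by (auto intro!: bdd_aboveI[of _ b])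
  then show ?thesis using x by (auto simp: radius_def intro!: cSup_upper)
qed

lemma tf_outside_radius: "radius \<phi> < \<bar>x\<bar> \<Longrightarrow> tf \<phi> x = 0"
  using abs_le_radius[of \<phi> x] by linarith

text \<open>A continuous function cannot be nonzero at the origin only.\<close>

lemma radius_pos [simp]: "0 < radius \<phi>"
proof (cases "tf \<phi> = (\<lambda>_. 0)")
  case True then show ?thesis by (simp add: radius_def)
next
  case False
  then obtain x where x: "tf \<phi> x \<noteq> 0" by auto
  have "isCont (tf \<phi>) x" using smooth_isCont[OF smooth_tf[of \<phi>], of x 0] by simp
  then have "\<forall>\<^sub>F y in at x. tf \<phi> y \<noteq> 0"
    using x by (auto simp: isCont_def intro: tendsto_imp_eventually_ne)
  then obtain d where d: "d > 0" "\<And>y. y \<noteq> x \<Longrightarrow> dist y x < d \<Longrightarrow> tf \<phi> y \<noteq> 0"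
    by (auto simp: eventually_at)
  \<comment> \<open>a point of the support other than 0\<close>
  obtain y where "y \<noteq> 0" "tf \<phi> y \<noteq> 0"
  proof (cases "x = 0")
    case True
    then show ?thesis using d(1) d(2)[of "d / 2"] that[of "d / 2"] by auto
  qed (use x that in auto)
  then show ?thesis using abs_le_radius[of \<phi> y] by linarith
qed

lemma radius_nonneg [simp]: "0 \<le> radius \<phi>" and radius_nonzero [simp]: "radius \<phi> \<noteq> 0"
  using radius_pos[of \<phi>] by linarith+

locale admissible =
  fixes U :: "test_fun filter"
  assumes adm: "admissible_ultrafilter U"
begin

lemma eventually_directing_set: "\<forall>\<^sub>F \<phi> in U. \<phi> \<in> directing_set n"
  using adm by (simp add: admissible_ultrafilter_def)

lemma U_nontrivial: "U \<noteq> bot"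
  using adm by (simp add: admissible_ultrafilter_def is_ultrafilter_def)

lemma eventually_radius_le:
  assumes "0 < e" shows "\<forall>\<^sub>F \<phi> in U. radius \<phi> \<le> e"
proof -
  obtain n :: nat where n: "n > 0" "1 / real n < e"
    using reals_Archimedean[OF assms] by (metis inverse_eq_divide zero_less_Suc)
  show ?thesis using eventually_directing_set[of n]
    by eventually_elim (use n in \<open>auto simp: directing_set_def\<close>)
qed

definition moderate :: "(test_fun \<Rightarrow> real) \<Rightarrow> bool" where
  "moderate B \<longleftrightarrow> (\<exists>m. \<forall>\<^sub>F \<phi> in U. B \<phi> \<le> 1 / radius \<phi> ^ m)"

definition negligible_net :: "(test_fun \<Rightarrow> real) \<Rightarrow> bool" where
  "negligible_net B \<longleftrightarrow> (\<forall>p. \<forall>\<^sub>F \<phi> in U. B \<phi> \<le> radius \<phi> ^ p)"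

text \<open>Moderate and negligible nets obey the same closure rules. Stating these, and all estimates built on
  them, for both classes at once gives the carrier and the ideal of each quotient from one proof.\<close>

definition size_class :: "((test_fun \<Rightarrow> real) \<Rightarrow> bool) \<Rightarrow> bool" where
  "size_class P \<longleftrightarrow> P = moderate \<or> P = negligible_net"

lemma size_class_moderate [simp]: "size_class moderate"
  and size_class_negligible [simp]: "size_class negligible_net"
  by (auto simp: size_class_def)

lemma size_class_mono:
  assumes "size_class P" "P B" "\<forall>\<^sub>F \<phi> in U. A \<phi> \<le> B \<phi>"
  shows "P A"
  using assms(1) unfolding size_class_def
proof
  assume P: "P = moderate"
  then obtain m where "\<forall>\<^sub>F \<phi> in U. B \<phi> \<le> 1 / radius \<phi> ^ m" using assms(2) by (auto simp: moderate_def)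
  with assms(3) have "\<forall>\<^sub>F \<phi> in U. A \<phi> \<le> 1 / radius \<phi> ^ m" by eventually_elim linarith
  then show ?thesis using P by (auto simp: moderate_def)
next
  assume P: "P = negligible_net"
  have "\<forall>\<^sub>F \<phi> in U. A \<phi> \<le> radius \<phi> ^ p" for p
  proof -
    have "\<forall>\<^sub>F \<phi> in U. B \<phi> \<le> radius \<phi> ^ p" using assms(2) P by (auto simp: negligible_net_def)
    with assms(3) show ?thesis by eventually_elim linarith
  qed
  then show ?thesis using P by (auto simp: negligible_net_def)
qed

lemma radius_power_shrink:
  assumes "radius \<phi> \<le> 1" "m \<le> n"
  shows "1 / radius \<phi> ^ m \<le> 1 / radius \<phi> ^ n"
  using assms by (intro divide_left_mono power_decreasing) auto

lemma size_class_add: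
  assumes "size_class P" "P A" "P B"
  shows "P (\<lambda>\<phi>. A \<phi> + B \<phi>)"
  using assms(1) unfolding size_class_def
proof
  assume P: "P = moderate"
  then obtain m n where 1: "\<forall>\<^sub>F \<phi> in U. A \<phi> \<le> 1 / radius \<phi> ^ m"
    and 2: "\<forall>\<^sub>F \<phi> in U. B \<phi> \<le> 1 / radius \<phi> ^ n"
    using assms(2,3) by (auto simp: moderate_def)
  have half: "\<forall>\<^sub>F \<phi> in U. radius \<phi> \<le> 1 / 2" by (rule eventually_radius_le) simp
  have "\<forall>\<^sub>F \<phi> in U. A \<phi> + B \<phi> \<le> 1 / radius \<phi> ^ Suc (max m n)"
    using 1 2 half
  proof eventually_elim
    case (elim \<phi>)
    define q where "q = 1 / radius \<phi> ^ max m n"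
    have "A \<phi> \<le> q" "B \<phi> \<le> q"
      using radius_power_shrink[of \<phi> m "max m n"] radius_power_shrink[of \<phi> n "max m n"] elim
      unfolding q_def by auto
    moreover have "2 * q \<le> 1 / radius \<phi> * q"
      by (rule mult_right_mono) (use elim in \<open>auto simp: q_def field_simps\<close>)
    ultimately show ?case by (simp add: q_def)
  qed
  then show ?thesis unfolding P moderate_def by blast
next
  assume P: "P = negligible_net"
  have "\<forall>\<^sub>F \<phi> in U. A \<phi> + B \<phi> \<le> radius \<phi> ^ p" for p
  proof -
    have "\<forall>\<^sub>F \<phi> in U. A \<phi> \<le> radius \<phi> ^ Suc p" "\<forall>\<^sub>F \<phi> in U. B \<phi> \<le> radius \<phi> ^ Suc p"
      using assms(2,3) unfolding P negligible_net_def by blast+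
    moreover have "\<forall>\<^sub>F \<phi> in U. radius \<phi> \<le> 1 / 2" by (rule eventually_radius_le) simp
    ultimately show ?thesis
    proof eventually_elim
      case (elim \<phi>)
      have "radius \<phi> * radius \<phi> ^ p \<le> 1 / 2 * radius \<phi> ^ p"
        by (rule mult_right_mono) (use elim in auto)
      moreover have "1 / 2 * radius \<phi> ^ p + 1 / 2 * radius \<phi> ^ p = radius \<phi> ^ p" by simp
      ultimately show ?case using elim unfolding power_Suc by linarith
    qed
  qed
  then show ?thesis using P by (auto simp: negligible_net_def)
qed

lemma size_class_mult:
  assumes "size_class P" "moderate A" "P B"
    and nonneg: "\<forall>\<^sub>F \<phi> in U. 0 \<le> A \<phi>" "\<forall>\<^sub>F \<phi> in U. 0 \<le> B \<phi>"
  shows "P (\<lambda>\<phi>. A \<phi> * B \<phi>)"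
proof -
  obtain m where m: "\<forall>\<^sub>F \<phi> in U. A \<phi> \<le> 1 / radius \<phi> ^ m"
    using assms(2) by (auto simp: moderate_def)
  show ?thesis
    using assms(1) unfolding size_class_def
  proof
    assume P: "P = moderate"
    then obtain n where "\<forall>\<^sub>F \<phi> in U. B \<phi> \<le> 1 / radius \<phi> ^ n"
      using assms(3) by (auto simp: moderate_def)
    with m nonneg have "\<forall>\<^sub>F \<phi> in U. A \<phi> * B \<phi> \<le> 1 / radius \<phi> ^ (m + n)"
    proof eventually_elim
      case (elim \<phi>)
      then have "A \<phi> * B \<phi> \<le> 1 / radius \<phi> ^ m * (1 / radius \<phi> ^ n)"
        by (intro mult_mono) auto
      then show ?case by (simp add: power_add)
    qed
    then show ?thesis using P by (auto simp: moderate_def)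
  next
    assume P: "P = negligible_net"
    have "\<forall>\<^sub>F \<phi> in U. A \<phi> * B \<phi> \<le> radius \<phi> ^ p" for p
    proof -
      have "\<forall>\<^sub>F \<phi> in U. B \<phi> \<le> radius \<phi> ^ (m + p)"
        using assms(3) P by (auto simp: negligible_net_def)
      with m nonneg show ?thesis
      proof eventually_elim
        case (elim \<phi>)
        then have "A \<phi> * B \<phi> \<le> 1 / radius \<phi> ^ m * radius \<phi> ^ (m + p)"
          by (intro mult_mono) auto
        then show ?case by (simp add: power_add)
      qed
    qed
    then show ?thesis using P by (auto simp: negligible_net_def)
  qed
qed

lemma moderate_const: "moderate (\<lambda>\<phi>. c)"
proof -
  have "\<forall>\<^sub>F \<phi> in U. radius \<phi> \<le> 1 / (\<bar>c\<bar> + 1)" by (rule eventually_radius_le) simp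
  then have "\<forall>\<^sub>F \<phi> in U. c \<le> 1 / radius \<phi> ^ 1"
  proof eventually_elim
    case (elim \<phi>)
    then have "(\<bar>c\<bar> + 1) * radius \<phi> \<le> 1" by (simp add: field_simps)
    moreover have "c * radius \<phi> \<le> (\<bar>c\<bar> + 1) * radius \<phi>" by (rule mult_right_mono) auto
    ultimately show ?case by (simp add: field_simps)
  qed
  then show ?thesis unfolding moderate_def by blast
qed

lemma moderate_radius_power: "moderate (\<lambda>\<phi>. 1 / radius \<phi> ^ m)"
  unfolding moderate_def by (intro exI[of _ m]) simp

lemma size_class_0: "size_class P \<Longrightarrow> P (\<lambda>\<phi>. 0)"
  unfolding size_class_def
  by (auto simp: negligible_net_def moderate_const)

lemma negligible_imp_moderate: "negligible_net B \<Longrightarrow> moderate B"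
proof -
  assume "negligible_net B"
  then have "\<forall>\<^sub>F \<phi> in U. B \<phi> \<le> radius \<phi> ^ 0" unfolding negligible_net_def by blast
  then show ?thesis using size_class_mono[OF size_class_moderate moderate_const[of 1], of B] by simp
qed

lemma size_class_cmult:
  assumes "size_class P" "P B" "0 \<le> c" "\<forall>\<^sub>F \<phi> in U. 0 \<le> B \<phi>"
  shows "P (\<lambda>\<phi>. c * B \<phi>)"
  using size_class_mult[OF assms(1) moderate_const assms(2), of c] assms by simp

lemma negligible_constD: "negligible_net (\<lambda>\<phi>. c) \<Longrightarrow> c \<le> 0"
proof (rule ccontr)
  assume n: "negligible_net (\<lambda>\<phi>. c)" and c: "\<not> c \<le> 0"
  have "\<forall>\<^sub>F \<phi> in U. c \<le> radius \<phi> ^ 1" using n unfolding negligible_net_def by blast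
  moreover have "\<forall>\<^sub>F \<phi> in U. radius \<phi> \<le> c / 2" by (rule eventually_radius_le) (use c in simp)
  ultimately have "\<forall>\<^sub>F \<phi> in U. False" by eventually_elim (use c in auto)
  then show False using U_nontrivial by simp
qed

section \<open>Moderate and negligible nets of smooth functions\<close>

abbreviation deriv_bound ::
    "nat \<Rightarrow> nat \<Rightarrow> (test_fun \<Rightarrow> real \<Rightarrow> complex) \<Rightarrow> (test_fun \<Rightarrow> real) \<Rightarrow> bool" where
  "deriv_bound j M f B \<equiv>
     \<forall>\<^sub>F \<phi> in U. \<forall>x\<in>{- real M..real M}. cmod (nderiv j (f \<phi>) x) \<le> B \<phi>"

text \<open>For the two size classes these are the moderate and the negligible nets of smooth functions. A
  bounding net for each derivative and interval replaces the quantified exponents of the radius, so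
  that estimates can be added and multiplied without bookkeeping.\<close>

definition controlled :: "((test_fun \<Rightarrow> real) \<Rightarrow> bool) \<Rightarrow> (test_fun \<Rightarrow> real \<Rightarrow> complex) \<Rightarrow> bool" where
  "controlled P f \<longleftrightarrow> (\<forall>\<phi>. smooth (f \<phi>)) \<and>
     (\<forall>j (M::nat). \<exists>B. P B \<and> deriv_bound j M f B)"

lemma controlled_smooth: "controlled P f \<Longrightarrow> smooth (f \<phi>)"
  by (simp add: controlled_def)

lemma controlledE:
  assumes "controlled P f"
  obtains B where "P B"
    "deriv_bound j M f B"
    "\<forall>\<^sub>F \<phi> in U. 0 \<le> B \<phi>"
proof -
  obtain B where B: "P B" "deriv_bound j M f B"
    using assms unfolding controlled_def by blast
  from B(2) have "\<forall>\<^sub>F \<phi> in U. 0 \<le> B \<phi>"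
  proof eventually_elim
    case (elim \<phi>)
    then have "cmod (nderiv j (f \<phi>) 0) \<le> B \<phi>" by simp
    then show ?case using norm_ge_zero[of "nderiv j (f \<phi>) 0"] by linarith
  qed
  with B that show thesis by blast
qed

lemma controlled_value:
  assumes "size_class P" "controlled P f"
  shows "P (\<lambda>\<phi>. cmod (nderiv j (f \<phi>) x))"
proof -
  obtain M :: nat where M: "\<bar>x\<bar> \<le> real M" using real_arch_simple by blast
  obtain B where B: "P B" "deriv_bound j M f B"
    by (rule controlledE[OF assms(2)]) (rule that)
  from B(2) have "\<forall>\<^sub>F \<phi> in U. cmod (nderiv j (f \<phi>) x) \<le> B \<phi>"
  proof eventually_elim
    case (elim \<phi>)
    moreover have "x \<in> {- real M..real M}" using M by (simp add: abs_le_iff)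
    ultimately show ?case by blast
  qed
  then show ?thesis by (rule size_class_mono[OF assms(1) B(1)])
qed

lemma bounded_by_nat_interval:
  fixes K :: "real set"
  assumes "compact K" obtains M :: nat where "K \<subseteq> {- real M..real M}"
proof -
  obtain b where "\<forall>x\<in>K. \<bar>x\<bar> \<le> b" using compact_imp_bounded[OF assms] by (auto simp: bounded_real)
  moreover obtain M :: nat where "b \<le> real M" using real_arch_simple by blast
  ultimately show thesis using that[of M] by force
qed

lemma carrier_emod_nets: "f \<in> carrier (emod_nets U) \<longleftrightarrow> controlled moderate f"
proof
  assume f: "f \<in> carrier (emod_nets U)"
  show "controlled moderate f"
    unfolding controlled_def
  proof (intro conjI allI)
    show "smooth (f \<phi>)" for \<phi> using f by (simp add: emod_nets_def)
    fix j M
    have "\<forall>K j. compact K \<longrightarrow>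
        (\<exists>m. \<forall>\<^sub>F \<phi> in U. \<forall>x\<in>K. cmod (nderiv j (f \<phi>) x) \<le> 1 / radius \<phi> ^ m)"
      using f by (simp add: emod_nets_def)
    from this[rule_format, OF compact_Icc, of "- real M" "real M" j]
    obtain m where "\<forall>\<^sub>F \<phi> in U. \<forall>x\<in>{- real M..real M}. cmod (nderiv j (f \<phi>) x) \<le> 1 / radius \<phi> ^ m"
      by blast
    then show "\<exists>B. moderate B \<and> (deriv_bound j M f B)"
      using moderate_radius_power by blast
  qed
next
  assume f: "controlled moderate f"
  have "\<exists>m. \<forall>\<^sub>F \<phi> in U. \<forall>x\<in>K. cmod (nderiv j (f \<phi>) x) \<le> 1 / radius \<phi> ^ m" if "compact K" for K j
  proof -
    obtain M where M: "K \<subseteq> {- real M..real M}" by (rule bounded_by_nat_interval[OF \<open>compact K\<close>])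
    obtain B where B: "moderate B" "deriv_bound j M f B"
      by (rule controlledE[OF f]) (rule that)
    obtain m where m: "\<forall>\<^sub>F \<phi> in U. B \<phi> \<le> 1 / radius \<phi> ^ m" using B(1) by (auto simp: moderate_def)
    from B(2) m have "\<forall>\<^sub>F \<phi> in U. \<forall>x\<in>K. cmod (nderiv j (f \<phi>) x) \<le> 1 / radius \<phi> ^ m"
      by eventually_elim (meson M subsetD order_trans)
    then show ?thesis by blast
  qed
  then show "f \<in> carrier (emod_nets U)"
    using controlled_smooth[OF f] by (auto simp: emod_nets_def)
qed

lemma eneg_nets_iff: "f \<in> eneg_nets U \<longleftrightarrow> controlled negligible_net f"
proof
  assume f: "f \<in> eneg_nets U"
  show "controlled negligible_net f"
    unfolding controlled_def
  proof (intro conjI allI)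
    show sm: "smooth (f \<phi>)" for \<phi> using f by (simp add: eneg_nets_def)
    fix j M
    let ?K = "{- real M..real M}"
    \<comment> \<open>the supremum over the interval is one bounding net that serves all powers of the radius\<close>
    have "\<forall>\<phi>. \<exists>z\<in>?K. \<forall>x\<in>?K. cmod (nderiv j (f \<phi>) x) \<le> cmod (nderiv j (f \<phi>) z)"
      by (intro allI continuous_attains_sup continuous_on_norm smooth_continuous_on sm) auto
    then obtain z where z: "\<And>\<phi>. z \<phi> \<in> ?K"
      "\<And>\<phi> x. x \<in> ?K \<Longrightarrow> cmod (nderiv j (f \<phi>) x) \<le> cmod (nderiv j (f \<phi>) (z \<phi>))"
      by metis
    have "negligible_net (\<lambda>\<phi>. cmod (nderiv j (f \<phi>) (z \<phi>)))"
      unfolding negligible_net_def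
    proof
      fix p
      have "\<forall>\<^sub>F \<phi> in U. \<forall>x\<in>?K. cmod (nderiv j (f \<phi>) x) \<le> radius \<phi> ^ p"
        using f by (auto simp: eneg_nets_def)
      then show "\<forall>\<^sub>F \<phi> in U. cmod (nderiv j (f \<phi>) (z \<phi>)) \<le> radius \<phi> ^ p"
        by eventually_elim (use z(1) in blast)
    qed
    then show "\<exists>B. negligible_net B \<and> (\<forall>\<^sub>F \<phi> in U. \<forall>x\<in>?K. cmod (nderiv j (f \<phi>) x) \<le> B \<phi>)"
      using z(2) by (intro exI[of _ "\<lambda>\<phi>. cmod (nderiv j (f \<phi>) (z \<phi>))"]) auto
  qed
next
  assume f: "controlled negligible_net f"
  have "\<forall>\<^sub>F \<phi> in U. \<forall>x\<in>K. cmod (nderiv j (f \<phi>) x) \<le> radius \<phi> ^ p" if "compact K" for K j p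
  proof -
    obtain M where M: "K \<subseteq> {- real M..real M}" by (rule bounded_by_nat_interval[OF \<open>compact K\<close>])
    obtain B where B: "negligible_net B"
      "deriv_bound j M f B"
      by (rule controlledE[OF f]) (rule that)
    have "\<forall>\<^sub>F \<phi> in U. B \<phi> \<le> radius \<phi> ^ p" using B(1) by (auto simp: negligible_net_def)
    with B(2) show ?thesis by eventually_elim (meson M subsetD order_trans)
  qed
  then show "f \<in> eneg_nets U"
    using controlled_smooth[OF f] by (auto simp: eneg_nets_def)
qed

lemma controlled_imp_moderate: "controlled negligible_net f \<Longrightarrow> controlled moderate f"
  unfolding controlled_def using negligible_imp_moderate by blast

lemma controlled_add:
  assumes P: "size_class P" and f: "controlled P f" and g: "controlled P g"
  shows "controlled P (\<lambda>\<phi> x. f \<phi> x + g \<phi> x)"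
  unfolding controlled_def
proof (intro conjI allI)
  show "smooth (\<lambda>x. f \<phi> x + g \<phi> x)" for \<phi>
    by (intro smooth_add controlled_smooth[OF f] controlled_smooth[OF g])
  fix j M
  obtain A where A: "P A" "deriv_bound j M f A"
    by (rule controlledE[OF f]) (rule that)
  obtain B where B: "P B" "deriv_bound j M g B"
    by (rule controlledE[OF g]) (rule that)
  from A(2) B(2) have "\<forall>\<^sub>F \<phi> in U. \<forall>x\<in>{- real M..real M}.
      cmod (nderiv j (\<lambda>x. f \<phi> x + g \<phi> x) x) \<le> A \<phi> + B \<phi>"
  proof eventually_elim
    case (elim \<phi>)
    show ?case
      unfolding nderiv_add[OF controlled_smooth[OF f] controlled_smooth[OF g]]
      using elim by (intro ballI norm_triangle_le add_mono) auto
  qed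
  then show "\<exists>B. P B \<and> (\<forall>\<^sub>F \<phi> in U. \<forall>x\<in>{- real M..real M}.
      cmod (nderiv j (\<lambda>x. f \<phi> x + g \<phi> x) x) \<le> B \<phi>)"
    using size_class_add[OF P A(1) B(1)] by (intro exI[of _ "\<lambda>\<phi>. A \<phi> + B \<phi>"]) simp
qed

lemma controlled_nderiv: "controlled P f \<Longrightarrow> controlled P (\<lambda>\<phi>. nderiv i (f \<phi>))"
  unfolding controlled_def by (auto simp: nderiv_nderiv smooth_nderiv)

lemma controlled_mult:
  assumes P: "size_class P" and f: "controlled moderate f" and g: "controlled P g"
  shows "controlled P (\<lambda>\<phi> x. f \<phi> x * g \<phi> x)"
  unfolding controlled_def
proof (intro conjI allI)
  show "smooth (\<lambda>x. f \<phi> x * g \<phi> x)" for \<phi>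
    by (intro smooth_mult controlled_smooth[OF f] controlled_smooth[OF g])
  fix j M
  show "\<exists>B. P B \<and> (\<forall>\<^sub>F \<phi> in U. \<forall>x\<in>{- real M..real M}. cmod (nderiv j (\<lambda>x. f \<phi> x * g \<phi> x) x) \<le> B \<phi>)"
    unfolding nderiv_mult[OF controlled_smooth[OF f] controlled_smooth[OF g]]
    using f g
  proof (induction j arbitrary: f g)
    case (0 f g)
    obtain A where A: "moderate A" "deriv_bound 0 M f A"
      "\<forall>\<^sub>F \<phi> in U. 0 \<le> A \<phi>"
      by (rule controlledE[OF 0(1)]) (rule that)
    obtain B where B: "P B" "deriv_bound 0 M g B"
      "\<forall>\<^sub>F \<phi> in U. 0 \<le> B \<phi>"
      by (rule controlledE[OF 0(2)]) (rule that)
    from A(2,3) B(2,3) have "\<forall>\<^sub>F \<phi> in U. \<forall>x\<in>{- real M..real M}. cmod (leibniz 0 (f \<phi>) (g \<phi>) x) \<le> A \<phi> * B \<phi>"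
      by eventually_elim (auto simp: norm_mult intro!: mult_mono)
    then show ?case using size_class_mult[OF P A(1) B(1) A(3) B(3)] by (intro exI[of _ "\<lambda>\<phi>. A \<phi> * B \<phi>"]) simp
  next
    case (Suc j f g)
    obtain A where A: "P A" "\<forall>\<^sub>F \<phi> in U. \<forall>x\<in>{- real M..real M}. cmod (leibniz j (nderiv 1 (f \<phi>)) (g \<phi>) x) \<le> A \<phi>"
      using Suc.IH[OF controlled_nderiv[OF Suc.prems(1), of 1] Suc.prems(2)] by blast
    obtain B where B: "P B" "\<forall>\<^sub>F \<phi> in U. \<forall>x\<in>{- real M..real M}. cmod (leibniz j (f \<phi>) (nderiv 1 (g \<phi>)) x) \<le> B \<phi>"
      using Suc.IH[OF Suc.prems(1) controlled_nderiv[OF Suc.prems(2), of 1]] by blast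
    from A(2) B(2) have "\<forall>\<^sub>F \<phi> in U. \<forall>x\<in>{- real M..real M}. cmod (leibniz (Suc j) (f \<phi>) (g \<phi>) x) \<le> A \<phi> + B \<phi>"
    proof eventually_elim
      case (elim \<phi>)
      show ?case unfolding leibniz.simps
        by (intro ballI norm_triangle_le add_mono) (use elim in blast)+
    qed
    then show ?case using size_class_add[OF P A(1) B(1)] by (intro exI[of _ "\<lambda>\<phi>. A \<phi> + B \<phi>"]) simp
  qed
qed

lemma controlled_const:
  assumes "size_class P" "P (\<lambda>\<phi>. cmod (a \<phi>))"
  shows "controlled P (\<lambda>\<phi> x. a \<phi>)"
  unfolding controlled_def
proof (intro conjI allI)
  fix j M
  show "\<exists>B. P B \<and> (\<forall>\<^sub>F \<phi> in U. \<forall>x\<in>{- real M..real M}. cmod (nderiv j (\<lambda>x. a \<phi>) x) \<le> B \<phi>)"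
    using assms(2) by (intro exI[of _ "\<lambda>\<phi>. cmod (a \<phi>)"]) (simp add: nderiv_const)
qed (rule smooth_const)

lemma controlled_smooth_fun:
  assumes "smooth f" shows "controlled moderate (\<lambda>\<phi>. f)"
  unfolding controlled_def
proof (intro conjI allI)
  fix j M
  have "compact (nderiv j f ` {- real M..real M})"
    by (intro compact_continuous_image smooth_continuous_on assms) simp
  then obtain b where "\<forall>x\<in>{- real M..real M}. cmod (nderiv j f x) \<le> b"
    using compact_imp_bounded by (fastforce simp: bounded_iff)
  then show "\<exists>B. moderate B \<and> (\<forall>\<^sub>F \<phi> in U. \<forall>x\<in>{- real M..real M}. cmod (nderiv j f x) \<le> B \<phi>)"
    using moderate_const[of b] by (intro exI[of _ "\<lambda>\<phi>. b"]) simp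
qed (rule assms)

lemma controlled_0: "size_class P \<Longrightarrow> controlled P (\<lambda>\<phi> x. 0)"
  using controlled_const[of P "\<lambda>\<phi>. 0"] size_class_0[of P] by simp

lemma controlled_cmult:
  "size_class P \<Longrightarrow> controlled P f \<Longrightarrow> controlled P (\<lambda>\<phi> x. c * f \<phi> x)"
  by (rule controlled_mult[OF _ controlled_const]) (auto simp: moderate_const)

lemma controlled_scale:
  "size_class P \<Longrightarrow> moderate (\<lambda>\<phi>. cmod (a \<phi>)) \<Longrightarrow> controlled P f \<Longrightarrow> controlled P (\<lambda>\<phi> x. a \<phi> * f \<phi> x)"
  by (rule controlled_mult[OF _ controlled_const]) auto

lemma controlled_diff:
  "size_class P \<Longrightarrow> controlled P f \<Longrightarrow> controlled P g \<Longrightarrow> controlled P (\<lambda>\<phi> x. f \<phi> x - g \<phi> x)"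
  using controlled_add[of P f "\<lambda>\<phi> x. - 1 * g \<phi> x"] controlled_cmult[of P g "- 1"] by simp

lemma controlled_sum:
  assumes "size_class P" "\<And>i. i \<in> A \<Longrightarrow> controlled P (f i)"
  shows "controlled P (\<lambda>\<phi> x. \<Sum>i\<in>A. f i \<phi> x)"
  using assms(2)
  by (induction A rule: infinite_finite_induct)
    (auto intro: controlled_add controlled_0 assms(1))

text \<open>The estimate on which existence, uniqueness and the well-definedness of the convolution rest: along
  \<open>u' = l u + h\<close>, control of \<open>h\<close> and of the values of \<open>u\<close> at one single point \<open>s\<close> propagates to \<open>u\<close>
  and all its derivatives on all compact sets.\<close>

lemma controlled_linear_ode:
  assumes P: "size_class P"
    and ode: "\<And>\<phi> x. (u \<phi> has_vector_derivative l * u \<phi> x + h \<phi> x) (at x)"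
    and h: "controlled P h" and x0: "P (\<lambda>\<phi>. cmod (u \<phi> s))"
  shows "controlled P u"
  unfolding controlled_def
proof (intro conjI allI)
  note sm = smooth_of_linear_ode[OF ode controlled_smooth[OF h]]
  show "smooth (u \<phi>)" for \<phi> by (rule sm)
  fix j M
  obtain N :: nat where N: "\<bar>s\<bar> \<le> real N" using real_arch_simple by blast
  define M' where "M' = max M N"
  define e where "e = exp (cmod l * (2 * real M'))"
  have "\<exists>B. P B \<and> (\<forall>\<^sub>F \<phi> in U. 0 \<le> B \<phi>) \<and> (\<forall>\<^sub>F \<phi> in U. \<forall>x\<in>{- real M'..real M'}. cmod (nderiv j (u \<phi>) x) \<le> B \<phi>)"
  proof (induction j)
    case 0
    obtain B where B: "P B" "\<forall>\<^sub>F \<phi> in U. \<forall>x\<in>{- real M'..real M'}. cmod (nderiv 0 (h \<phi>) x) \<le> B \<phi>"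
        "\<forall>\<^sub>F \<phi> in U. 0 \<le> B \<phi>"
      by (rule controlledE[OF h]) (rule that)
    let ?B = "\<lambda>\<phi>. e * (cmod (u \<phi> s) + (e * (2 * real M')) * B \<phi>)"
    have nonneg: "\<forall>\<^sub>F \<phi> in U. 0 \<le> cmod (u \<phi> s) + (e * (2 * real M')) * B \<phi>"
      using B(3) by eventually_elim (auto simp: e_def)
    have "P ?B"
      by (intro size_class_cmult[OF P] size_class_add[OF P] x0 B nonneg) (auto simp: e_def)
    moreover have "\<forall>\<^sub>F \<phi> in U. \<forall>x\<in>{- real M'..real M'}. cmod (nderiv 0 (u \<phi>) x) \<le> ?B \<phi>"
      using B(2)
    proof eventually_elim
      case (elim \<phi>)
      show ?case
      proof
        fix x assume x: "x \<in> {- real M'..real M'}"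
        have "cmod (u \<phi> x) \<le> e * (cmod (u \<phi> s) + e * B \<phi> * (2 * real M'))"
          unfolding e_def
          by (rule linear_ode_bound[OF ode]) (use elim x N in \<open>auto simp: M'_def abs_le_iff\<close>)
        then show "cmod (nderiv 0 (u \<phi>) x) \<le> ?B \<phi>" by (simp add: mult_ac)
      qed
    qed
    moreover have "\<forall>\<^sub>F \<phi> in U. 0 \<le> ?B \<phi>" using nonneg by eventually_elim (simp add: e_def)
    ultimately show ?case by blast
  next
    case (Suc j)
    then obtain A where A: "P A" "\<forall>\<^sub>F \<phi> in U. 0 \<le> A \<phi>"
      "\<forall>\<^sub>F \<phi> in U. \<forall>x\<in>{- real M'..real M'}. cmod (nderiv j (u \<phi>) x) \<le> A \<phi>" by blast
    obtain B where B: "P B" "\<forall>\<^sub>F \<phi> in U. \<forall>x\<in>{- real M'..real M'}. cmod (nderiv j (h \<phi>) x) \<le> B \<phi>"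
        "\<forall>\<^sub>F \<phi> in U. 0 \<le> B \<phi>"
      by (rule controlledE[OF h]) (rule that)
    have "P (\<lambda>\<phi>. cmod l * A \<phi> + B \<phi>)"
      by (intro size_class_cmult[OF P] size_class_add[OF P] A B) auto
    moreover have "\<forall>\<^sub>F \<phi> in U. 0 \<le> cmod l * A \<phi> + B \<phi>" using A(2) B(3) by eventually_elim auto
    moreover from A(3) B(2)
    have "\<forall>\<^sub>F \<phi> in U. \<forall>x\<in>{- real M'..real M'}. cmod (nderiv (Suc j) (u \<phi>) x) \<le> cmod l * A \<phi> + B \<phi>"
      unfolding sm(2)
      by eventually_elim (auto intro!: norm_triangle_le add_mono mult_left_mono simp: norm_mult)
    ultimately show ?case by blast
  qed
  then obtain B where "P B"
    "\<forall>\<^sub>F \<phi> in U. \<forall>x\<in>{- real M'..real M'}. cmod (nderiv j (u \<phi>) x) \<le> B \<phi>" by blast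
  moreover from this(2) have "deriv_bound j M u B"
  proof eventually_elim
    case (elim \<phi>)
    have "{- real M..real M} \<subseteq> {- real M'..real M'}" by (auto simp: M'_def)
    then show ?case using elim by blast
  qed
  ultimately show "\<exists>B. P B \<and> (deriv_bound j M u B)" by blast
qed

end

section \<open>The rings of generalized numbers and generalized functions\<close>

text \<open>Nets of numbers and nets of functions are subsets of rings of functions with pointwise
  operations. The ring and ideal axioms are checked here once for both.\<close>

definition ring_on :: "'a set \<Rightarrow> 'a::comm_ring_1 ring" where
  "ring_on S = \<lparr>carrier = S, mult = (*), one = 1, zero = 0, add = (+)\<rparr>"

lemma cring_ring_on:
  assumes "0 \<in> S" "1 \<in> S" "\<And>a b. a \<in> S \<Longrightarrow> b \<in> S \<Longrightarrow> a + b \<in> S"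
    "\<And>a b. a \<in> S \<Longrightarrow> b \<in> S \<Longrightarrow> a * b \<in> S" "\<And>a. a \<in> S \<Longrightarrow> - a \<in> S"
  shows "cring (ring_on S)"
proof (rule cringI)
  show "abelian_group (ring_on S)"
  proof (rule abelian_groupI)
    fix x assume "x \<in> carrier (ring_on S)"
    then show "\<exists>y\<in>carrier (ring_on S). y \<oplus>\<^bsub>ring_on S\<^esub> x = \<zero>\<^bsub>ring_on S\<^esub>"
      using assms(5) by (intro bexI[of _ "- x"]) (auto simp: ring_on_def)
  qed (use assms in \<open>auto simp: ring_on_def algebra_simps\<close>)
  show "comm_monoid (ring_on S)"
    by (rule comm_monoidI) (use assms in \<open>auto simp: ring_on_def algebra_simps\<close>)
qed (auto simp: ring_on_def algebra_simps)

lemma a_inv_ring_on: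
  assumes "cring (ring_on S)" "x \<in> S" "- x \<in> S"
  shows "\<ominus>\<^bsub>ring_on S\<^esub> x = - x"
proof -
  interpret cring "ring_on S" by fact
  show ?thesis by (rule minus_equality) (use assms in \<open>auto simp: ring_on_def\<close>)
qed

lemma ideal_ring_on:
  assumes R: "cring (ring_on S)" and I: "I \<subseteq> S" "0 \<in> I" "\<And>a b. a \<in> I \<Longrightarrow> b \<in> I \<Longrightarrow> a + b \<in> I"
    "\<And>a b. a \<in> S \<Longrightarrow> b \<in> I \<Longrightarrow> a * b \<in> I" "\<And>a. a \<in> I \<Longrightarrow> - a \<in> I"
  shows "ideal I (ring_on S)"
proof (rule idealI)
  interpret cring "ring_on S" by fact
  show "ring (ring_on S)" ..
  show "subgroup I (add_monoid (ring_on S))"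
  proof (rule subgroup.intro)
    fix x assume x: "x \<in> I"
    then have "inv\<^bsub>add_monoid (ring_on S)\<^esub> x = - x"
      using a_inv_ring_on[OF R, of x] I unfolding a_inv_def by blast
    then show "inv\<^bsub>add_monoid (ring_on S)\<^esub> x \<in> I" using I x by simp
  qed (use I in \<open>auto simp: ring_on_def\<close>)
next
  show "x \<otimes>\<^bsub>ring_on S\<^esub> a \<in> I" "a \<otimes>\<^bsub>ring_on S\<^esub> x \<in> I"
    if "a \<in> I" "x \<in> carrier (ring_on S)" for a x
    using I(4)[of x a] that by (simp_all add: ring_on_def mult.commute[of a])
qed

lemma UN_constant_on: "(\<And>b. b \<in> A \<Longrightarrow> F b = c) \<Longrightarrow> a \<in> A \<Longrightarrow> (\<Union>b\<in>A. F b) = c"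
  by auto

context admissible
begin

lemma uminus_net: "- f = (\<lambda>\<phi> x. - f \<phi> x)" for f :: "test_fun \<Rightarrow> real \<Rightarrow> complex"
  by (simp add: fun_eq_iff)

lemma emod_nets_eq: "emod_nets U = ring_on {f. controlled moderate f}"
proof -
  have "carrier (emod_nets U) = {f. controlled moderate f}" using carrier_emod_nets by blast
  then show ?thesis
    unfolding emod_nets_def ring_on_def by (simp add: fun_eq_iff zero_fun_def one_fun_def plus_fun_def times_fun_def)
qed

lemma eneg_nets_eq: "eneg_nets U = {f. controlled negligible_net f}"
  using eneg_nets_iff by blast

lemma controlled_uminus: "size_class P \<Longrightarrow> controlled P f \<Longrightarrow> controlled P (- f)"
  using controlled_cmult[of P f "- 1"] by (simp add: uminus_net)

lemma cring_emod_nets: "cring (emod_nets U)"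
  unfolding emod_nets_eq
  by (rule cring_ring_on)
    (auto intro: controlled_uminus controlled_add controlled_mult
      controlled_const controlled_0 moderate_const
      simp: zero_fun_def one_fun_def plus_fun_def times_fun_def)

lemma ideal_eneg_nets: "ideal (eneg_nets U) (emod_nets U)"
  unfolding emod_nets_eq eneg_nets_eq
  by (rule ideal_ring_on[OF cring_emod_nets[unfolded emod_nets_eq]])
    (auto intro: controlled_uminus controlled_add controlled_mult controlled_0
      controlled_imp_moderate simp: zero_fun_def plus_fun_def times_fun_def)

abbreviation mod_net :: "(test_fun \<Rightarrow> complex) \<Rightarrow> bool" where
  "mod_net a \<equiv> moderate (\<lambda>\<phi>. cmod (a \<phi>))"

abbreviation neg_net :: "(test_fun \<Rightarrow> complex) \<Rightarrow> bool" where
  "neg_net a \<equiv> negligible_net (\<lambda>\<phi>. cmod (a \<phi>))"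

lemma cmod_nets_eq: "cmod_nets U = ring_on {a. mod_net a}"
  unfolding cmod_nets_def ring_on_def moderate_def
  by (simp add: fun_eq_iff zero_fun_def one_fun_def plus_fun_def times_fun_def)

lemma cneg_nets_eq: "cneg_nets U = {a. neg_net a}"
  unfolding cneg_nets_def negligible_net_def ..

lemma size_class_norm_add:
  "size_class P \<Longrightarrow> P (\<lambda>\<phi>. cmod (a \<phi>)) \<Longrightarrow> P (\<lambda>\<phi>. cmod (b \<phi>)) \<Longrightarrow> P (\<lambda>\<phi>. cmod (a \<phi> + b \<phi>))"
  by (rule size_class_mono[where B = "\<lambda>\<phi>. cmod (a \<phi>) + cmod (b \<phi>)"])
    (auto simp: norm_triangle_ineq intro: size_class_add)

lemma size_class_norm_mult:
  "size_class P \<Longrightarrow> mod_net a \<Longrightarrow> P (\<lambda>\<phi>. cmod (b \<phi>)) \<Longrightarrow> P (\<lambda>\<phi>. cmod (a \<phi> * b \<phi>))"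
  unfolding norm_mult by (rule size_class_mult) auto

lemma cring_cmod_nets: "cring (cmod_nets U)"
  unfolding cmod_nets_eq
  by (rule cring_ring_on)
    (auto intro: size_class_norm_add size_class_norm_mult moderate_const)

lemma ideal_cneg_nets: "ideal (cneg_nets U) (cmod_nets U)"
  unfolding cmod_nets_eq cneg_nets_eq
  by (rule ideal_ring_on[OF cring_cmod_nets[unfolded cmod_nets_eq]])
    (auto intro: size_class_norm_add size_class_norm_mult negligible_imp_moderate
      simp: size_class_0[OF size_class_negligible])

lemma ehat_hom: "ring_hom_cring (emod_nets U) (Ehat U) (eclass U)"
  using ideal.rcos_ring_hom_cring[OF ideal_eneg_nets cring_emod_nets]
  by (simp add: Ehat_def eclass_def[abs_def])

lemma chat_hom: "ring_hom_cring (cmod_nets U) (Chat U) (cclass U)"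
  using ideal.rcos_ring_hom_cring[OF ideal_cneg_nets cring_cmod_nets]
  by (simp add: Chat_def cclass_def[abs_def])

lemma cring_Ehat: "cring (Ehat U)" and cring_Chat: "cring (Chat U)"
  using ehat_hom chat_hom by (auto simp: ring_hom_cring_def)

lemma eclass_eq_iff:
  assumes "controlled moderate f" "controlled moderate g"
  shows "eclass U f = eclass U g \<longleftrightarrow> controlled negligible_net (\<lambda>\<phi> x. f \<phi> x - g \<phi> x)"
proof -
  interpret cring "emod_nets U" by (rule cring_emod_nets)
  have "f \<ominus>\<^bsub>emod_nets U\<^esub> g = f + - g"
    using a_inv_ring_on[OF cring_emod_nets[unfolded emod_nets_eq], of g] assms controlled_uminus
    by (simp add: emod_nets_eq a_minus_def) (simp add: ring_on_def)
  also have "\<dots> = (\<lambda>\<phi> x. f \<phi> x - g \<phi> x)" by (simp add: fun_eq_iff)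
  finally show ?thesis
    using quotient_eq_iff_same_a_r_cos[OF ideal_eneg_nets, of f g] assms
    by (simp add: eclass_def carrier_emod_nets eneg_nets_eq)
qed

lemma mem_eclass_iff: "g \<in> eclass U f \<longleftrightarrow> controlled negligible_net (\<lambda>\<phi> x. g \<phi> x - f \<phi> x)"
proof
  assume "g \<in> eclass U f"
  then show "controlled negligible_net (\<lambda>\<phi> x. g \<phi> x - f \<phi> x)"
    by (auto simp: eclass_def a_r_coset_def r_coset_def eneg_nets_eq emod_nets_eq ring_on_def
        plus_fun_def)
next
  assume "controlled negligible_net (\<lambda>\<phi> x. g \<phi> x - f \<phi> x)"
  moreover have "g = (\<lambda>\<phi> x. g \<phi> x - f \<phi> x) + f" by (simp add: fun_eq_iff)
  ultimately show "g \<in> eclass U f"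
    by (auto simp: eclass_def a_r_coset_def r_coset_def eneg_nets_eq emod_nets_eq ring_on_def)
qed

lemma carrier_Ehat: "F \<in> carrier (Ehat U) \<longleftrightarrow> (\<exists>f. controlled moderate f \<and> F = eclass U f)"
  using carrier_emod_nets
  by (auto simp: Ehat_def FactRing_def A_RCOSETS_def RCOSETS_def eclass_def a_r_coset_def)

lemma eclass_in_carrier [simp]: "controlled moderate f \<Longrightarrow> eclass U f \<in> carrier (Ehat U)"
  using carrier_Ehat by blast

lemma cclass_eq_iff:
  assumes "mod_net a" "mod_net b"
  shows "cclass U a = cclass U b \<longleftrightarrow> neg_net (\<lambda>\<phi>. a \<phi> - b \<phi>)"
proof -
  interpret cring "cmod_nets U" by (rule cring_cmod_nets)
  have "a \<ominus>\<^bsub>cmod_nets U\<^esub> b = a + - b"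
    using a_inv_ring_on[OF cring_cmod_nets[unfolded cmod_nets_eq], of b] assms
    by (simp add: cmod_nets_eq a_minus_def) (simp add: ring_on_def)
  also have "\<dots> = (\<lambda>\<phi>. a \<phi> - b \<phi>)" by (simp add: fun_eq_iff)
  finally show ?thesis
    using quotient_eq_iff_same_a_r_cos[OF ideal_cneg_nets, of a b] assms
    by (simp add: cclass_def cmod_nets_eq cneg_nets_eq) (simp add: ring_on_def)
qed

lemma mem_cclass_iff: "b \<in> cclass U a \<longleftrightarrow> neg_net (\<lambda>\<phi>. b \<phi> - a \<phi>)"
proof
  assume "b \<in> cclass U a"
  then show "neg_net (\<lambda>\<phi>. b \<phi> - a \<phi>)"
    by (auto simp: cclass_def a_r_coset_def r_coset_def cneg_nets_eq cmod_nets_eq ring_on_def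
        plus_fun_def)
next
  assume "neg_net (\<lambda>\<phi>. b \<phi> - a \<phi>)"
  moreover have "b = (\<lambda>\<phi>. b \<phi> - a \<phi>) + a" by (simp add: fun_eq_iff)
  ultimately show "b \<in> cclass U a"
    by (auto simp: cclass_def a_r_coset_def r_coset_def cneg_nets_eq cmod_nets_eq ring_on_def)
qed

lemma carrier_Chat: "A \<in> carrier (Chat U) \<longleftrightarrow> (\<exists>a. mod_net a \<and> A = cclass U a)"
  by (auto simp: Chat_def FactRing_def A_RCOSETS_def RCOSETS_def cclass_def a_r_coset_def
      cmod_nets_eq) (auto simp: ring_on_def)

lemma cclass_in_carrier [simp]: "mod_net a \<Longrightarrow> cclass U a \<in> carrier (Chat U)"
  using carrier_Chat by blast

lemma eclass_add:
  assumes "controlled moderate f" "controlled moderate g"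
  shows "eclass U f \<oplus>\<^bsub>Ehat U\<^esub> eclass U g = eclass U (\<lambda>\<phi> x. f \<phi> x + g \<phi> x)"
  using ring_hom_add[OF ring_hom_cring.homh[OF ehat_hom], of f g] assms
  by (simp add: carrier_emod_nets) (simp add: emod_nets_def)

lemma eclass_mult:
  assumes "controlled moderate f" "controlled moderate g"
  shows "eclass U f \<otimes>\<^bsub>Ehat U\<^esub> eclass U g = eclass U (\<lambda>\<phi> x. f \<phi> x * g \<phi> x)"
  using ring_hom_mult[OF ring_hom_cring.homh[OF ehat_hom], of f g] assms
  by (simp add: carrier_emod_nets) (simp add: emod_nets_def)

lemma eclass_zero: "\<zero>\<^bsub>Ehat U\<^esub> = eclass U (\<lambda>\<phi> x. 0)"
  using ring_hom_cring.hom_zero[OF ehat_hom] by (simp add: emod_nets_def)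

lemma eclass_a_inv:
  assumes f: "controlled moderate f"
  shows "\<ominus>\<^bsub>Ehat U\<^esub> eclass U f = eclass U (\<lambda>\<phi> x. - f \<phi> x)"
proof -
  have "\<ominus>\<^bsub>emod_nets U\<^esub> f = - f"
    unfolding emod_nets_eq
    by (rule a_inv_ring_on[OF cring_emod_nets[unfolded emod_nets_eq]]) (use f controlled_uminus in auto)
  then show ?thesis
    using ring_hom_cring.hom_a_inv[OF ehat_hom, of f] f by (simp add: carrier_emod_nets uminus_net)
qed

lemma eclass_diff:
  assumes f: "controlled moderate f" and g: "controlled moderate g"
  shows "eclass U f \<ominus>\<^bsub>Ehat U\<^esub> eclass U g = eclass U (\<lambda>\<phi> x. f \<phi> x - g \<phi> x)"
  using eclass_add[OF f controlled_cmult[OF size_class_moderate g, where c = "- 1"]] by (simp add: a_minus_def eclass_a_inv g)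

lemma cclass_add:
  assumes "mod_net a" "mod_net b"
  shows "cclass U a \<oplus>\<^bsub>Chat U\<^esub> cclass U b = cclass U (\<lambda>\<phi>. a \<phi> + b \<phi>)"
  using ring_hom_add[OF ring_hom_cring.homh[OF chat_hom], of a b] assms
  by (simp add: cmod_nets_eq) (simp add: ring_on_def plus_fun_def)

lemma cclass_mult:
  assumes "mod_net a" "mod_net b"
  shows "cclass U a \<otimes>\<^bsub>Chat U\<^esub> cclass U b = cclass U (\<lambda>\<phi>. a \<phi> * b \<phi>)"
  using ring_hom_mult[OF ring_hom_cring.homh[OF chat_hom], of a b] assms
  by (simp add: cmod_nets_eq) (simp add: ring_on_def times_fun_def)

lemma cclass_zero: "\<zero>\<^bsub>Chat U\<^esub> = cclass U (\<lambda>\<phi>. 0)"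
  using ring_hom_cring.hom_zero[OF chat_hom] by (simp add: cmod_nets_def)

lemma cclass_diff:
  assumes a: "mod_net a" and b: "mod_net b"
  shows "cclass U a \<ominus>\<^bsub>Chat U\<^esub> cclass U b = cclass U (\<lambda>\<phi>. a \<phi> - b \<phi>)"
proof -
  have "\<ominus>\<^bsub>cmod_nets U\<^esub> b = - b"
    unfolding cmod_nets_eq
    by (rule a_inv_ring_on[OF cring_cmod_nets[unfolded cmod_nets_eq]]) (use b in auto)
  then have "\<ominus>\<^bsub>Chat U\<^esub> cclass U b = cclass U (- b)"
    using ring_hom_cring.hom_a_inv[OF chat_hom, of b] b by (simp add: cmod_nets_eq) (simp add: ring_on_def)
  then show ?thesis
    using cclass_add[OF a, of "- b"] b by (simp add: a_minus_def)
qed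

lemma gfun_deriv_eclass:
  assumes f: "controlled moderate f"
  shows "gfun_deriv U (eclass U f) = eclass U (\<lambda>\<phi>. nderiv 1 (f \<phi>))"
proof -
  have "eclass U (\<lambda>\<phi>. nderiv 1 (g \<phi>)) = eclass U (\<lambda>\<phi>. nderiv 1 (f \<phi>))" if "g \<in> eclass U f" for g
  proof -
    have d: "controlled negligible_net (\<lambda>\<phi> x. g \<phi> x - f \<phi> x)" using that by (simp add: mem_eclass_iff)
    then have g: "controlled moderate g"
      using controlled_add[OF size_class_moderate controlled_imp_moderate[OF d] f] by simp
    have "(\<lambda>\<phi>. nderiv 1 (\<lambda>x. g \<phi> x - f \<phi> x)) = (\<lambda>\<phi> x. nderiv 1 (g \<phi>) x - nderiv 1 (f \<phi>) x)"
      using nderiv_lincomb[OF controlled_smooth[OF g] controlled_smooth[OF f], where j = 1 and a = 1 and b = "- 1"] by simp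
    then show ?thesis
      using controlled_nderiv[OF d, of 1]
      by (simp add: eclass_eq_iff controlled_nderiv f g)
  qed
  moreover have "f \<in> eclass U f" by (simp add: mem_eclass_iff controlled_0)
  ultimately show ?thesis unfolding gfun_deriv_def by (rule UN_constant_on)
qed

lemma mod_net_value: "controlled moderate f \<Longrightarrow> mod_net (\<lambda>\<phi>. f \<phi> x)"
  using controlled_value[of moderate f 0 x] by simp

lemma gval_eclass:
  assumes f: "controlled moderate f"
  shows "gval U (eclass U f) x = cclass U (\<lambda>\<phi>. f \<phi> x)"
proof -
  have "cclass U (\<lambda>\<phi>. g \<phi> x) = cclass U (\<lambda>\<phi>. f \<phi> x)" if "g \<in> eclass U f" for g
  proof -
    have d: "controlled negligible_net (\<lambda>\<phi> x. g \<phi> x - f \<phi> x)" using that by (simp add: mem_eclass_iff)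
    then have g: "controlled moderate g"
      using controlled_add[OF size_class_moderate controlled_imp_moderate[OF d] f] by simp
    show ?thesis
      using controlled_value[OF size_class_negligible d, of 0 x] by (simp add: cclass_eq_iff mod_net_value f g)
  qed
  moreover have "f \<in> eclass U f" by (simp add: mem_eclass_iff controlled_0)
  ultimately show ?thesis unfolding gval_def by (rule UN_constant_on)
qed

lemma const_fun_cclass:
  assumes a: "mod_net a"
  shows "const_fun U (cclass U a) = eclass U (\<lambda>\<phi> x. a \<phi>)"
proof -
  have "eclass U (\<lambda>\<phi> x. b \<phi>) = eclass U (\<lambda>\<phi> x. a \<phi>)" if "b \<in> cclass U a" for b
  proof -
    have d: "neg_net (\<lambda>\<phi>. b \<phi> - a \<phi>)" using that by (simp add: mem_cclass_iff)
    then have b: "mod_net b"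
      using size_class_norm_add[OF size_class_moderate negligible_imp_moderate[OF d] a] by simp
    show ?thesis
      using controlled_const[OF size_class_negligible d] by (simp add: eclass_eq_iff controlled_const a b)
  qed
  moreover have "a \<in> cclass U a" by (simp add: mem_cclass_iff size_class_0)
  ultimately show ?thesis unfolding const_fun_def by (rule UN_constant_on)
qed

lemma gscale_eclass:
  assumes "mod_net a" "controlled moderate f"
  shows "cclass U a \<cdot>\<^bsub>U\<^esub> eclass U f = eclass U (\<lambda>\<phi> x. a \<phi> * f \<phi> x)"
  using assms by (simp add: gscale_def const_fun_cclass eclass_mult controlled_const)

lemma num_gscale_eclass:
  "controlled moderate f \<Longrightarrow> num U c \<cdot>\<^bsub>U\<^esub> eclass U f = eclass U (\<lambda>\<phi> x. c * f \<phi> x)"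
  unfolding num_def by (rule gscale_eclass) (auto simp: moderate_const)

lemma finsum_eclass:
  assumes "\<And>n. n \<in> A \<Longrightarrow> controlled moderate (f n)"
  shows "(\<Oplus>\<^bsub>Ehat U\<^esub>n\<in>A. eclass U (f n)) = eclass U (\<lambda>\<phi> x. \<Sum>n\<in>A. f n \<phi> x)"
proof -
  interpret cring "Ehat U" by (rule cring_Ehat)
  show ?thesis
    using assms
    by (induction A rule: infinite_finite_induct)
      (auto simp: eclass_zero eclass_add controlled_sum Pi_iff)
qed

lemma gabs_cclass:
  assumes a: "mod_net a"
  shows "gabs U (cclass U a) = cclass U (\<lambda>\<phi>. complex_of_real (cmod (a \<phi>)))"
proof -
  have "cclass U (\<lambda>\<phi>. complex_of_real (cmod (b \<phi>))) = cclass U (\<lambda>\<phi>. complex_of_real (cmod (a \<phi>)))"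
    if "b \<in> cclass U a" for b
  proof -
    have d: "neg_net (\<lambda>\<phi>. b \<phi> - a \<phi>)" using that by (simp add: mem_cclass_iff)
    then have b: "mod_net b"
      using size_class_norm_add[OF size_class_moderate negligible_imp_moderate[OF d] a] by simp
    have "neg_net (\<lambda>\<phi>. complex_of_real (cmod (b \<phi>)) - complex_of_real (cmod (a \<phi>)))"
      by (rule size_class_mono[OF size_class_negligible d])
        (auto simp: of_real_diff[symmetric] norm_triangle_ineq3 simp del: of_real_diff)
    then show ?thesis using a b by (simp add: cclass_eq_iff)
  qed
  moreover have "a \<in> cclass U a" by (simp add: mem_cclass_iff size_class_0)
  ultimately show ?thesis unfolding gabs_def by (rule UN_constant_on)
qed

lemma cclass_in_Rhat: "mod_net a \<Longrightarrow> (\<And>\<phi>. a \<phi> \<in> \<real>) \<Longrightarrow> cclass U a \<in> Rhat U"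
  unfolding Rhat_def by (rule CollectI, rule exI[of _ a]) (simp add: cmod_nets_eq, simp add: ring_on_def)

text \<open>The strict order of generalized numbers requires a nonzero difference, so the bound \<open>1 / (2 n)\<close> is
  used to get below \<open>1 / n\<close>: the gap \<open>1 / (2 n)\<close> that remains is not negligible.\<close>

lemma infinitesimal_gapprox:
  assumes a: "mod_net a" and small: "\<And>e. 0 < e \<Longrightarrow> \<forall>\<^sub>F \<phi> in U. cmod (a \<phi> - c) \<le> e"
  shows "gapprox U (cclass U a) (num U c)"
  unfolding gapprox_def
proof (intro conjI allI impI)
  show "cclass U a \<in> carrier (Chat U)" "num U c \<in> carrier (Chat U)"
    using a by (auto simp: num_def moderate_const)
  fix n :: nat assume n: "1 \<le> n"
  define d where "d \<phi> = complex_of_real (cmod (a \<phi> - c))" for \<phi>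
  have dif: "mod_net (\<lambda>\<phi>. a \<phi> - c)"
    using size_class_norm_add[OF size_class_moderate a, of "\<lambda>\<phi>. - c"] by (simp add: moderate_const)
  have d: "mod_net d" using dif by (simp add: d_def)
  have abs: "gabs U (cclass U a \<ominus>\<^bsub>Chat U\<^esub> num U c) = cclass U d"
    using dif a by (simp add: num_def cclass_diff moderate_const gabs_cclass d_def[abs_def])
  let ?q = "\<lambda>\<phi>. 1 / of_nat n :: complex"
  have q: "mod_net ?q" by (simp add: moderate_const)
  have qd: "mod_net (\<lambda>\<phi>. ?q \<phi> - d \<phi>)"
    using size_class_norm_add[OF size_class_moderate q, of "\<lambda>\<phi>. - d \<phi>"] d by simp
  have ev: "\<forall>\<^sub>F \<phi> in U. cmod (a \<phi> - c) \<le> 1 / (2 * real n)" using n by (intro small) simp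
  have "cclass U d \<in> Rhat U" "cclass U ?q \<in> Rhat U" "cclass U (\<lambda>\<phi>. ?q \<phi> - d \<phi>) \<in> Rhat U"
    by (rule cclass_in_Rhat; use d q qd in \<open>simp add: d_def\<close>)+
  moreover have "cclass U d \<noteq> cclass U ?q"
  proof
    assume "cclass U d = cclass U ?q"
    then have "neg_net (\<lambda>\<phi>. d \<phi> - ?q \<phi>)" using cclass_eq_iff[OF d q] by blast
    then have "negligible_net (\<lambda>\<phi>. 1 / (2 * real n))"
    proof (rule size_class_mono[OF size_class_negligible])
      show "\<forall>\<^sub>F \<phi> in U. 1 / (2 * real n) \<le> cmod (d \<phi> - ?q \<phi>)"
        using ev
      proof eventually_elim
        case (elim \<phi>)
        have "1 / real n - cmod (a \<phi> - c) \<le> cmod (d \<phi> - ?q \<phi>)"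
          using norm_triangle_ineq2[of "?q \<phi>" "d \<phi>"]
          by (simp add: d_def norm_divide norm_minus_commute)
        moreover have "1 / real n = 1 / (2 * real n) + 1 / (2 * real n)" by simp
        ultimately show ?case using elim by linarith
      qed
    qed
    from negligible_constD[OF this] n show False by simp
  qed
  moreover have "gnonneg U (cclass U ?q \<ominus>\<^bsub>Chat U\<^esub> cclass U d)"
    unfolding gnonneg_def cclass_diff[OF q d]
  proof (intro conjI bexI)
    show "(\<lambda>\<phi>. ?q \<phi> - d \<phi>) \<in> cclass U (\<lambda>\<phi>. ?q \<phi> - d \<phi>)" by (simp add: mem_cclass_iff size_class_0)
    have "1 / (2 * real n) \<le> 1 / real n" using n by (simp add: field_simps)
    show "\<forall>\<^sub>F \<phi> in U. ?q \<phi> - d \<phi> \<in> \<real> \<and> 0 \<le> Re (?q \<phi> - d \<phi>)"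
      using ev
    proof eventually_elim
      case (elim \<phi>)
      have "?q \<phi> - d \<phi> = complex_of_real (1 / real n - cmod (a \<phi> - c))" by (simp add: d_def)
      then show ?case
        using elim \<open>1 / (2 * real n) \<le> 1 / real n\<close> by (metis Reals_of_real Re_complex_of_real diff_ge_0_iff_ge order_trans)
    qed
  qed fact
  ultimately show "gless U (gabs U (cclass U a \<ominus>\<^bsub>Chat U\<^esub> num U c)) (num U (1 / of_nat n))"
    unfolding abs gless_def by (simp add: num_def)
qed

end

section \<open>Regularisation of distributions on the half line\<close>

lemma tf_Abs_test_fun:
  assumes "smooth f" "\<And>x. b < \<bar>x\<bar> \<Longrightarrow> f x = 0"
  shows "tf (Abs_test_fun f) = f"
proof (rule Abs_test_fun_inverse)
  have "{x. f x \<noteq> 0} \<subseteq> {-b..b}" using assms(2) by (force simp: not_less[symmetric])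
  then have "bounded {x. f x \<noteq> 0}" using bounded_subset bounded_closed_interval by blast
  then show "f \<in> {f. smooth f \<and> compact (closure {x. f x \<noteq> 0})}" using assms(1) by simp
qed

lemma test_fun_eqI: "(\<And>x. tf \<phi> x = tf \<psi> x) \<Longrightarrow> \<phi> = \<psi>"
  using tf_inject by blast

lemma nderiv_reflect:
  "smooth f \<Longrightarrow> nderiv j (\<lambda>y. f (x - y)) = (\<lambda>y. (-1) ^ j * nderiv j f (x - y))"
proof (rule nderiv_eqI[where g = "\<lambda>j y. (-1) ^ j * nderiv j f (x - y)"])
  fix j y
  assume f: "smooth f"
  have "((\<lambda>y. x - y) has_vector_derivative -1) (at y)"
    by (auto intro!: derivative_eq_intros)
  from vector_diff_chain_at[OF this smooth_has_nderiv[OF f]]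
  have "((\<lambda>y. nderiv j f (x - y)) has_vector_derivative (-1) *\<^sub>R nderiv (Suc j) f (x - y)) (at y)"
    by (simp add: o_def)
  from has_vector_derivative_mult_right[OF this, of "(-1) ^ j"]
  show "((\<lambda>y. (-1) ^ j * nderiv j f (x - y)) has_vector_derivative
      (-1) ^ Suc j * nderiv (Suc j) f (x - y)) (at y)" by simp
qed simp

lemma tf_test_deriv: "tf (test_deriv \<phi>) = nderiv 1 (tf \<phi>)"
  by (simp add: test_deriv.rep_eq)

lemma tf_test_deriv_pow: "tf ((test_deriv ^^ j) \<phi>) = nderiv j (tf \<phi>)"
  by (induction j) (simp_all add: tf_test_deriv nderiv_nderiv)

lemma nderiv_tf_outside: "radius \<phi> < \<bar>x\<bar> \<Longrightarrow> nderiv j (tf \<phi>) x = 0"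
proof (induction j arbitrary: x)
  case (Suc j)
  have "(nderiv j (tf \<phi>) has_vector_derivative 0) (at x)"
  proof (rule has_vector_derivative_transform_within_open)
    show "((\<lambda>_. 0) has_vector_derivative 0) (at x)" by simp
    show "open {y. radius \<phi> < \<bar>y\<bar>}" by (intro open_Collect_less continuous_intros)
  qed (use Suc in auto)
  then show ?case by (simp add: nderiv_Suc vector_derivative_at)
qed (simp add: tf_outside_radius)

lemma closure_support_subset:
  assumes "closed K" "\<And>x. x \<notin> K \<Longrightarrow> tf \<phi> x = 0"
  shows "closure {x. tf \<phi> x \<noteq> 0} \<subseteq> K"
  by (rule closure_minimal) (use assms in auto)

lemma bdd_above_nderiv_tf: "bdd_above (range (\<lambda>x. cmod (nderiv j (tf \<phi>) x)))"
proof -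
  have "compact (nderiv j (tf \<phi>) ` {- radius \<phi>..radius \<phi>})"
    by (intro compact_continuous_image smooth_continuous_on smooth_tf) simp
  then obtain b where b: "\<And>x. x \<in> {- radius \<phi>..radius \<phi>} \<Longrightarrow> cmod (nderiv j (tf \<phi>) x) \<le> b"
    using compact_imp_bounded by (fastforce simp: bounded_iff)
  have "cmod (nderiv j (tf \<phi>) x) \<le> max b 0" for x
    using b[of x] nderiv_tf_outside[of \<phi> x j] by (cases "radius \<phi> < \<bar>x\<bar>") (auto simp: abs_le_iff not_less)
  then show ?thesis by (intro bdd_aboveI[of _ "max b 0"]) auto
qed

lemma distribution_lincomb:
  "distribution T \<Longrightarrow> T (test_lincomb a b \<phi> \<psi>) = a * T \<phi> + b * T \<psi>"
  by (simp add: distribution_def)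

text \<open>The continuity estimate in the form in which it is applied: one number \<open>B\<close> that dominates
  finitely many derivatives.\<close>

lemma distribution_continuous:
  assumes "distribution T" "compact K"
  obtains c N where "0 \<le> c"
    "\<And>\<phi> B. closure {x. tf \<phi> x \<noteq> 0} \<subseteq> K \<Longrightarrow> (\<And>j x. j \<le> N \<Longrightarrow> cmod (nderiv j (tf \<phi>) x) \<le> B) \<Longrightarrow>
      cmod (T \<phi>) \<le> c * B"
proof -
  obtain c N where cN: "\<And>\<phi>. closure {x. tf \<phi> x \<noteq> 0} \<subseteq> K \<Longrightarrow>
      cmod (T \<phi>) \<le> c * (\<Sum>j\<le>N. SUP x. cmod (nderiv j (tf \<phi>) x))"
    using assms unfolding distribution_def by metis
  show thesis
  proof (rule that[of "\<bar>c\<bar> * (real N + 1)" N])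
    fix \<phi> B
    assume K: "closure {x. tf \<phi> x \<noteq> 0} \<subseteq> K"
      and B: "\<And>j x. j \<le> N \<Longrightarrow> cmod (nderiv j (tf \<phi>) x) \<le> B"
    let ?S = "\<Sum>j\<le>N. SUP x. cmod (nderiv j (tf \<phi>) x)"
    have S0: "0 \<le> ?S"
      by (intro sum_nonneg order_trans[OF norm_ge_zero cSUP_upper[OF UNIV_I bdd_above_nderiv_tf]])
    have "?S \<le> (\<Sum>j\<le>N. B)" by (intro sum_mono cSUP_least B) auto
    also have "\<dots> = (real N + 1) * B" by simp
    finally have "?S \<le> (real N + 1) * B" .
    then have "\<bar>c\<bar> * ?S \<le> \<bar>c\<bar> * ((real N + 1) * B)" by (intro mult_left_mono) auto
    moreover have "c * ?S \<le> \<bar>c\<bar> * ?S" using S0 by (intro mult_right_mono) auto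
    ultimately show "cmod (T \<phi>) \<le> \<bar>c\<bar> * (real N + 1) * B"
      using cN[OF K] by (simp add: mult.assoc)
  qed simp
qed

lemma test_lincomb_eqI:
  "(\<And>x. tf \<eta> x = a * tf \<phi> x + b * tf \<psi> x) \<Longrightarrow> test_lincomb a b \<phi> \<psi> = \<eta>"
  by (rule test_fun_eqI) (simp add: test_lincomb.rep_eq)

lemma tf_test_reflect: "tf (test_reflect x \<phi>) = (\<lambda>y. tf \<phi> (x - y))"
  by (simp add: test_reflect.rep_eq)

lemma conv_test_dist_deriv:
  assumes T: "distribution T"
  shows "conv_test (dist_deriv T) \<phi> x = conv_test T (test_deriv \<phi>) x"
proof -
  have "test_lincomb (- 1) 0 (test_reflect x (test_deriv \<phi>)) (test_reflect x (test_deriv \<phi>))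
      = test_deriv (test_reflect x \<phi>)"
    by (rule test_lincomb_eqI)
      (simp add: tf_test_deriv tf_test_reflect nderiv_reflect smooth_tf)
  then have "T (test_deriv (test_reflect x \<phi>)) = - T (test_reflect x (test_deriv \<phi>))"
    using distribution_lincomb[OF T, of "- 1" 0 "test_reflect x (test_deriv \<phi>)" "test_reflect x (test_deriv \<phi>)"] by simp
  then show ?thesis by (simp add: conv_test_def dist_deriv_def)
qed

text \<open>Applied to every derivative of a test function, this bound, which is uniform in \<open>x\<close>, makes the
  difference quotients of its translates converge in the topology of test functions.\<close>

lemma first_order_remainder:
  assumes f: "smooth f" and B: "\<And>y. cmod (nderiv 2 f y) \<le> B"
  shows "cmod (f (x + h) - f x - of_real h * nderiv 1 f x) \<le> B * h\<^sup>2"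
proof -
  define r where "r t = f (x + t) - of_real t * nderiv 1 f x" for t
  define S where "S = {- \<bar>h\<bar>..\<bar>h\<bar>}"
  have d1: "(nderiv 1 f has_vector_derivative nderiv 2 f y) (at y)" for y
    using smooth_has_nderiv[OF f, of 1 y] by (simp add: numeral_2_eq_2)
  have "norm (nderiv 1 f (x + t) - nderiv 1 f x) \<le> B * norm (x + t - x)" for t
    by (rule differentiable_bound[where S = UNIV and f' = "\<lambda>y t. t *\<^sub>R nderiv 2 f y"])
      (use d1 in \<open>auto simp: has_vector_derivative_def mult.commute[of "\<bar>_\<bar>"]
        intro!: onorm_le mult_right_mono B\<close>)
  then have d2: "cmod (nderiv 1 f (x + t) - nderiv 1 f x) \<le> B * \<bar>t\<bar>" for t by simp
  have shift: "((\<lambda>t. f (x + t)) has_vector_derivative nderiv 1 f (x + t)) (at t)" for t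
  proof -
    have "((\<lambda>t. x + t) has_vector_derivative 1) (at t)" by (auto intro!: derivative_eq_intros)
    from vector_diff_chain_at[OF this smooth_has_vector_derivative[OF f]] show ?thesis
      by (simp add: o_def)
  qed
  have r: "(r has_vector_derivative (nderiv 1 f (x + t) - nderiv 1 f x)) (at t)" for t
    unfolding r_def by (auto intro!: derivative_eq_intros shift has_vector_derivative_of_real)
  have "0 \<le> B" using B[of 0] norm_ge_zero[of "nderiv 2 f 0"] by linarith
  have "norm (r h - r 0) \<le> (B * \<bar>h\<bar>) * norm (h - 0)"
  proof (rule differentiable_bound[where S = S and f' = "\<lambda>t s. s *\<^sub>R (nderiv 1 f (x + t) - nderiv 1 f x)"])
    fix t assume t: "t \<in> S"
    show "(r has_derivative (\<lambda>s. s *\<^sub>R (nderiv 1 f (x + t) - nderiv 1 f x))) (at t within S)"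
      using r[of t] by (auto simp: has_vector_derivative_def intro: has_derivative_at_withinI)
    have "B * \<bar>t\<bar> \<le> B * \<bar>h\<bar>" using t \<open>0 \<le> B\<close> by (intro mult_left_mono) (auto simp: S_def)
    then have "cmod (nderiv 1 f (x + t) - nderiv 1 f x) \<le> B * \<bar>h\<bar>" using d2[of t] by linarith
    then show "onorm (\<lambda>s. s *\<^sub>R (nderiv 1 f (x + t) - nderiv 1 f x)) \<le> B * \<bar>h\<bar>"
      by (intro onorm_le) (auto simp: mult.commute[of "\<bar>_\<bar>"] intro!: mult_right_mono)
  qed (auto simp: S_def)
  then show ?thesis by (simp add: r_def power2_eq_square algebra_simps)
qed

lemma nderiv_tf_uniform_bound:
  obtains B where "0 \<le> B" "\<And>j x. j \<le> N \<Longrightarrow> cmod (nderiv j (tf \<phi>) x) \<le> B"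
proof -
  let ?s = "\<lambda>j. SUP x. cmod (nderiv j (tf \<phi>) x)"
  have s: "cmod (nderiv j (tf \<phi>) x) \<le> ?s j" for j x
    by (rule cSUP_upper[OF UNIV_I bdd_above_nderiv_tf])
  have s0: "0 \<le> ?s j" for j using s[of j 0] norm_ge_zero order_trans by blast
  show thesis
  proof (rule that[of "\<Sum>j\<le>N. ?s j"])
    fix j x assume "j \<le> N"
    then have "?s j \<le> (\<Sum>j\<le>N. ?s j)" by (intro member_le_sum s0) auto
    then show "cmod (nderiv j (tf \<phi>) x) \<le> (\<Sum>j\<le>N. ?s j)" using s[of j x] by linarith
  qed (intro sum_nonneg s0)
qed

text \<open>Differentiation under the distribution: by Taylor's formula the remainder of the difference
  quotient is a test function with support in a fixed compact set, all of whose derivatives are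
  quadratically small in the increment.\<close>

lemma conv_test_has_vector_derivative:
  assumes T: "distribution T"
  shows "(conv_test T \<phi> has_vector_derivative conv_test T (test_deriv \<phi>) x) (at x)"
proof -
  define K where "K = {x - 1 - radius \<phi>..x + 1 + radius \<phi>}"
  obtain c N where c: "0 \<le> c" and cN:
    "\<And>\<psi> B. closure {y. tf \<psi> y \<noteq> 0} \<subseteq> K \<Longrightarrow> (\<And>j y. j \<le> N \<Longrightarrow> cmod (nderiv j (tf \<psi>) y) \<le> B) \<Longrightarrow>
      cmod (T \<psi>) \<le> c * B"
    by (rule distribution_continuous[OF T, of K]) (auto simp: K_def)
  obtain B where B: "0 \<le> B" "\<And>j x. j \<le> N + 2 \<Longrightarrow> cmod (nderiv j (tf \<phi>) x) \<le> B"
    by (rule nderiv_tf_uniform_bound[of "N + 2" \<phi>]) (rule that, assumption, blast)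
  \<comment> \<open>\<open>T\<close> of the Taylor remainder of \<open>x \<mapsto> \<phi>(x - y)\<close> is quadratic in the increment\<close>
  have rem: "cmod (conv_test T \<phi> (x + h) - conv_test T \<phi> x - of_real h * conv_test T (test_deriv \<phi>) x)
      \<le> c * (B * h\<^sup>2)" if h: "\<bar>h\<bar> \<le> 1" for h
  proof -
    define \<eta> where "\<eta> = test_lincomb 1 (- of_real h)
      (test_lincomb 1 (- 1) (test_reflect (x + h) \<phi>) (test_reflect x \<phi>)) (test_reflect x (test_deriv \<phi>))"
    have chi: "tf \<eta> = (\<lambda>y. 1 * (1 * tf \<phi> (x + h - y) + (- 1) * tf \<phi> (x - y)) + (- of_real h) * nderiv 1 (tf \<phi>) (x - y))"
      by (simp add: \<eta>_def test_lincomb.rep_eq tf_test_reflect tf_test_deriv)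
    have sm: "smooth (\<lambda>y. tf \<phi> (z - y))" "smooth (\<lambda>y. nderiv 1 (tf \<phi>) (z - y))" for z
      by (intro smooth_reflect smooth_nderiv smooth_tf)+
    have "nderiv j (tf \<eta>) y = (- 1) ^ j * (nderiv j (tf \<phi>) (x - y + h) - nderiv j (tf \<phi>) (x - y)
        - of_real h * nderiv 1 (nderiv j (tf \<phi>)) (x - y))" for j y
      unfolding chi nderiv_lincomb[OF smooth_lincomb[OF sm(1) sm(1)] sm(2)] nderiv_lincomb[OF sm(1) sm(1)]
        nderiv_reflect[OF smooth_tf] nderiv_reflect[OF smooth_nderiv[OF smooth_tf]] nderiv_nderiv
      by (simp add: algebra_simps)
    then have "cmod (nderiv j (tf \<eta>) y) \<le> B * h\<^sup>2" if "j \<le> N" for j y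
      using first_order_remainder[OF smooth_nderiv[OF smooth_tf, of j \<phi>], of B "x - y" h] B(2)[of "2 + j"] that
      by (simp add: norm_mult norm_power nderiv_nderiv)
    moreover have "closure {y. tf \<eta> y \<noteq> 0} \<subseteq> K"
    proof (rule closure_support_subset)
      fix y assume "y \<notin> K"
      then have "radius \<phi> < \<bar>x - y\<bar>" "radius \<phi> < \<bar>x + h - y\<bar>"
        using h unfolding K_def atLeastAtMost_iff by linarith+
      then show "tf \<eta> y = 0" using nderiv_tf_outside[of \<phi> _ 1] by (simp add: chi tf_outside_radius)
    qed (simp add: K_def)
    ultimately have "cmod (T \<eta>) \<le> c * (B * h\<^sup>2)" by (intro cN) auto
    then show ?thesis
      by (simp add: \<eta>_def distribution_lincomb[OF T] conv_test_def)
  qed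
  show ?thesis
    unfolding has_vector_derivative_def has_derivative_at
  proof (intro conjI bounded_linear_scaleR_left)
    show "(\<lambda>h. norm (conv_test T \<phi> (x + h) - conv_test T \<phi> x - h *\<^sub>R conv_test T (test_deriv \<phi>) x) / norm h)
        \<midarrow>0\<rightarrow> 0"
    proof (rule Lim_null_comparison)
      have "\<forall>\<^sub>F h in at (0::real). \<bar>h\<bar> \<le> 1"
        by (rule eventually_at[THEN iffD2], rule exI[of _ 1]) auto
      then show "\<forall>\<^sub>F h in at 0. norm (norm (conv_test T \<phi> (x + h) - conv_test T \<phi> x -
          h *\<^sub>R conv_test T (test_deriv \<phi>) x) / norm h) \<le> c * B * \<bar>h\<bar>"
      proof eventually_elim
        case (elim h)
        show ?case
          using rem[OF elim]
          by (cases "h = 0") (auto simp: field_simps power2_eq_square scaleR_conv_of_real abs_if split: if_splits)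
      qed
      show "((\<lambda>h. c * B * \<bar>h\<bar>) \<longlongrightarrow> 0) (at (0::real))"
        by (rule tendsto_eq_intros refl)+ simp
    qed
  qed
qed

lemma nderiv_conv_test:
  assumes "distribution T"
  shows "nderiv j (conv_test T \<phi>) = conv_test T ((test_deriv ^^ j) \<phi>)" "smooth (conv_test T \<phi>)"
  by (rule nderiv_eqI[where g = "\<lambda>j. conv_test T ((test_deriv ^^ j) \<phi>)"]
      smoothI[where g = "\<lambda>j. conv_test T ((test_deriv ^^ j) \<phi>)"];
      simp add: conv_test_has_vector_derivative[OF assms])+

lemma distributions_plus_distribution: "T \<in> distributions_plus \<Longrightarrow> distribution T"
  by (simp add: distributions_plus_def)

text \<open>Regularising with \<open>\<phi>\<close> moves the support of a distribution on the half line by at most the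
  radius of \<open>\<phi>\<close>.\<close>

lemma conv_test_left_of_radius:
  assumes T: "T \<in> distributions_plus" and x: "x < - radius \<phi>"
  shows "conv_test T \<phi> x = 0"
proof -
  have "closure {y. tf (test_reflect x \<phi>) y \<noteq> 0} \<subseteq> {..x + radius \<phi>}"
    by (rule closure_support_subset) (auto simp: tf_test_reflect tf_outside_radius)
  also have "\<dots> \<subseteq> {..<0}" using x by auto
  finally show ?thesis using T by (simp add: distributions_plus_def conv_test_def)
qed

lemma dist_deriv_distributions_plus:
  assumes T: "T \<in> distributions_plus"
  shows "dist_deriv T \<in> distributions_plus"
proof -
  note D = distributions_plus_distribution[OF T]
  have lin: "test_deriv (test_lincomb a b \<phi> \<psi>) = test_lincomb a b (test_deriv \<phi>) (test_deriv \<psi>)" for a b \<phi> \<psi>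
    by (rule test_fun_eqI) (simp add: tf_test_deriv test_lincomb.rep_eq nderiv_lincomb smooth_tf)
  have supp: "closure {x. tf (test_deriv \<phi>) x \<noteq> 0} \<subseteq> closure {x. tf \<phi> x \<noteq> 0}" for \<phi>
  proof (rule closure_support_subset)
    fix x assume x: "x \<notin> closure {x. tf \<phi> x \<noteq> 0}"
    have "(tf \<phi> has_vector_derivative 0) (at x)"
    proof (rule has_vector_derivative_transform_within_open)
      show "((\<lambda>_. 0) has_vector_derivative 0) (at x)" by simp
      show "open (- closure {x. tf \<phi> x \<noteq> 0})" by (intro open_Compl closed_closure)
    qed (use x subsetD[OF closure_subset, of _ "{x. tf \<phi> x \<noteq> 0}"] in auto)
    then show "tf (test_deriv \<phi>) x = 0" by (simp add: tf_test_deriv nderiv_Suc vector_derivative_at)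
  qed simp
  have "distribution (dist_deriv T)"
    unfolding distribution_def
  proof (intro conjI allI impI)
    show "dist_deriv T (test_lincomb a b \<phi> \<psi>) = a * dist_deriv T \<phi> + b * dist_deriv T \<psi>" for a b \<phi> \<psi>
      by (simp add: dist_deriv_def lin distribution_lincomb[OF D])
    fix K :: "real set" assume K: "compact K"
    obtain c N where c: "0 \<le> c" and cN:
      "\<And>\<psi> B. closure {y. tf \<psi> y \<noteq> 0} \<subseteq> K \<Longrightarrow> (\<And>j y. j \<le> N \<Longrightarrow> cmod (nderiv j (tf \<psi>) y) \<le> B) \<Longrightarrow>
        cmod (T \<psi>) \<le> c * B"
      by (rule distribution_continuous[OF D K]) (rule that, assumption, blast)
    have "cmod (dist_deriv T \<phi>) \<le> c * (\<Sum>j\<le>Suc N. SUP x. cmod (nderiv j (tf \<phi>) x))"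
      if "closure {x. tf \<phi> x \<noteq> 0} \<subseteq> K" for \<phi>
      unfolding dist_deriv_def norm_minus_cancel
    proof (rule cN)
      show "closure {y. tf (test_deriv \<phi>) y \<noteq> 0} \<subseteq> K" using supp that by blast
      fix j y assume j: "j \<le> N"
      have "cmod (nderiv j (tf (test_deriv \<phi>)) y) \<le> (SUP x. cmod (nderiv (Suc j) (tf \<phi>) x))"
        unfolding tf_test_deriv nderiv_nderiv using cSUP_upper[OF UNIV_I bdd_above_nderiv_tf, of "Suc j" \<phi> y] by simp
      also have "\<dots> \<le> (\<Sum>j\<le>Suc N. SUP x. cmod (nderiv j (tf \<phi>) x))"
        using j by (intro member_le_sum order_trans[OF norm_ge_zero cSUP_upper[OF UNIV_I bdd_above_nderiv_tf]]) auto
      finally show "cmod (nderiv j (tf (test_deriv \<phi>)) y) \<le> (\<Sum>j\<le>Suc N. SUP x. cmod (nderiv j (tf \<phi>) x))" .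
    qed
    then show "\<exists>c N. \<forall>\<phi>. closure {x. tf \<phi> x \<noteq> 0} \<subseteq> K \<longrightarrow>
        cmod (dist_deriv T \<phi>) \<le> c * (\<Sum>j\<le>N. SUP x. cmod (nderiv j (tf \<phi>) x))" by blast
  qed
  moreover have "dist_deriv T \<phi> = 0" if "closure {x. tf \<phi> x \<noteq> 0} \<subseteq> {..<0}" for \<phi>
    using T supp[of \<phi>] that unfolding distributions_plus_def dist_deriv_def by fastforce
  ultimately show ?thesis by (simp add: distributions_plus_def)
qed

context admissible
begin

text \<open>The bounds on derivatives in the definition of the directing sets are what makes regularised
  distributions moderate.\<close>

lemma nderiv_tf_moderate:
  "\<exists>m. \<forall>\<^sub>F \<phi> in U. \<forall>j\<le>N. \<forall>x. cmod (nderiv j (tf \<phi>) x) \<le> 1 / radius \<phi> ^ m"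
proof (intro exI[of _ "2 * (N + 1)"])
  show "\<forall>\<^sub>F \<phi> in U. \<forall>j\<le>N. \<forall>x. cmod (nderiv j (tf \<phi>) x) \<le> 1 / radius \<phi> ^ (2 * (N + 1))"
    using eventually_directing_set[of "Suc N"] eventually_radius_le[of 1, simplified]
  proof eventually_elim
    case (elim \<phi>)
    show ?case
    proof (intro allI impI)
      fix j x assume "j \<le> N"
      then have "cmod (nderiv j (tf \<phi>) x) \<le> 1 / radius \<phi> ^ (2 * (j + 1))"
        using elim(1) by (auto simp: directing_set_def)
      also have "\<dots> \<le> 1 / radius \<phi> ^ (2 * (N + 1))"
        using \<open>j \<le> N\<close> by (intro radius_power_shrink elim) auto
      finally show "cmod (nderiv j (tf \<phi>) x) \<le> 1 / radius \<phi> ^ (2 * (N + 1))" .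
    qed
  qed
qed

lemma controlled_conv_test:
  assumes T: "distribution T"
  shows "controlled moderate (conv_test T)"
  unfolding controlled_def
proof (intro conjI allI)
  show "smooth (conv_test T \<phi>)" for \<phi> by (rule nderiv_conv_test[OF T])
  fix i and M :: nat
  \<comment> \<open>contains all supports once radii are at most 1\<close>
  define K where "K = {- real M - 1..real M + 1}"
  obtain c N where c: "0 \<le> c" and cN:
    "\<And>\<psi> B. closure {y. tf \<psi> y \<noteq> 0} \<subseteq> K \<Longrightarrow> (\<And>j y. j \<le> N \<Longrightarrow> cmod (nderiv j (tf \<psi>) y) \<le> B) \<Longrightarrow>
      cmod (T \<psi>) \<le> c * B"
    by (rule distribution_continuous[OF T, of K]) (auto simp: K_def)
  obtain m where m: "\<forall>\<^sub>F \<phi> in U. \<forall>j\<le>N + i. \<forall>x. cmod (nderiv j (tf \<phi>) x) \<le> 1 / radius \<phi> ^ m"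
    using nderiv_tf_moderate by blast
  have "moderate (\<lambda>\<phi>. c * (1 / radius \<phi> ^ m))"
    by (rule size_class_cmult[OF size_class_moderate moderate_radius_power c]) simp
  moreover have "\<forall>\<^sub>F \<phi> in U. \<forall>x\<in>{- real M..real M}. cmod (nderiv i (conv_test T \<phi>) x) \<le> c * (1 / radius \<phi> ^ m)"
    using m eventually_radius_le[of 1, simplified]
  proof eventually_elim
    case (elim \<phi>)
    show ?case
    proof
      fix x assume x: "x \<in> {- real M..real M}"
      show "cmod (nderiv i (conv_test T \<phi>) x) \<le> c * (1 / radius \<phi> ^ m)"
        unfolding nderiv_conv_test[OF T] unfolding conv_test_def
      proof (rule cN)
        show "closure {y. tf (test_reflect x ((test_deriv ^^ i) \<phi>)) y \<noteq> 0} \<subseteq> K"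
        proof (rule closure_support_subset)
          fix y assume "y \<notin> K"
          then have "radius \<phi> < \<bar>x - y\<bar>" using x elim(2) by (auto simp: K_def)
          then show "tf (test_reflect x ((test_deriv ^^ i) \<phi>)) y = 0"
            by (simp add: tf_test_reflect tf_test_deriv_pow nderiv_tf_outside)
        qed (simp add: K_def)
        fix j y assume "j \<le> N"
        then show "cmod (nderiv j (tf (test_reflect x ((test_deriv ^^ i) \<phi>))) y) \<le> 1 / radius \<phi> ^ m"
          using elim(1)
          by (simp add: tf_test_reflect tf_test_deriv_pow nderiv_reflect smooth_nderiv smooth_tf
              nderiv_nderiv norm_mult norm_power)
      qed
    qed
  qed
  ultimately show "\<exists>B. moderate B \<and> (\<forall>\<^sub>F \<phi> in U. \<forall>x\<in>{- real M..real M}.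
      cmod (nderiv i (conv_test T \<phi>) x) \<le> B \<phi>)" by blast
qed

end

section \<open>Convolution with causal exponential kernels\<close>

lemma has_integral_heaviside:
  fixes f F :: "real \<Rightarrow> complex"
  assumes F: "\<And>t. (F has_vector_derivative f t) (at t)" and cont: "continuous_on UNIV f"
    and b: "0 \<le> b" "\<And>t. b < t \<Longrightarrow> f t = 0"
  shows "has_bochner_integral lborel (\<lambda>t. of_real (heaviside t) * f t) (F b - F 0)"
proof -
  have "has_bochner_integral lborel (\<lambda>t. indicator {0..b} t *\<^sub>R f t) (F b - F 0)"
    by (rule has_bochner_integral_FTC_Icc)
      (use b F cont in \<open>auto intro: has_vector_derivative_at_within continuous_on_subset\<close>)
  moreover have "(\<lambda>t. indicator {0..b} t *\<^sub>R f t) = (\<lambda>t. of_real (heaviside t) * f t)"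
    using b by (auto simp: fun_eq_iff heaviside_def indicator_def not_le)
  ultimately show ?thesis by simp
qed

text \<open>The convolution with \<open>H(t) exp (l t)\<close>, which is the causal fundamental solution of \<open>u' - l u\<close>.\<close>

definition exp_conv :: "complex \<Rightarrow> (real \<Rightarrow> complex) \<Rightarrow> real \<Rightarrow> complex" where
  "exp_conv l h x = (LINT t|lborel. of_real (heaviside t) * (exp (l * of_real t) * h (x - t)))"

text \<open>Substituting \<open>s = x - t\<close> turns the convolution into \<open>exp (l x)\<close> times the antiderivative of
  \<open>exp (-l s) * h s\<close> that vanishes on the left.\<close>

lemma exp_conv_antiderivative:
  fixes l :: complex and h :: "real \<Rightarrow> complex"
  assumes cont: "continuous_on UNIV h" and zero: "\<And>x. x < b \<Longrightarrow> h x = 0"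
  shows "\<exists>P. (\<forall>x. (P has_vector_derivative exp (- l * of_real x) * h x) (at x)) \<and> (\<forall>x<b. P x = 0) \<and>
    (\<forall>x. has_bochner_integral lborel
      (\<lambda>t. of_real (heaviside t) * (exp (l * of_real t) * h (x - t))) (exp (l * of_real x) * P x))"
proof -
  have ch: "continuous_on UNIV (\<lambda>x. exp (- l * of_real x) * h x)"
    by (intro continuous_intros cont)
  have hz: "\<And>x. x < b \<Longrightarrow> exp (- l * of_real x) * h x = 0" using zero by simp
  obtain P where P: "\<And>x. (P has_vector_derivative exp (- l * of_real x) * h x) (at x)"
    "\<And>x. x < b \<Longrightarrow> P x = 0"
    using antiderivative_vanishing_left[OF ch, of b] hz by auto
  have "has_bochner_integral lborel
      (\<lambda>t. of_real (heaviside t) * (exp (l * of_real t) * h (x - t))) (exp (l * of_real x) * P x)" for x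
  proof -
    \<comment> \<open>beyond \<open>B\<close> the argument \<open>x - t\<close> lies where \<open>h\<close> vanishes\<close>
    define B where "B = max 0 (x - b) + 1"
    have "((\<lambda>t. - (exp (l * of_real x) * P (x - t))) has_vector_derivative exp (l * of_real t) * h (x - t)) (at t)" for t
    proof -
      have "((\<lambda>t. x - t) has_vector_derivative -1) (at t)" by (auto intro!: derivative_eq_intros)
      from vector_diff_chain_at[OF this P(1)]
      have "((\<lambda>t. P (x - t)) has_vector_derivative - (exp (- l * of_real (x - t)) * h (x - t))) (at t)"
        by (simp add: o_def)
      then have "((\<lambda>t. - (exp (l * of_real x) * P (x - t))) has_vector_derivative
          - (exp (l * of_real x) * - (exp (- l * of_real (x - t)) * h (x - t)))) (at t)"
        by (intro has_vector_derivative_minus has_vector_derivative_mult_right)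
      also have "- (exp (l * of_real x) * - (exp (- l * of_real (x - t)) * h (x - t))) =
          exp (l * of_real x) * exp (- l * of_real (x - t)) * h (x - t)" by simp
      also have "exp (l * of_real x) * exp (- l * of_real (x - t)) = exp (l * of_real t)"
        unfolding exp_add[symmetric] by (simp add: algebra_simps)
      finally show ?thesis .
    qed
    moreover have "continuous_on UNIV (\<lambda>t. exp (l * of_real t) * h (x - t))"
      by (intro continuous_intros continuous_on_compose2[OF cont]) auto
    moreover have "0 \<le> B" "\<And>t. B < t \<Longrightarrow> exp (l * of_real t) * h (x - t) = 0"
      using zero by (auto simp: B_def)
    ultimately have "has_bochner_integral lborel
        (\<lambda>t. of_real (heaviside t) * (exp (l * of_real t) * h (x - t)))
        (- (exp (l * of_real x) * P (x - B)) - - (exp (l * of_real x) * P (x - 0)))"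
      by (rule has_integral_heaviside)
    moreover have "P (x - B) = 0" by (rule P(2)) (simp add: B_def)
    ultimately show ?thesis by simp
  qed
  with P show ?thesis by blast
qed

lemma
  fixes l :: complex and h :: "real \<Rightarrow> complex"
  assumes cont: "continuous_on UNIV h" and zero: "\<And>x. x < b \<Longrightarrow> h x = 0"
  shows integrable_exp_conv:
      "integrable lborel (\<lambda>t. of_real (heaviside t) * (exp (l * of_real t) * h (x - t)))"
    and exp_conv_has_vector_derivative:
      "(exp_conv l h has_vector_derivative l * exp_conv l h x + h x) (at x)"
    and exp_conv_eq_0: "x < b \<Longrightarrow> exp_conv l h x = 0"
proof -
  obtain P where P: "\<And>x. (P has_vector_derivative exp (- l * of_real x) * h x) (at x)"
    "\<And>x. x < b \<Longrightarrow> P x = 0"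
    and I: "\<And>x. has_bochner_integral lborel
      (\<lambda>t. of_real (heaviside t) * (exp (l * of_real t) * h (x - t))) (exp (l * of_real x) * P x)"
    using exp_conv_antiderivative[OF cont, of b l] zero by auto
  have eq: "exp_conv l h x = exp (l * of_real x) * P x" for x
    unfolding exp_conv_def by (rule has_bochner_integral_integral_eq[OF I])
  show "integrable lborel (\<lambda>t. of_real (heaviside t) * (exp (l * of_real t) * h (x - t)))"
    using I[of x] by (rule integrable.intros)
  have "((\<lambda>x. exp (l * of_real x) * P x) has_vector_derivative
      exp (l * of_real x) * (exp (- l * of_real x) * h x) + (l * exp (l * of_real x)) * P x) (at x)"
    by (rule has_vector_derivative_mult exp_has_vector_derivative P)+
  then show "(exp_conv l h has_vector_derivative l * exp_conv l h x + h x) (at x)"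
    unfolding eq[abs_def] by (simp add: mult.assoc[symmetric] exp_add[symmetric] add.commute)
  show "x < b \<Longrightarrow> exp_conv l h x = 0" by (simp add: eq P(2))
qed

lemma exp_conv_lincomb:
  assumes "finite A" and "\<And>n. n \<in> A \<Longrightarrow> continuous_on UNIV (h n)"
    and "\<And>n x. n \<in> A \<Longrightarrow> x < b \<Longrightarrow> h n x = 0"
  shows "exp_conv l (\<lambda>x. \<Sum>n\<in>A. a n * h n x) x = (\<Sum>n\<in>A. a n * exp_conv l (h n) x)"
proof -
  have i: "integrable lborel (\<lambda>t. of_real (heaviside t) * (exp (l * of_real t) * h n (x - t)))" if "n \<in> A" for n
    by (rule integrable_exp_conv) (use assms that in auto)
  have "exp_conv l (\<lambda>x. \<Sum>n\<in>A. a n * h n x) x =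
      (LINT t|lborel. (\<Sum>n\<in>A. a n * (of_real (heaviside t) * (exp (l * of_real t) * h n (x - t)))))"
    unfolding exp_conv_def by (simp add: sum_distrib_left mult_ac)
  also have "\<dots> = (\<Sum>n\<in>A. a n * exp_conv l (h n) x)"
    unfolding exp_conv_def by (subst Bochner_Integration.integral_sum) (auto simp: i)
  finally show ?thesis .
qed

lemma exp_conv_diff:
  assumes "continuous_on UNIV f" "continuous_on UNIV g"
    and "\<And>x. x < b \<Longrightarrow> f x = 0" "\<And>x. x < b \<Longrightarrow> g x = 0"
  shows "exp_conv l (\<lambda>x. f x - g x) x = exp_conv l f x - exp_conv l g x"
proof -
  have "integrable lborel (\<lambda>t. of_real (heaviside t) * (exp (l * of_real t) * f (x - t)))"
    "integrable lborel (\<lambda>t. of_real (heaviside t) * (exp (l * of_real t) * g (x - t)))"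
    by (rule integrable_exp_conv; use assms in auto)+
  then show ?thesis
    unfolding exp_conv_def by (simp add: right_diff_distrib)
qed

text \<open>On the half line every kernel in the theorem is such a combination of two exponentials, with the
  characteristic roots as exponents. The family is closed under differentiation, which multiplies
  the coefficients by the exponents.\<close>

definition exp_kernel :: "complex \<Rightarrow> complex \<Rightarrow> complex \<Rightarrow> complex \<Rightarrow> real \<Rightarrow> complex" where
  "exp_kernel c l d m t = c * exp (l * of_real t) + d * exp (m * of_real t)"

definition kernel_conv ::
    "complex \<Rightarrow> complex \<Rightarrow> complex \<Rightarrow> complex \<Rightarrow> (real \<Rightarrow> complex) \<Rightarrow> real \<Rightarrow> complex" where
  "kernel_conv c l d m h x = c * exp_conv l h x + d * exp_conv m h x"

definition causal_dist :: "complex \<Rightarrow> complex \<Rightarrow> complex \<Rightarrow> complex \<Rightarrow> test_fun \<Rightarrow> complex" where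
  "causal_dist c l d m = dist_of (\<lambda>t. of_real (heaviside t) * exp_kernel c l d m t)"

context admissible
begin

text \<open>An antiderivative of a test function with integral 1 climbs from 0 to 1 within the support of that
  test function. A suitable one exists because the filter is proper and contains the first directing
  set, in which radii are at most 1; the shift by 3 moves the climb to the left of the origin.\<close>

lemma cutoff_exists: "\<exists>\<kappa>. cutoff \<kappa>"
proof -
  obtain \<phi> where phi: "\<phi> \<in> directing_set 1"
    using eventually_happens[OF eventually_directing_set] U_nontrivial by blast
  then have r: "radius \<phi> \<le> 1" and int: "(LINT x|lborel. tf \<phi> x) = 1"
    by (simp_all add: directing_set_def)
  have cont: "continuous_on S (tf \<phi>)" for S
    using smooth_continuous_on[OF smooth_tf[of \<phi>], of S 0] by simp
  obtain P where P: "\<And>x. (P has_vector_derivative tf \<phi> x) (at x)" "\<And>x. x < - radius \<phi> \<Longrightarrow> P x = 0"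
    using antiderivative_vanishing_left[of "tf \<phi>" "- radius \<phi>"] cont[of UNIV]
    by (auto simp: tf_outside_radius)
  have smooth: "smooth P"
    by (rule smooth_of_linear_ode[where l = 0 and h = "tf \<phi>"]) (simp_all add: P smooth_tf)
  have one: "P x = 1" if x: "1 < x" for x
  proof -
    have "(LINT t|lborel. indicator {- x..x} t *\<^sub>R tf \<phi> t) = P x - P (- x)"
      by (rule integral_FTC_Icc) (use x P cont in \<open>auto intro: has_vector_derivative_at_within\<close>)
    moreover have "(\<lambda>t. indicator {- x..x} t *\<^sub>R tf \<phi> t) = tf \<phi>"
    proof
      fix t show "indicator {- x..x} t *\<^sub>R tf \<phi> t = tf \<phi> t"
        using x r tf_outside_radius[of \<phi> t] by (cases "radius \<phi> < \<bar>t\<bar>") (auto simp: indicator_def)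
    qed
    moreover have "P (- x) = 0" using x r by (intro P(2)) simp
    ultimately show ?thesis using int by simp
  qed
  have "smooth (\<lambda>x. P (0 - (- 3 - x)))"
    by (rule smooth_reflect[of "\<lambda>x. P (0 - x)"], rule smooth_reflect[OF smooth])
  then have "smooth (\<lambda>x. P (x + 3))" by (simp add: add.commute)
  moreover have "\<exists>a>0. \<forall>x\<ge>-a. P (x + 3) = 1" by (intro exI[of _ 1]) (auto intro!: one)
  moreover have "\<exists>b. \<forall>x\<le>b. P (x + 3) = 0"
    using r by (intro exI[of _ "- 5"]) (auto intro!: P(2))
  ultimately show ?thesis unfolding cutoff_def by blast
qed

text \<open>The cutoff changes a test function only where the distribution vanishes.\<close>

lemma distribution_plus_cutoff:
  assumes S: "S \<in> distributions_plus" and k: "cutoff \<kappa>"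
  shows "S (Abs_test_fun (\<lambda>y. \<kappa> y * tf \<psi> y)) = S \<psi>"
proof -
  let ?\<eta> = "Abs_test_fun (\<lambda>y. \<kappa> y * tf \<psi> y)"
  have tf: "tf ?\<eta> = (\<lambda>y. \<kappa> y * tf \<psi> y)"
    by (rule tf_Abs_test_fun[of _ "radius \<psi>"])
      (use k in \<open>auto simp: cutoff_def tf_outside_radius intro!: smooth_mult smooth_tf\<close>)
  obtain a where a: "a > 0" "\<And>x. x \<ge> - a \<Longrightarrow> \<kappa> x = 1" using k unfolding cutoff_def by blast
  have "closure {x. tf (test_lincomb 1 (- 1) ?\<eta> \<psi>) x \<noteq> 0} \<subseteq> {..- a}"
    by (rule closure_support_subset) (use a in \<open>auto simp: test_lincomb.rep_eq tf\<close>)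
  also have "\<dots> \<subseteq> {..<0}" using a by auto
  finally have "S (test_lincomb 1 (- 1) ?\<eta> \<psi>) = 0" using S by (simp add: distributions_plus_def)
  then show ?thesis by (simp add: distribution_lincomb distributions_plus_distribution[OF S])
qed

text \<open>Inside the definition of the convolution the inner functional is the regularisation of \<open>S\<close>, by the
  preceding lemma, and the outer cutoff is 1 on the half line over which the kernel is integrated.\<close>

lemma conv_test_conv_plus:
  assumes S: "S \<in> distributions_plus"
  shows "conv_test (conv_plus (dist_of (\<lambda>t. of_real (heaviside t) * k t)) S) \<phi> x
    = (LINT t|lborel. of_real (heaviside t) * (k t * conv_test S \<phi> (x - t)))"
proof -
  define \<kappa> where "\<kappa> = (SOME \<kappa>. cutoff \<kappa>)"
  have k: "cutoff \<kappa>" unfolding \<kappa>_def using cutoff_exists by (rule someI_ex)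
  obtain b where b: "\<And>x. x \<le> b \<Longrightarrow> \<kappa> x = 0" using k unfolding cutoff_def by blast
  have k1: "\<kappa> y = 1" if "0 \<le> y" for y
    using k that unfolding cutoff_def by force
  have inner: "S (Abs_test_fun (\<lambda>z. \<kappa> z * tf (test_reflect x \<phi>) (y + z))) = conv_test S \<phi> (x - y)" for y
  proof -
    have "(\<lambda>z. \<kappa> z * tf (test_reflect x \<phi>) (y + z)) = (\<lambda>z. \<kappa> z * tf (test_reflect (x - y) \<phi>) z)"
      by (simp add: tf_test_reflect algebra_simps)
    then show ?thesis by (simp add: distribution_plus_cutoff[OF S k] conv_test_def)
  qed
  have tf: "tf (Abs_test_fun (\<lambda>y. \<kappa> y * conv_test S \<phi> (x - y))) = (\<lambda>y. \<kappa> y * conv_test S \<phi> (x - y))"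
  proof (rule tf_Abs_test_fun)
    show "smooth (\<lambda>y. \<kappa> y * conv_test S \<phi> (x - y))"
      using k by (intro smooth_mult smooth_reflect nderiv_conv_test distributions_plus_distribution S)
        (simp add: cutoff_def)
    fix y assume "max \<bar>b\<bar> \<bar>x + radius \<phi>\<bar> < \<bar>y\<bar>"
    then have "y \<le> b \<or> x - y < - radius \<phi>" by linarith
    then show "\<kappa> y * conv_test S \<phi> (x - y) = 0"
      using b conv_test_left_of_radius[OF S] by auto
  qed
  have "conv_test (conv_plus (dist_of (\<lambda>t. of_real (heaviside t) * k t)) S) \<phi> x =
      (LINT t|lborel. of_real (heaviside t) * k t * (\<kappa> t * conv_test S \<phi> (x - t)))"
    unfolding conv_test_def[of "conv_plus _ _"] conv_plus_def Let_def \<kappa>_def[symmetric] inner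
      dist_of_def tf ..
  also have "\<dots> = (LINT t|lborel. of_real (heaviside t) * (k t * conv_test S \<phi> (x - t)))"
    by (rule Bochner_Integration.integral_cong) (auto simp: heaviside_def k1)
  finally show ?thesis .
qed

lemma continuous_conv_test: "distribution S \<Longrightarrow> continuous_on A (conv_test S \<phi>)"
  by (intro smooth_imp_continuous_on nderiv_conv_test)

lemma conv_test_causal_dist:
  assumes S: "S \<in> distributions_plus"
  shows "conv_test (conv_plus (causal_dist c l d m) S) \<phi> x = kernel_conv c l d m (conv_test S \<phi>) x"
proof -
  note D = distributions_plus_distribution[OF S]
  have i: "integrable lborel (\<lambda>t. of_real (heaviside t) * (exp (l * of_real t) * conv_test S \<phi> (x - t)))" for l
    by (rule integrable_exp_conv[of _ "- radius \<phi>"])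
      (auto simp: conv_test_left_of_radius[OF S] continuous_conv_test[OF D])
  have "(LINT t|lborel. of_real (heaviside t) * (exp_kernel c l d m t * conv_test S \<phi> (x - t))) =
    (LINT t|lborel. c * (of_real (heaviside t) * (exp (l * of_real t) * conv_test S \<phi> (x - t)))
      + d * (of_real (heaviside t) * (exp (m * of_real t) * conv_test S \<phi> (x - t))))"
    by (simp add: exp_kernel_def algebra_simps)
  also have "\<dots> = kernel_conv c l d m (conv_test S \<phi>) x"
    by (simp add: kernel_conv_def exp_conv_def i)
  finally show ?thesis by (simp add: causal_dist_def conv_test_conv_plus[OF S])
qed

text \<open>The support property of regularised distributions on the half line. It makes the integrals over
  half lines finite and provides the vanishing initial value from which estimates start.\<close>

definition causal_net :: "(test_fun \<Rightarrow> real \<Rightarrow> complex) \<Rightarrow> bool" where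
  "causal_net h \<longleftrightarrow> (\<forall>\<phi> x. x < - radius \<phi> \<longrightarrow> h \<phi> x = 0)"

lemma continuous_controlled: "controlled P h \<Longrightarrow> continuous_on A (h \<phi>)"
  by (intro smooth_imp_continuous_on controlled_smooth)

lemma exp_conv_net_derivative:
  "controlled P h \<Longrightarrow> causal_net h \<Longrightarrow>
    (exp_conv l (h \<phi>) has_vector_derivative l * exp_conv l (h \<phi>) x + h \<phi> x) (at x)"
  by (rule exp_conv_has_vector_derivative[of _ "- radius \<phi>"])
    (auto simp: causal_net_def continuous_controlled)

text \<open>As soon as radii are at most 1, the point \<open>-2\<close> lies to the left of all supports, and the
  convolution vanishes there.\<close>

lemma controlled_exp_conv:
  assumes P: "size_class P" and h: "controlled P h" "causal_net h"
  shows "controlled P (\<lambda>\<phi>. exp_conv l (h \<phi>))"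
proof (rule controlled_linear_ode[OF P _ h(1), where s = "- 2"])
  show "(exp_conv l (h \<phi>) has_vector_derivative l * exp_conv l (h \<phi>) x + h \<phi> x) (at x)" for \<phi> x
    by (rule exp_conv_net_derivative[OF h])
  have "\<forall>\<^sub>F \<phi> in U. cmod (exp_conv l (h \<phi>) (- 2)) \<le> 0"
    using eventually_radius_le[of 1, simplified]
  proof eventually_elim
    case (elim \<phi>)
    have "exp_conv l (h \<phi>) (- 2) = 0"
      by (rule exp_conv_eq_0[of _ "- radius \<phi>"])
        (use h elim in \<open>auto simp: causal_net_def continuous_controlled\<close>)
    then show ?case by simp
  qed
  then show "P (\<lambda>\<phi>. cmod (exp_conv l (h \<phi>) (- 2)))"
    by (rule size_class_mono[OF P size_class_0[OF P]])
qed

lemma controlled_kernel_conv: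
  assumes P: "size_class P" and h: "controlled P h" "causal_net h"
  shows "controlled P (\<lambda>\<phi>. kernel_conv c l d m (h \<phi>))"
  unfolding kernel_conv_def[abs_def]
  by (intro controlled_add controlled_cmult controlled_exp_conv P h)

text \<open>The summand with the factor \<open>c + d\<close>, the value of the kernel at 0, is the jump of the causal kernel
  at the origin.\<close>

lemma kernel_conv_has_vector_derivative:
  assumes h: "controlled P h" "causal_net h"
  shows "(kernel_conv c l d m (h \<phi>) has_vector_derivative
      kernel_conv (c * l) l (d * m) m (h \<phi>) x + (c + d) * h \<phi> x) (at x)"
  unfolding kernel_conv_def[abs_def]
  by (rule derivative_eq_intros exp_conv_net_derivative[OF h] refl)+ (simp add: algebra_simps)

lemma eclass_kernel_conv_cong:
  assumes f: "controlled moderate f" "causal_net f" and g: "controlled moderate g" "causal_net g"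
    and eq: "eclass U f = eclass U g"
  shows "eclass U (\<lambda>\<phi>. kernel_conv c l d m (f \<phi>)) = eclass U (\<lambda>\<phi>. kernel_conv c l d m (g \<phi>))"
proof -
  have "controlled negligible_net (\<lambda>\<phi> x. f \<phi> x - g \<phi> x)"
    using eq by (simp add: eclass_eq_iff f g)
  then have "controlled negligible_net (\<lambda>\<phi>. kernel_conv c l d m (\<lambda>x. f \<phi> x - g \<phi> x))"
    by (rule controlled_kernel_conv[OF size_class_negligible]) (use f g in \<open>auto simp: causal_net_def\<close>)
  moreover have "(\<lambda>\<phi>. kernel_conv c l d m (\<lambda>x. f \<phi> x - g \<phi> x))
      = (\<lambda>\<phi> x. kernel_conv c l d m (f \<phi>) x - kernel_conv c l d m (g \<phi>) x)"
  proof (intro ext)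
    fix \<phi> x
    have "exp_conv l (\<lambda>x. f \<phi> x - g \<phi> x) x = exp_conv l (f \<phi>) x - exp_conv l (g \<phi>) x" for l
      by (rule exp_conv_diff[of _ _ "- radius \<phi>"])
        (use f g in \<open>auto simp: causal_net_def continuous_controlled\<close>)
    then show "kernel_conv c l d m (\<lambda>x. f \<phi> x - g \<phi> x) x
        = kernel_conv c l d m (f \<phi>) x - kernel_conv c l d m (g \<phi>) x"
      by (simp add: kernel_conv_def) (simp add: algebra_simps)
  qed
  ultimately have "controlled negligible_net (\<lambda>\<phi> x. kernel_conv c l d m (f \<phi>) x - kernel_conv c l d m (g \<phi>) x)"
    by simp
  then show ?thesis by (simp add: eclass_eq_iff controlled_kernel_conv f g)
qed

section \<open>Convolution on the span of the embedded distributions\<close>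

text \<open>The canonical representative of \<open>\<Sum> \<alpha>\<^sub>n \<iota>(T\<^sub>n)\<close>.\<close>

definition span_net :: "nat \<Rightarrow> (nat \<Rightarrow> test_fun \<Rightarrow> complex) \<Rightarrow> (nat \<Rightarrow> test_fun \<Rightarrow> complex) \<Rightarrow> test_fun \<Rightarrow> real \<Rightarrow> complex" where
  "span_net m a S = (\<lambda>\<phi> x. \<Sum>n\<in>{1..m}. a n \<phi> * conv_test (S n) \<phi> x)"

definition span_data :: "nat \<Rightarrow> (nat \<Rightarrow> test_fun \<Rightarrow> complex) \<Rightarrow> (nat \<Rightarrow> test_fun \<Rightarrow> complex) \<Rightarrow> bool" where
  "span_data m a S \<longleftrightarrow> m \<ge> 1 \<and> (\<forall>n\<in>{1..m}. mod_net (a n) \<and> S n \<in> distributions_plus)"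

lemma span_data_controlled:
  assumes "span_data m a S" "n \<in> {1..m}"
  shows "controlled moderate (conv_test (S n))" "mod_net (a n)" "S n \<in> distributions_plus"
  using assms controlled_conv_test[OF distributions_plus_distribution] by (auto simp: span_data_def)

lemma span_net_controlled: "span_data m a S \<Longrightarrow> controlled moderate (span_net m a S)"
  unfolding span_net_def
  by (intro controlled_sum controlled_scale) (auto dest: span_data_controlled)

lemma span_net_causal: "span_data m a S \<Longrightarrow> causal_net (span_net m a S)"
  unfolding span_net_def causal_net_def
  by (auto intro!: sum.neutral simp: conv_test_left_of_radius span_data_def)

lemma conv_test_span_data:
  assumes data: "span_data k a S" and n: "n \<in> {1..k}"
  shows "conv_test (conv_plus (causal_dist c l d m) (S n)) = (\<lambda>\<phi>. kernel_conv c l d m (conv_test (S n) \<phi>))"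
    and "controlled moderate (\<lambda>\<phi>. kernel_conv c l d m (conv_test (S n) \<phi>))"
proof -
  note S = span_data_controlled[OF data n]
  show "conv_test (conv_plus (causal_dist c l d m) (S n)) = (\<lambda>\<phi>. kernel_conv c l d m (conv_test (S n) \<phi>))"
    using conv_test_causal_dist[OF S(3)] by (simp add: fun_eq_iff)
  show "controlled moderate (\<lambda>\<phi>. kernel_conv c l d m (conv_test (S n) \<phi>))"
    by (rule controlled_kernel_conv)
      (use S in \<open>auto simp: causal_net_def conv_test_left_of_radius\<close>)
qed

lemma span_sum_eclass:
  assumes data: "span_data m a S" and \<alpha>: "\<And>n. n \<in> {1..m} \<Longrightarrow> \<alpha> n = cclass U (a n)"
  shows "(\<Oplus>\<^bsub>Ehat U\<^esub>n\<in>{1..m}. \<alpha> n \<cdot>\<^bsub>U\<^esub> iota U (S n)) = eclass U (span_net m a S)"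
proof -
  interpret cring "Ehat U" by (rule cring_Ehat)
  have "(\<Oplus>\<^bsub>Ehat U\<^esub>n\<in>{1..m}. \<alpha> n \<cdot>\<^bsub>U\<^esub> iota U (S n))
      = (\<Oplus>\<^bsub>Ehat U\<^esub>n\<in>{1..m}. eclass U (\<lambda>\<phi> x. a n \<phi> * conv_test (S n) \<phi> x))"
    using span_data_controlled[OF data] \<alpha>
    by (intro finsum_cong') (auto simp: iota_def gscale_eclass controlled_scale)
  also have "\<dots> = eclass U (span_net m a S)"
    unfolding span_net_def
    by (rule finsum_eclass) (use span_data_controlled[OF data] in \<open>auto intro: controlled_scale\<close>)
  finally show ?thesis .
qed

lemma span_conv_sum_eclass:
  assumes data: "span_data k a S" and \<alpha>: "\<And>n. n \<in> {1..k} \<Longrightarrow> \<alpha> n = cclass U (a n)"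
  shows "(\<Oplus>\<^bsub>Ehat U\<^esub>n\<in>{1..k}. \<alpha> n \<cdot>\<^bsub>U\<^esub> iota U (conv_plus (causal_dist c l d m) (S n)))
    = eclass U (\<lambda>\<phi>. kernel_conv c l d m (span_net k a S \<phi>))"
proof -
  interpret cring "Ehat U" by (rule cring_Ehat)
  note S = span_data_controlled[OF data] and conv = conv_test_span_data[OF data]
  have eq: "kernel_conv c l d m (span_net k a S \<phi>) x =
      (\<Sum>n\<in>{1..k}. a n \<phi> * kernel_conv c l d m (conv_test (S n) \<phi>) x)" for \<phi> x
  proof -
    have "exp_conv l (span_net k a S \<phi>) x = (\<Sum>n\<in>{1..k}. a n \<phi> * exp_conv l (conv_test (S n) \<phi>) x)" for l
      unfolding span_net_def
      by (rule exp_conv_lincomb[where b = "- radius \<phi>"])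
        (use S in \<open>auto simp: continuous_controlled[of moderate] conv_test_left_of_radius\<close>)
    then show ?thesis
      by (simp add: kernel_conv_def sum.distrib sum_distrib_left algebra_simps)
  qed
  have "(\<Oplus>\<^bsub>Ehat U\<^esub>n\<in>{1..k}. \<alpha> n \<cdot>\<^bsub>U\<^esub> iota U (conv_plus (causal_dist c l d m) (S n)))
      = (\<Oplus>\<^bsub>Ehat U\<^esub>n\<in>{1..k}. eclass U (\<lambda>\<phi> x. a n \<phi> * kernel_conv c l d m (conv_test (S n) \<phi>) x))"
    using S \<alpha> conv by (intro finsum_cong') (auto simp: iota_def gscale_eclass controlled_scale)
  also have "\<dots> = eclass U (\<lambda>\<phi> x. \<Sum>n\<in>{1..k}. a n \<phi> * kernel_conv c l d m (conv_test (S n) \<phi>) x)"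
    by (rule finsum_eclass) (use S conv in \<open>auto intro: controlled_scale\<close>)
  finally show ?thesis by (simp add: eq[abs_def])
qed

lemma span_data_ex:
  assumes "m \<ge> (1::nat)" "\<forall>n\<in>{1..m}. \<alpha> n \<in> carrier (Chat U) \<and> S n \<in> distributions_plus"
  obtains a where "span_data m a S" "\<And>n. n \<in> {1..m} \<Longrightarrow> \<alpha> n = cclass U (a n)"
proof -
  have "\<forall>n\<in>{1..m}. \<exists>b. mod_net b \<and> \<alpha> n = cclass U b" using assms(2) carrier_Chat by blast
  then obtain a where a: "\<forall>n\<in>{1..m}. mod_net (a n) \<and> \<alpha> n = cclass U (a n)" by metis
  then show thesis using assms by (intro that[of a]) (auto simp: span_data_def)
qed

lemma span_hatE:
  assumes "V \<in> span_hat U distributions_plus"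
  obtains m a S where "span_data m a S" "V = eclass U (span_net m a S)"
proof -
  obtain m \<alpha> S where V: "m \<ge> (1::nat)" "\<forall>n\<in>{1..m}. \<alpha> n \<in> carrier (Chat U) \<and> S n \<in> distributions_plus"
    "V = (\<Oplus>\<^bsub>Ehat U\<^esub>n\<in>{1..m}. \<alpha> n \<cdot>\<^bsub>U\<^esub> iota U (S n))"
    using assms unfolding span_hat_def by blast
  obtain a where a: "span_data m a S" "\<And>n. n \<in> {1..m} \<Longrightarrow> \<alpha> n = cclass U (a n)"
    using span_data_ex[OF V(1,2)] by blast
  show thesis using that[OF a(1)] span_sum_eclass[OF a] V(3) by blast
qed

lemma span_net_deriv:
  assumes data: "span_data m a S"
  shows "(\<lambda>\<phi>. nderiv 1 (span_net m a S \<phi>)) = span_net m a (\<lambda>n. dist_deriv (S n))"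
    and "span_data m a (\<lambda>n. dist_deriv (S n))"
proof -
  have D: "distribution (S n)" if "n \<in> {1..m}" for n
    using span_data_controlled(3)[OF data that] by (rule distributions_plus_distribution)
  show "(\<lambda>\<phi>. nderiv 1 (span_net m a S \<phi>)) = span_net m a (\<lambda>n. dist_deriv (S n))"
  proof (intro ext)
    fix \<phi> x
    have "nderiv 1 (span_net m a S \<phi>) = (\<lambda>x. \<Sum>n\<in>{1..m}. nderiv 1 (\<lambda>x. a n \<phi> * conv_test (S n) \<phi> x) x)"
      unfolding span_net_def by (rule nderiv_sum) (intro smooth_cmult nderiv_conv_test D)
    then have "nderiv 1 (span_net m a S \<phi>) x = (\<Sum>n\<in>{1..m}. nderiv 1 (\<lambda>x. a n \<phi> * conv_test (S n) \<phi> x) x)"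
      by simp
    also have "\<dots> = span_net m a (\<lambda>n. dist_deriv (S n)) \<phi> x"
      unfolding span_net_def
    proof (rule sum.cong)
      fix n assume n: "n \<in> {1..m}"
      show "nderiv 1 (\<lambda>x. a n \<phi> * conv_test (S n) \<phi> x) x = a n \<phi> * conv_test (dist_deriv (S n)) \<phi> x"
        unfolding nderiv_cmult[OF nderiv_conv_test(2)[OF D[OF n]]] nderiv_conv_test(1)[OF D[OF n]]
        by (simp add: conv_test_dist_deriv[OF D[OF n]])
    qed simp
    finally show "nderiv 1 (span_net m a S \<phi>) x = span_net m a (\<lambda>n. dist_deriv (S n)) \<phi> x" .
  qed
  show "span_data m a (\<lambda>n. dist_deriv (S n))"
    using data by (auto simp: span_data_def dist_deriv_distributions_plus)
qed

text \<open>A generalized function has many representations \<open>\<Sum> \<alpha>\<^sub>n \<iota>(T\<^sub>n)\<close>, and the convolution is defined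
  through any of them. On representatives it is an integral operator that acts on the sum as a whole
  and maps negligible causal nets to negligible ones, so the result depends only on the class.\<close>

lemma gconv_causal_dist:
  assumes data: "span_data k a S"
  shows "gconv U (causal_dist c l d m) (eclass U (span_net k a S))
    = eclass U (\<lambda>\<phi>. kernel_conv c l d m (span_net k a S \<phi>))"
  unfolding gconv_def
proof (rule the_equality)
  let ?f = "eclass U (span_net k a S)"
  show "\<exists>m' \<alpha> S'. m' \<ge> (1::nat) \<and> (\<forall>n\<in>{1..m'}. \<alpha> n \<in> carrier (Chat U) \<and> S' n \<in> distributions_plus) \<and>
     ?f = (\<Oplus>\<^bsub>Ehat U\<^esub>n\<in>{1..m'}. \<alpha> n \<cdot>\<^bsub>U\<^esub> iota U (S' n)) \<and>
     eclass U (\<lambda>\<phi>. kernel_conv c l d m (span_net k a S \<phi>)) =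
       (\<Oplus>\<^bsub>Ehat U\<^esub>n\<in>{1..m'}. \<alpha> n \<cdot>\<^bsub>U\<^esub> iota U (conv_plus (causal_dist c l d m) (S' n)))"
  proof (intro exI conjI)
    show "1 \<le> k" using data by (simp add: span_data_def)
    show "\<forall>n\<in>{1..k}. cclass U (a n) \<in> carrier (Chat U) \<and> S n \<in> distributions_plus"
      using data by (simp add: span_data_def)
  qed (rule span_sum_eclass[OF data, symmetric] span_conv_sum_eclass[OF data, symmetric], simp)+
  fix h
  assume "\<exists>m' \<alpha> S'. m' \<ge> (1::nat) \<and> (\<forall>n\<in>{1..m'}. \<alpha> n \<in> carrier (Chat U) \<and> S' n \<in> distributions_plus) \<and>
     ?f = (\<Oplus>\<^bsub>Ehat U\<^esub>n\<in>{1..m'}. \<alpha> n \<cdot>\<^bsub>U\<^esub> iota U (S' n)) \<and>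
     h = (\<Oplus>\<^bsub>Ehat U\<^esub>n\<in>{1..m'}. \<alpha> n \<cdot>\<^bsub>U\<^esub> iota U (conv_plus (causal_dist c l d m) (S' n)))"
  then obtain m' \<alpha> S' where h: "m' \<ge> (1::nat)"
    "\<forall>n\<in>{1..m'}. \<alpha> n \<in> carrier (Chat U) \<and> S' n \<in> distributions_plus"
    "?f = (\<Oplus>\<^bsub>Ehat U\<^esub>n\<in>{1..m'}. \<alpha> n \<cdot>\<^bsub>U\<^esub> iota U (S' n))"
    "h = (\<Oplus>\<^bsub>Ehat U\<^esub>n\<in>{1..m'}. \<alpha> n \<cdot>\<^bsub>U\<^esub> iota U (conv_plus (causal_dist c l d m) (S' n)))"
    by blast
  obtain b where b: "span_data m' b S'" "\<And>n. n \<in> {1..m'} \<Longrightarrow> \<alpha> n = cclass U (b n)"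
    using span_data_ex[OF h(1,2)] by blast
  have eq: "?f = eclass U (span_net m' b S')" using h(3) span_sum_eclass[OF b] by simp
  have "h = eclass U (\<lambda>\<phi>. kernel_conv c l d m (span_net m' b S' \<phi>))"
    unfolding h(4) by (rule span_conv_sum_eclass[OF b])
  also have "\<dots> = eclass U (\<lambda>\<phi>. kernel_conv c l d m (span_net k a S \<phi>))"
    by (rule eclass_kernel_conv_cong)
      (simp_all add: eq span_net_controlled span_net_causal data b(1))
  finally show "h = eclass U (\<lambda>\<phi>. kernel_conv c l d m (span_net k a S \<phi>))" .
qed

end

section \<open>Moments of test functions and values at the origin\<close>

lemma integrable_continuous_mult_tf:
  fixes g :: "real \<Rightarrow> complex"
  assumes "continuous_on UNIV g"
  shows "integrable lborel (\<lambda>y. g y * tf \<phi> y)"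
proof -
  have "integrable lborel (\<lambda>y. indicator {- radius \<phi>..radius \<phi>} y *\<^sub>R (g y * tf \<phi> y))"
    by (intro borel_integrable_compact continuous_on_mult continuous_on_subset[OF assms]
        smooth_imp_continuous_on smooth_tf) auto
  moreover have "(\<lambda>y. indicator {- radius \<phi>..radius \<phi>} y *\<^sub>R (g y * tf \<phi> y)) = (\<lambda>y. g y * tf \<phi> y)"
  proof
    fix y show "indicator {- radius \<phi>..radius \<phi>} y *\<^sub>R (g y * tf \<phi> y) = g y * tf \<phi> y"
      using tf_outside_radius[of \<phi> y] by (cases "radius \<phi> < \<bar>y\<bar>") (auto simp: indicator_def abs_le_iff)
  qed
  ultimately show ?thesis by simp
qed

lemma integrable_heaviside_mult:
  fixes f :: "real \<Rightarrow> complex"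
  assumes "integrable lborel f"
  shows "integrable lborel (\<lambda>t. of_real (heaviside t) * f t)"
    "integrable lborel (\<lambda>t. of_real (heaviside (- t)) * f t)"
proof -
  have "integrable lborel (\<lambda>t. indicator {0..} t *\<^sub>R f t)" "integrable lborel (\<lambda>t. indicator {..0} t *\<^sub>R f t)"
    by (rule integrable_mult_indicator[OF _ assms], simp)+
  moreover have "(\<lambda>t. indicator {0..} t *\<^sub>R f t) = (\<lambda>t. of_real (heaviside t) * f t)"
    "(\<lambda>t. indicator {..0} t *\<^sub>R f t) = (\<lambda>t. of_real (heaviside (- t)) * f t)"
    by (auto simp: fun_eq_iff heaviside_def indicator_def)
  ultimately show "integrable lborel (\<lambda>t. of_real (heaviside t) * f t)"
    "integrable lborel (\<lambda>t. of_real (heaviside (- t)) * f t)" by simp_all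
qed

lemma integral_mult_tf_bound:
  fixes g :: "real \<Rightarrow> complex"
  assumes int: "integrable lborel (\<lambda>y. g y * tf \<phi> y)"
    and bound: "\<And>y. \<bar>y\<bar> \<le> radius \<phi> \<Longrightarrow> cmod (g y) \<le> B"
  shows "cmod (LINT y|lborel. g y * tf \<phi> y) \<le> B * (LINT y|lborel. cmod (tf \<phi> y))"
proof -
  have i: "integrable lborel (\<lambda>y. cmod (tf \<phi> y))"
    using integrable_continuous_mult_tf[of "\<lambda>_. 1" \<phi>] by (intro integrable_norm) simp
  have "cmod (LINT y|lborel. g y * tf \<phi> y) \<le> (LINT y|lborel. B * cmod (tf \<phi> y))"
  proof (rule Bochner_Integration.integral_norm_bound_integral)
    show "cmod (g y * tf \<phi> y) \<le> B * cmod (tf \<phi> y)" for y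
      using bound[of y] tf_outside_radius[of \<phi> y]
      by (cases "radius \<phi> < \<bar>y\<bar>") (auto simp: norm_mult intro!: mult_right_mono)
  qed (use i int in auto)
  then show ?thesis by simp
qed

text \<open>Reflection exchanges the two half lines; they overlap only in the null set \<open>{0}\<close>.\<close>

lemma half_line_integral_even:
  fixes g :: "real \<Rightarrow> complex"
  assumes int: "integrable lborel g" and even: "\<And>t. g (- t) = g t"
  shows "(LINT t|lborel. of_real (heaviside t) * g t) = (LINT t|lborel. g t) / 2"
proof -
  have "(LINT t|lborel. of_real (heaviside t) * g t) =
      (LINT t|lborel. of_real (heaviside (- t)) * g t)"
    using lborel_integral_real_affine[of "- 1" "\<lambda>t. of_real (heaviside t) * g t" 0] by (simp add: even)
  moreover have "(LINT t|lborel. of_real (heaviside t) * g t) + (LINT t|lborel. of_real (heaviside (- t)) * g t)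
      = (LINT t|lborel. of_real (heaviside t) * g t + of_real (heaviside (- t)) * g t)"
    by (rule Bochner_Integration.integral_add[symmetric]) (rule integrable_heaviside_mult[OF int])+
  moreover have "\<dots> = (LINT t|lborel. g t)"
  proof (rule integral_cong_AE)
    show "AE t in lborel. of_real (heaviside t) * g t + of_real (heaviside (- t)) * g t = g t"
      using AE_lborel_singleton[of 0] by eventually_elim (auto simp: heaviside_def)
  qed (use integrable_heaviside_mult[OF int] int in \<open>auto intro!: borel_measurable_integrable\<close>)
  ultimately show ?thesis by (simp add: mult_2_right[symmetric])
qed

definition exp_moment :: "complex \<Rightarrow> test_fun \<Rightarrow> complex" where
  "exp_moment l \<phi> = (LINT y|lborel. exp (l * of_real y) * tf \<phi> y)"

text \<open>The exponential is replaced by its Taylor polynomial of degree \<open>n\<close>. The error is of order \<open>n + 1\<close>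
  in the radius.\<close>

lemma exp_moment_bound:
  assumes phi: "\<phi> \<in> directing_set n" and n: "1 \<le> n"
  shows "cmod (exp_moment l \<phi> - 1) \<le> 2 * exp (cmod l) * cmod l ^ Suc n * radius \<phi> ^ Suc n"
proof -
  have r: "radius \<phi> \<le> 1" and int: "(LINT x|lborel. tf \<phi> x) = 1"
    and mom: "\<And>j. j \<in> {1..n} \<Longrightarrow> (LINT x|lborel. complex_of_real (x ^ j) * tf \<phi> x) = 0"
    and L1: "(LINT x|lborel. cmod (tf \<phi> x)) \<le> 1 + 1 / n"
    using phi n by (auto simp: directing_set_def field_simps order_trans[of _ "1 / real n" 1])
  define T where "T y = (\<Sum>j\<le>n. (l * of_real y) ^ j / fact j)" for y
  have iT: "integrable lborel (\<lambda>y. T y * tf \<phi> y)"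
    unfolding T_def by (intro integrable_continuous_mult_tf continuous_intros) auto
  have ie: "integrable lborel (\<lambda>y. exp (l * of_real y) * tf \<phi> y)"
    by (intro integrable_continuous_mult_tf continuous_intros)
  have ij: "integrable lborel (\<lambda>y. complex_of_real (y ^ j) * tf \<phi> y)" for j
    by (intro integrable_continuous_mult_tf continuous_intros)
  \<comment> \<open>only the constant term of the Taylor polynomial survives the vanishing moments\<close>
  have "(LINT y|lborel. T y * tf \<phi> y) =
      (LINT y|lborel. (\<Sum>j\<le>n. l ^ j / fact j * (complex_of_real (y ^ j) * tf \<phi> y)))"
    unfolding T_def by (simp add: sum_distrib_right power_mult_distrib mult.assoc)
  also have "\<dots> = (\<Sum>j\<le>n. l ^ j / fact j * (LINT y|lborel. complex_of_real (y ^ j) * tf \<phi> y))"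
    by (subst Bochner_Integration.integral_sum) (use ij in auto)
  also have "\<dots> = (\<Sum>j\<in>{0}. l ^ j / fact j * (LINT y|lborel. complex_of_real (y ^ j) * tf \<phi> y))"
    by (rule sum.mono_neutral_right) (use mom in auto)
  finally have T: "(LINT y|lborel. T y * tf \<phi> y) = 1" using int by simp
  have eq: "exp_moment l \<phi> - 1 = (LINT y|lborel. (exp (l * of_real y) - T y) * tf \<phi> y)"
    unfolding exp_moment_def T[symmetric] using ie iT by (simp add: left_diff_distrib)
  have "cmod (exp_moment l \<phi> - 1) \<le> exp (cmod l) * (cmod l * radius \<phi>) ^ Suc n * (LINT x|lborel. cmod (tf \<phi> x))"
    unfolding eq
  proof (rule integral_mult_tf_bound)
    show "integrable lborel (\<lambda>y. (exp (l * of_real y) - T y) * tf \<phi> y)"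
      using ie iT by (simp add: left_diff_distrib)
    fix y assume y: "\<bar>y\<bar> \<le> radius \<phi>"
    have le: "cmod (l * of_real y) \<le> cmod l * radius \<phi>" unfolding norm_mult norm_of_real
      using y by (intro mult_left_mono) auto
    have le1: "cmod (l * of_real y) \<le> cmod l"
      using le mult_left_mono[OF r, of "cmod l"] by simp
    have "cmod (exp (l * of_real y) - T y) \<le> exp (cmod (l * of_real y)) * (cmod (l * of_real y) ^ Suc n) / fact n"
      unfolding T_def by (rule Taylor_exp_field)
    also have "\<dots> \<le> exp (cmod (l * of_real y)) * (cmod (l * of_real y) ^ Suc n) / 1"
      by (intro divide_left_mono) (auto simp: fact_ge_1)
    also have "\<dots> \<le> exp (cmod l) * (cmod l * radius \<phi>) ^ Suc n"
      using le le1 by (simp del: power_Suc) (intro mult_mono power_mono, auto)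
    finally show "cmod (exp (l * of_real y) - T y) \<le> exp (cmod l) * (cmod l * radius \<phi>) ^ Suc n" .
  qed
  also have "\<dots> \<le> exp (cmod l) * (cmod l * radius \<phi>) ^ Suc n * 2"
  proof (rule mult_left_mono)
    have "1 / real n \<le> 1" using n by simp
    then show "(LINT x|lborel. cmod (tf \<phi> x)) \<le> 2" using L1 by linarith
  qed (auto intro!: mult_nonneg_nonneg zero_le_power)
  finally show ?thesis by (simp only: power_mult_distrib mult_ac)
qed

text \<open>Exponentials are eigenfunctions of convolution operators.\<close>

lemma conv_test_exp:
  "(LINT y|lborel. exp (l * of_real y) * tf \<phi> (x - y)) = exp (l * of_real x) * exp_moment (- l) \<phi>"
proof -
  have "(LINT y|lborel. exp (l * of_real y) * tf \<phi> (x - y)) =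
      (LINT y|lborel. exp (l * of_real (x + - 1 * y)) * tf \<phi> (x - (x + - 1 * y)))"
    using lborel_integral_real_affine[of "- 1" "\<lambda>y. exp (l * of_real y) * tf \<phi> (x - y)" x] by simp
  also have "\<dots> = (LINT y|lborel. exp (l * of_real x) * (exp (- l * of_real y) * tf \<phi> y))"
  proof (rule Bochner_Integration.integral_cong)
    fix y
    have "exp (l * of_real (x + - 1 * y)) = exp (l * of_real x) * exp (- l * of_real y)"
      unfolding exp_add[symmetric] by (simp add: right_diff_distrib)
    then show "exp (l * of_real (x + - 1 * y)) * tf \<phi> (x - (x + - 1 * y)) =
        exp (l * of_real x) * (exp (- l * of_real y) * tf \<phi> y)" by simp
  qed simp
  finally show ?thesis by (simp add: exp_moment_def)
qed

lemma smooth_exp_kernel: "smooth (exp_kernel c l d m)"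
  unfolding exp_kernel_def[abs_def] by (intro smooth_lincomb smooth_exp)

lemma exp_kernel_has_vector_derivative:
  "(exp_kernel c l d m has_vector_derivative exp_kernel (c * l) l (d * m) m x) (at x)"
  unfolding exp_kernel_def[abs_def]
  by (rule derivative_eq_intros exp_has_vector_derivative refl)+ simp

lemma continuous_exp_kernel: "continuous_on S (exp_kernel c l d m)"
  by (intro smooth_imp_continuous_on smooth_exp_kernel)

lemma conv_test_exp_kernel:
  "conv_test (dist_of (exp_kernel c l d m)) \<phi> x =
    c * exp_moment (- l) \<phi> * exp (l * of_real x) + d * exp_moment (- m) \<phi> * exp (m * of_real x)"
proof -
  have i: "integrable lborel (\<lambda>y. exp (l * of_real y) * tf (test_reflect x \<phi>) y)" for l
    by (intro integrable_continuous_mult_tf continuous_intros)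
  have "conv_test (dist_of (exp_kernel c l d m)) \<phi> x =
      (LINT y|lborel. c * (exp (l * of_real y) * tf (test_reflect x \<phi>) y) +
        d * (exp (m * of_real y) * tf (test_reflect x \<phi>) y))"
    by (simp add: conv_test_def dist_of_def exp_kernel_def algebra_simps)
  also have "\<dots> = c * (LINT y|lborel. exp (l * of_real y) * tf \<phi> (x - y))
      + d * (LINT y|lborel. exp (m * of_real y) * tf \<phi> (x - y))"
    using i by (simp add: tf_test_reflect)
  finally show ?thesis unfolding conv_test_exp by (simp only: mult_ac)
qed

text \<open>Integration by parts on the half line; the boundary term is the jump of the kernel at the origin.\<close>

lemma dist_deriv_causal_dist:
  "dist_deriv (causal_dist c l d m) \<phi> = (c + d) * dirac \<phi> + causal_dist (c * l) l (d * m) m \<phi>"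
proof -
  let ?k = "exp_kernel c l d m" and ?k' = "exp_kernel (c * l) l (d * m) m"
  let ?r = "radius \<phi> + 1"
  have "has_bochner_integral lborel
      (\<lambda>t. of_real (heaviside t) * (?k t * nderiv 1 (tf \<phi>) t + ?k' t * tf \<phi> t))
      (?k ?r * tf \<phi> ?r - ?k 0 * tf \<phi> 0)"
  proof (rule has_integral_heaviside)
    show "((\<lambda>t. ?k t * tf \<phi> t) has_vector_derivative ?k t * nderiv 1 (tf \<phi>) t + ?k' t * tf \<phi> t) (at t)" for t
      by (rule has_vector_derivative_mult exp_kernel_has_vector_derivative
          smooth_has_vector_derivative smooth_tf)+
    show "continuous_on UNIV (\<lambda>t. ?k t * nderiv 1 (tf \<phi>) t + ?k' t * tf \<phi> t)"
      by (intro continuous_intros continuous_exp_kernel smooth_imp_continuous_on smooth_nderiv smooth_tf)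
    show "?k t * nderiv 1 (tf \<phi>) t + ?k' t * tf \<phi> t = 0" if "?r < t" for t
      using that nderiv_tf_outside[of \<phi> t 1] tf_outside_radius[of \<phi> t] by simp
  qed simp
  then have *: "(LINT t|lborel. of_real (heaviside t) * (?k t * nderiv 1 (tf \<phi>) t + ?k' t * tf \<phi> t)) = - (c + d) * tf \<phi> 0"
    by (simp add: has_bochner_integral_integral_eq tf_outside_radius exp_kernel_def algebra_simps)
  have i: "integrable lborel (\<lambda>t. of_real (heaviside t) * (?k t * tf (test_deriv \<phi>) t))"
    "integrable lborel (\<lambda>t. of_real (heaviside t) * (?k' t * tf \<phi> t))"
    by (intro integrable_heaviside_mult integrable_continuous_mult_tf continuous_exp_kernel)+
  have "causal_dist c l d m (test_deriv \<phi>) + causal_dist (c * l) l (d * m) m \<phi> = - (c + d) * tf \<phi> 0"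
    unfolding *[symmetric] causal_dist_def dist_of_def
    using i by (simp add: tf_test_deriv distrib_left mult.assoc)
  then have "causal_dist c l d m (test_deriv \<phi>) = - (c + d) * tf \<phi> 0 - causal_dist (c * l) l (d * m) m \<phi>"
    by (simp only: eq_diff_eq)
  then show ?thesis unfolding dist_deriv_def dirac_def by (simp only:) (simp add: algebra_simps)
qed

lemma even_tf: "\<phi> \<in> directing_set n \<Longrightarrow> 1 \<le> n \<Longrightarrow> tf \<phi> (- x) = tf \<phi> x"
  by (auto simp: directing_set_def)

lemma conv_test_causal_dist_0:
  assumes "\<phi> \<in> directing_set n" "1 \<le> n"
  shows "conv_test (causal_dist c l d m) \<phi> 0 =
    (LINT t|lborel. of_real (heaviside t) * (exp_kernel c l d m t * tf \<phi> t))"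
  unfolding conv_test_def causal_dist_def dist_of_def
  by (simp add: tf_test_reflect even_tf[OF assms] mult.assoc)

context admissible
begin

text \<open>The order \<open>n\<close> of the vanishing moments is arbitrary, hence the error is below every power of the
  radius.\<close>

lemma neg_net_exp_moment: "neg_net (\<lambda>\<phi>. exp_moment l \<phi> - 1)"
  unfolding negligible_net_def
proof
  fix p
  define n :: nat where "n = max p 1"
  define C where "C = 2 * exp (cmod l) * cmod l ^ Suc n + 1"
  have C: "0 < C" by (simp add: C_def add_nonneg_pos)
  have small: "\<forall>\<^sub>F \<phi> in U. radius \<phi> \<le> 1 / C" by (rule eventually_radius_le) (use C in simp)
  show "\<forall>\<^sub>F \<phi> in U. cmod (exp_moment l \<phi> - 1) \<le> radius \<phi> ^ p"
    using eventually_directing_set[of n] eventually_radius_le[of 1, simplified] small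
  proof eventually_elim
    case (elim \<phi>)
    have "cmod (exp_moment l \<phi> - 1) \<le> (2 * exp (cmod l) * cmod l ^ Suc n) * radius \<phi> ^ Suc n"
      by (rule exp_moment_bound[OF elim(1)]) (simp add: n_def)
    also have "\<dots> \<le> C * radius \<phi> ^ Suc n"
      by (intro mult_right_mono) (auto simp: C_def)
    also have "\<dots> = (C * radius \<phi>) * radius \<phi> ^ n" by simp
    also have "\<dots> \<le> 1 * radius \<phi> ^ n"
      using elim(3) C by (intro mult_right_mono) (auto simp: field_simps)
    also have "\<dots> \<le> radius \<phi> ^ p"
      using elim(2) by (simp add: n_def power_decreasing)
    finally show ?case .
  qed
qed

lemma controlled_exp_kernel_coeffs:
  assumes "size_class P" "P (\<lambda>\<phi>. cmod (a \<phi>))" "P (\<lambda>\<phi>. cmod (b \<phi>))"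
  shows "controlled P (\<lambda>\<phi>. exp_kernel (a \<phi>) l (b \<phi>) m)"
proof -
  have "controlled P (\<lambda>\<phi> x. exp (l * of_real x) * a \<phi>)" if "P (\<lambda>\<phi>. cmod (a \<phi>))" for l a
    by (intro controlled_mult controlled_smooth_fun smooth_exp controlled_const assms(1) that)
  then show ?thesis
    unfolding exp_kernel_def[abs_def] using assms by (intro controlled_add) (simp_all add: mult.commute)
qed

text \<open>The embedding multiplies each exponential by its moment, which is 1 up to a negligible net.\<close>

lemma iota_exp_kernel: "iota U (dist_of (exp_kernel c l d m)) = eclass U (\<lambda>\<phi>. exp_kernel c l d m)"
proof -
  have eq: "conv_test (dist_of (exp_kernel c l d m)) =
      (\<lambda>\<phi>. exp_kernel (c * exp_moment (- l) \<phi>) l (d * exp_moment (- m) \<phi>) m)"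
    by (simp add: fun_eq_iff conv_test_exp_kernel exp_kernel_def)
  have n: "neg_net (\<lambda>\<phi>. c * (exp_moment l \<phi> - 1))" for c l
    by (rule size_class_norm_mult) (simp_all add: moderate_const neg_net_exp_moment)
  have diff: "controlled negligible_net (\<lambda>\<phi> x. conv_test (dist_of (exp_kernel c l d m)) \<phi> x - exp_kernel c l d m x)"
    using controlled_exp_kernel_coeffs[OF size_class_negligible n[of c "- l"] n[of d "- m"], of l m]
    unfolding eq by (simp add: exp_kernel_def[abs_def] algebra_simps)
  have k: "controlled moderate (\<lambda>\<phi>. exp_kernel c l d m)"
    by (intro controlled_smooth_fun smooth_exp_kernel)
  have "controlled moderate (conv_test (dist_of (exp_kernel c l d m)))"
    using controlled_add[OF size_class_moderate controlled_imp_moderate[OF diff] k] by simp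
  then show ?thesis unfolding iota_def using diff k by (simp add: eclass_eq_iff)
qed

lemma controlled_tf: "controlled moderate tf"
  unfolding controlled_def
proof (intro conjI allI)
  fix j and M :: nat
  obtain m where m: "\<forall>\<^sub>F \<phi> in U. \<forall>i\<le>j. \<forall>x. cmod (nderiv i (tf \<phi>) x) \<le> 1 / radius \<phi> ^ m"
    using nderiv_tf_moderate by blast
  then have "\<forall>\<^sub>F \<phi> in U. \<forall>x\<in>{- real M..real M}. cmod (nderiv j (tf \<phi>) x) \<le> 1 / radius \<phi> ^ m"
    by eventually_elim simp
  then show "\<exists>B. moderate B \<and> (\<forall>\<^sub>F \<phi> in U. \<forall>x\<in>{- real M..real M}. cmod (nderiv j (tf \<phi>) x) \<le> B \<phi>)"
    using moderate_radius_power by blast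
qed (rule smooth_tf)

text \<open>Regularising the causal kernel is the same as convolving the test functions with it, and the test
  functions themselves form a moderate causal net.\<close>

lemma controlled_conv_test_causal_dist: "controlled moderate (conv_test (causal_dist c l d m))"
proof -
  have i: "integrable lborel (\<lambda>t. of_real (heaviside t) * (exp (l * of_real t) * tf \<phi> (x - t)))" for l \<phi> x
    by (rule integrable_exp_conv[of _ "- radius \<phi>"])
      (auto intro: smooth_imp_continuous_on smooth_tf simp: tf_outside_radius)
  have "conv_test (causal_dist c l d m) \<phi> x = kernel_conv c l d m (tf \<phi>) x" for \<phi> x
  proof -
    have "conv_test (causal_dist c l d m) \<phi> x =
      (LINT t|lborel. c * (of_real (heaviside t) * (exp (l * of_real t) * tf \<phi> (x - t)))
        + d * (of_real (heaviside t) * (exp (m * of_real t) * tf \<phi> (x - t))))"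
      by (simp add: conv_test_def causal_dist_def dist_of_def tf_test_reflect exp_kernel_def algebra_simps)
    then show ?thesis by (simp add: kernel_conv_def exp_conv_def i)
  qed
  then have "conv_test (causal_dist c l d m) = (\<lambda>\<phi>. kernel_conv c l d m (tf \<phi>))"
    by (simp add: fun_eq_iff)
  then show ?thesis
    using controlled_kernel_conv[OF size_class_moderate controlled_tf]
    by (simp add: causal_net_def tf_outside_radius)
qed

text \<open>An even \<open>\<phi>\<close> has half of its mass on the half line, so regularisation takes the mean of the one-sided
  limits \<open>0\<close> and \<open>c + d\<close> of the kernel at the origin, up to the oscillation of the kernel over the
  support of \<open>\<phi>\<close>.\<close>

lemma causal_dist_value_0_approx:
  assumes "0 < e"
  shows "\<forall>\<^sub>F \<phi> in U. cmod (conv_test (causal_dist c l d m) \<phi> 0 - (c + d) / 2) \<le> e"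
proof -
  let ?k = "exp_kernel c l d m"
  have k0: "?k 0 = c + d" by (simp add: exp_kernel_def)
  have "isCont ?k 0" using continuous_exp_kernel[of UNIV] by (simp add: continuous_on_eq_continuous_at)
  then obtain \<delta> where delta: "\<delta> > 0" "\<And>t. dist t 0 < \<delta> \<Longrightarrow> dist (?k t) (?k 0) < e / 2"
    using assms unfolding continuous_at_eps_delta by (metis half_gt_zero)
  have small: "\<forall>\<^sub>F \<phi> in U. radius \<phi> \<le> \<delta> / 2" by (rule eventually_radius_le) (use delta in simp)
  show ?thesis
    using eventually_directing_set[of 1] small
  proof eventually_elim
    case (elim \<phi>)
    have int: "(LINT x|lborel. tf \<phi> x) = 1" and L1: "(LINT x|lborel. cmod (tf \<phi> x)) \<le> 2"
      using elim(1) by (auto simp: directing_set_def)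
    have i1: "integrable lborel (\<lambda>t. of_real (heaviside t) * (?k t * tf \<phi> t))"
      by (intro integrable_heaviside_mult integrable_continuous_mult_tf continuous_exp_kernel)
    have itf: "integrable lborel (tf \<phi>)" using integrable_continuous_mult_tf[of "\<lambda>_. 1" \<phi>] by simp
    have "(LINT t|lborel. of_real (heaviside t) * tf \<phi> t) = 1 / 2"
      using half_line_integral_even[OF itf] even_tf[OF elim(1)] int by simp
    then have "(c + d) / 2 = (LINT t|lborel. (c + d) * (of_real (heaviside t) * tf \<phi> t))" by simp
    then have eq: "conv_test (causal_dist c l d m) \<phi> 0 - (c + d) / 2 =
        (LINT t|lborel. of_real (heaviside t) * (?k t * tf \<phi> t) - (c + d) * (of_real (heaviside t) * tf \<phi> t))"
      unfolding conv_test_causal_dist_0[OF elim(1) order_refl]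
      using i1 integrable_heaviside_mult(1)[OF itf] by simp
    also have "\<dots> = (LINT t|lborel. (of_real (heaviside t) * (?k t - ?k 0)) * tf \<phi> t)"
      by (simp add: k0 algebra_simps)
    also have "cmod \<dots> \<le> e / 2 * (LINT x|lborel. cmod (tf \<phi> x))"
    proof (rule integral_mult_tf_bound)
      have "integrable lborel (\<lambda>t. of_real (heaviside t) * ((?k t - ?k 0) * tf \<phi> t))"
        by (intro integrable_heaviside_mult integrable_continuous_mult_tf continuous_intros continuous_exp_kernel)
      then show "integrable lborel (\<lambda>t. (of_real (heaviside t) * (?k t - ?k 0)) * tf \<phi> t)"
        by (simp add: mult.assoc)
      fix t assume "\<bar>t\<bar> \<le> radius \<phi>"
      then have "cmod (?k t - ?k 0) \<le> e / 2"
        using delta(2)[of t] elim(2) delta(1) by (simp add: dist_norm)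
      then show "cmod (of_real (heaviside t) * (?k t - ?k 0)) \<le> e / 2"
        using assms by (simp add: heaviside_def norm_mult)
    qed
    also have "\<dots> \<le> e / 2 * 2" using L1 assms by (intro mult_left_mono) auto
    finally show ?case by simp
  qed
qed

lemma gapprox_causal_dist:
  "gapprox U (gval U (iota U (causal_dist c l d m)) 0) (num U ((c + d) / 2))"
  unfolding iota_def gval_eclass[OF controlled_conv_test_causal_dist]
  by (rule infinitesimal_gapprox[OF mod_net_value[OF controlled_conv_test_causal_dist] causal_dist_value_0_approx])

text \<open>For an even kernel the half line integral is exactly half of the full one, and the full one is known
  up to a negligible error from the exponential moments.\<close>

lemma gval_even_causal_dist:
  assumes "c = d" "m = - l"
  shows "gval U (iota U (causal_dist c l d m)) 0 = num U c"
proof -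
  have n: "neg_net (\<lambda>\<phi>. c / 2 * (exp_moment l \<phi> - 1))" for l
    by (rule size_class_norm_mult) (simp_all add: moderate_const neg_net_exp_moment)
  have "neg_net (\<lambda>\<phi>. conv_test (causal_dist c l d m) \<phi> 0 - c)"
  proof (rule size_class_mono[OF size_class_negligible
        size_class_norm_add[OF size_class_negligible n[of l] n[of "- l"]]])
    show "\<forall>\<^sub>F \<phi> in U. cmod (conv_test (causal_dist c l d m) \<phi> 0 - c) \<le>
        cmod (c / 2 * (exp_moment l \<phi> - 1) + c / 2 * (exp_moment (- l) \<phi> - 1))"
      using eventually_directing_set[of 1]
    proof eventually_elim
      case (elim \<phi>)
      have i: "integrable lborel (\<lambda>y. exp (l * of_real y) * tf \<phi> y)" for l
        by (intro integrable_continuous_mult_tf continuous_intros)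
      have "conv_test (causal_dist c l d m) \<phi> 0 = (LINT t|lborel. exp_kernel c l d m t * tf \<phi> t) / 2"
        unfolding conv_test_causal_dist_0[OF elim order_refl]
      proof (rule half_line_integral_even)
        show "integrable lborel (\<lambda>t. exp_kernel c l d m t * tf \<phi> t)"
          by (intro integrable_continuous_mult_tf continuous_exp_kernel)
      qed (simp add: even_tf[OF elim] exp_kernel_def assms add.commute)
      also have "(LINT t|lborel. exp_kernel c l d m t * tf \<phi> t) =
          (LINT t|lborel. c * (exp (l * of_real t) * tf \<phi> t) + c * (exp (- l * of_real t) * tf \<phi> t))"
        by (simp add: exp_kernel_def assms algebra_simps)
      also have "\<dots> = c * exp_moment l \<phi> + c * exp_moment (- l) \<phi>"
        unfolding exp_moment_def using i[of l] i[of "- l"] by simp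
      finally have half: "conv_test (causal_dist c l d m) \<phi> 0 = (c * exp_moment l \<phi> + c * exp_moment (- l) \<phi>) / 2" .
      have "conv_test (causal_dist c l d m) \<phi> 0 - c =
          c / 2 * (exp_moment l \<phi> - 1) + c / 2 * (exp_moment (- l) \<phi> - 1)"
        unfolding half by (simp add: field_simps)
      then show ?case by simp
    qed
  qed
  then show ?thesis
    unfolding iota_def gval_eclass[OF controlled_conv_test_causal_dist] num_def
    by (simp add: cclass_eq_iff mod_net_value[OF controlled_conv_test_causal_dist] moderate_const)
qed

section \<open>Linear initial value problems\<close>

abbreviation first_order_ivp :: "complex \<Rightarrow> complex \<Rightarrow> gen_fun \<Rightarrow> gen_fun \<Rightarrow> bool" where
  "first_order_ivp R K F I \<equiv> I \<in> carrier (Ehat U) \<and>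
     num U R \<cdot>\<^bsub>U\<^esub> gfun_deriv U I \<oplus>\<^bsub>Ehat U\<^esub> num U K \<cdot>\<^bsub>U\<^esub> I = F \<and>
     gval U I 0 = \<zero>\<^bsub>Chat U\<^esub>"

abbreviation second_order_ivp ::
    "complex \<Rightarrow> complex \<Rightarrow> complex \<Rightarrow> gen_fun \<Rightarrow> gen_fun \<Rightarrow> bool" where
  "second_order_ivp L R K F I \<equiv> I \<in> carrier (Ehat U) \<and>
     num U L \<cdot>\<^bsub>U\<^esub> gfun_deriv U (gfun_deriv U I) \<oplus>\<^bsub>Ehat U\<^esub> num U R \<cdot>\<^bsub>U\<^esub> gfun_deriv U I
       \<oplus>\<^bsub>Ehat U\<^esub> num U K \<cdot>\<^bsub>U\<^esub> I = F \<and>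
     gval U I 0 = \<zero>\<^bsub>Chat U\<^esub> \<and> gval U (gfun_deriv U I) 0 = \<zero>\<^bsub>Chat U\<^esub>"

lemma homogeneous_first_order_negligible:
  fixes R K :: complex
  assumes R: "R \<noteq> 0" and K: "K = - R * l" and z: "controlled moderate z"
    and eq: "controlled negligible_net (\<lambda>\<phi> x. R * nderiv 1 (z \<phi>) x + K * z \<phi> x)"
    and z0: "neg_net (\<lambda>\<phi>. z \<phi> 0)"
  shows "controlled negligible_net z"
proof (rule controlled_linear_ode[where s = 0 and P = negligible_net])
  show "controlled negligible_net (\<lambda>\<phi> x. 1 / R * (R * nderiv 1 (z \<phi>) x + K * z \<phi> x))"
    by (rule controlled_cmult[OF size_class_negligible eq])
  show "(z \<phi> has_vector_derivative l * z \<phi> x + 1 / R * (R * nderiv 1 (z \<phi>) x + K * z \<phi> x)) (at x)" for \<phi> x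
    using smooth_has_vector_derivative[OF controlled_smooth[OF z], of \<phi> x] R
    by (simp add: K field_simps)
qed (use z0 in simp_all)

text \<open>The characteristic polynomial factors, so \<open>w = z' - m z\<close> satisfies \<open>w' = l w\<close> and \<open>z' = m z + w\<close>, up
  to negligible nets. The first order estimate applies to \<open>w\<close> and then to \<open>z\<close>.\<close>

lemma homogeneous_second_order_negligible:
  fixes L R K :: complex
  assumes L: "L \<noteq> 0" and R: "R = - L * (l + m)" and K: "K = L * l * m"
    and z: "controlled moderate z"
    and eq: "controlled negligible_net
      (\<lambda>\<phi> x. L * nderiv 2 (z \<phi>) x + R * nderiv 1 (z \<phi>) x + K * z \<phi> x)"
    and z0: "neg_net (\<lambda>\<phi>. z \<phi> 0)" and z1: "neg_net (\<lambda>\<phi>. nderiv 1 (z \<phi>) 0)"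
  shows "controlled negligible_net z"
proof -
  define w where "w = (\<lambda>\<phi> x. nderiv 1 (z \<phi>) x - m * z \<phi> x)"
  have d1: "(z \<phi> has_vector_derivative nderiv 1 (z \<phi>) x) (at x)" for \<phi> x
    by (rule smooth_has_vector_derivative[OF controlled_smooth[OF z]])
  have d2: "(nderiv 1 (z \<phi>) has_vector_derivative nderiv 2 (z \<phi>) x) (at x)" for \<phi> x
    using smooth_has_nderiv[OF controlled_smooth[OF z], of 1 \<phi> x] by (simp add: numeral_2_eq_2)
  have "controlled negligible_net w"
  proof (rule controlled_linear_ode)
    show "controlled negligible_net
        (\<lambda>\<phi> x. 1 / L * (L * nderiv 2 (z \<phi>) x + R * nderiv 1 (z \<phi>) x + K * z \<phi> x))"
      by (rule controlled_cmult[OF size_class_negligible eq])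
    fix \<phi> x
    have "(w \<phi> has_vector_derivative nderiv 2 (z \<phi>) x - m * nderiv 1 (z \<phi>) x) (at x)"
      unfolding w_def by (intro has_vector_derivative_diff has_vector_derivative_mult_right d1 d2)
    also have "nderiv 2 (z \<phi>) x - m * nderiv 1 (z \<phi>) x =
        l * w \<phi> x + 1 / L * (L * nderiv 2 (z \<phi>) x + R * nderiv 1 (z \<phi>) x + K * z \<phi> x)"
      using L by (simp add: w_def R K field_simps)
    finally show "(w \<phi> has_vector_derivative
        l * w \<phi> x + 1 / L * (L * nderiv 2 (z \<phi>) x + R * nderiv 1 (z \<phi>) x + K * z \<phi> x)) (at x)" .
    have "neg_net (\<lambda>\<phi>. - m * z \<phi> 0)"
      by (rule size_class_norm_mult[OF size_class_negligible moderate_const z0])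
    from size_class_norm_add[OF size_class_negligible z1 this]
    show "neg_net (\<lambda>\<phi>. w \<phi> 0)" by (simp add: w_def)
  qed simp
  then show ?thesis
  proof (rule controlled_linear_ode[rotated 2, where s = 0 and P = negligible_net])
    show "(z \<phi> has_vector_derivative m * z \<phi> x + w \<phi> x) (at x)" for \<phi> x
      using d1 by (simp add: w_def)
  qed (use z0 in simp_all)
qed

lemma gval_eq_zero_iff:
  "controlled moderate f \<Longrightarrow> gval U (eclass U f) x = \<zero>\<^bsub>Chat U\<^esub> \<longleftrightarrow> neg_net (\<lambda>\<phi>. f \<phi> x)"
  by (simp add: gval_eclass cclass_zero cclass_eq_iff mod_net_value moderate_const)

lemma deriv2_eclass:
  "controlled moderate f \<Longrightarrow> gfun_deriv U (gfun_deriv U (eclass U f)) = eclass U (\<lambda>\<phi>. nderiv 2 (f \<phi>))"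
  by (simp add: gfun_deriv_eclass controlled_nderiv nderiv_nderiv numeral_2_eq_2)

lemma first_order_eclass:
  assumes f: "controlled moderate f"
  shows "num U R \<cdot>\<^bsub>U\<^esub> gfun_deriv U (eclass U f) \<oplus>\<^bsub>Ehat U\<^esub> num U K \<cdot>\<^bsub>U\<^esub> eclass U f
    = eclass U (\<lambda>\<phi> x. R * nderiv 1 (f \<phi>) x + K * f \<phi> x)"
  using f controlled_nderiv[OF f, of 1]
  by (simp add: gfun_deriv_eclass num_gscale_eclass eclass_add controlled_cmult)

lemma second_order_eclass:
  assumes f: "controlled moderate f"
  shows "num U L \<cdot>\<^bsub>U\<^esub> gfun_deriv U (gfun_deriv U (eclass U f)) \<oplus>\<^bsub>Ehat U\<^esub>
      num U R \<cdot>\<^bsub>U\<^esub> gfun_deriv U (eclass U f) \<oplus>\<^bsub>Ehat U\<^esub> num U K \<cdot>\<^bsub>U\<^esub> eclass U f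
    = eclass U (\<lambda>\<phi> x. L * nderiv 2 (f \<phi>) x + R * nderiv 1 (f \<phi>) x + K * f \<phi> x)"
  unfolding deriv2_eclass[OF f] unfolding gfun_deriv_eclass[OF f]
  using f controlled_nderiv[OF f, of 1] controlled_nderiv[OF f, of 2]
  by (simp add: num_gscale_eclass eclass_add controlled_cmult controlled_add)

lemma nderiv_diff_net:
  assumes "controlled P f" "controlled Q g"
  shows "nderiv j (\<lambda>x. f \<phi> x - g \<phi> x) = (\<lambda>x. nderiv j (f \<phi>) x - nderiv j (g \<phi>) x)"
  using nderiv_lincomb[OF controlled_smooth[OF assms(1)] controlled_smooth[OF assms(2)],
      where a = 1 and b = "- 1"] by simp

text \<open>A net \<open>y\<close> that solves the problem exactly for every \<open>\<phi>\<close> represents a solution, and any other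
  solution differs from it by a net to which the homogeneous estimate applies.\<close>

lemma first_order_ivp_iff:
  fixes R K :: complex
  assumes R: "R \<noteq> 0" and K: "K = - R * l" and h: "controlled moderate h" and y: "controlled moderate y"
    and eqy: "\<And>\<phi> x. R * nderiv 1 (y \<phi>) x + K * y \<phi> x = h \<phi> x"
    and y0: "\<And>\<phi>. y \<phi> 0 = 0"
  shows "first_order_ivp R K (eclass U h) I \<longleftrightarrow> I = eclass U y" (is "?ivp \<longleftrightarrow> _")
proof
  assume ivp: ?ivp
  from conjunct1[OF ivp] obtain f where f: "controlled moderate f" and I: "I = eclass U f"
    unfolding carrier_Ehat by auto
  let ?z = "\<lambda>\<phi> x. f \<phi> x - y \<phi> x"
  have "controlled negligible_net ?z"
  proof (rule homogeneous_first_order_negligible[OF R K])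
    show "controlled moderate ?z" by (intro controlled_diff f y) simp
    have "controlled negligible_net (\<lambda>\<phi> x. (R * nderiv 1 (f \<phi>) x + K * f \<phi> x) - h \<phi> x)"
      using ivp f h controlled_nderiv[OF f, of 1]
      by (simp add: I first_order_eclass eclass_eq_iff controlled_add controlled_cmult)
    then show "controlled negligible_net (\<lambda>\<phi> x. R * nderiv 1 (?z \<phi>) x + K * ?z \<phi> x)"
      unfolding nderiv_diff_net[OF f y] eqy[symmetric] by (simp add: algebra_simps)
    show "neg_net (\<lambda>\<phi>. ?z \<phi> 0)"
      using ivp f by (simp add: I y0 gval_eq_zero_iff)
  qed
  then show "I = eclass U y" using f y by (simp add: I eclass_eq_iff)
next
  assume I: "I = eclass U y"
  show ?ivp
    unfolding I first_order_eclass[OF y] eqy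
    using y size_class_0[OF size_class_negligible] by (simp add: gval_eq_zero_iff y0)
qed

lemma second_order_ivp_iff:
  fixes L R K :: complex
  assumes L: "L \<noteq> 0" and R: "R = - L * (l + m)" and K: "K = L * l * m"
    and h: "controlled moderate h" and y: "controlled moderate y"
    and eqy: "\<And>\<phi> x. L * nderiv 2 (y \<phi>) x + R * nderiv 1 (y \<phi>) x + K * y \<phi> x = h \<phi> x"
    and y0: "\<And>\<phi>. y \<phi> 0 = 0" and y1: "\<And>\<phi>. nderiv 1 (y \<phi>) 0 = 0"
  shows "second_order_ivp L R K (eclass U h) I \<longleftrightarrow> I = eclass U y" (is "?ivp \<longleftrightarrow> _")
proof
  assume ivp: ?ivp
  from conjunct1[OF ivp] obtain f where f: "controlled moderate f" and I: "I = eclass U f"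
    unfolding carrier_Ehat by auto
  let ?z = "\<lambda>\<phi> x. f \<phi> x - y \<phi> x"
  have "controlled negligible_net ?z"
  proof (rule homogeneous_second_order_negligible[OF L R K])
    show "controlled moderate ?z" by (intro controlled_diff f y) simp
    have "controlled negligible_net (\<lambda>\<phi> x. (L * nderiv 2 (f \<phi>) x + R * nderiv 1 (f \<phi>) x + K * f \<phi> x) - h \<phi> x)"
      using ivp f h controlled_nderiv[OF f, of 1] controlled_nderiv[OF f, of 2]
      by (simp add: I second_order_eclass eclass_eq_iff controlled_add controlled_cmult)
    then show "controlled negligible_net
        (\<lambda>\<phi> x. L * nderiv 2 (?z \<phi>) x + R * nderiv 1 (?z \<phi>) x + K * ?z \<phi> x)"
      unfolding nderiv_diff_net[OF f y] eqy[symmetric] by (simp add: algebra_simps)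
    show "neg_net (\<lambda>\<phi>. ?z \<phi> 0)"
      using ivp f by (simp add: I y0 gval_eq_zero_iff)
    show "neg_net (\<lambda>\<phi>. nderiv 1 (?z \<phi>) 0)"
      using ivp f unfolding nderiv_diff_net[OF f y]
      by (simp add: I y1 gval_eq_zero_iff gfun_deriv_eclass controlled_nderiv del: One_nat_def)
  qed
  then show "I = eclass U y" using f y by (simp add: I eclass_eq_iff)
next
  assume I: "I = eclass U y"
  show ?ivp
    unfolding I second_order_eclass[OF y] eqy unfolding gfun_deriv_eclass[OF y]
    using y size_class_0[OF size_class_negligible]
    by (simp add: gval_eq_zero_iff controlled_nderiv y0 y1 del: One_nat_def)
qed

lemma num_0_gscale: "F \<in> carrier (Ehat U) \<Longrightarrow> num U 0 \<cdot>\<^bsub>U\<^esub> F = \<zero>\<^bsub>Ehat U\<^esub>"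
  using carrier_Ehat[of F] by (auto simp: num_gscale_eclass eclass_zero)

lemma num_mult_eq_zero_iff:
  assumes "X \<in> carrier (Chat U)"
  shows "num U z \<otimes>\<^bsub>Chat U\<^esub> X = \<zero>\<^bsub>Chat U\<^esub> \<longleftrightarrow> z = 0 \<or> X = \<zero>\<^bsub>Chat U\<^esub>"
proof -
  obtain a where a: "mod_net a" and X: "X = cclass U a" using assms carrier_Chat by blast
  have za: "mod_net (\<lambda>\<phi>. z * a \<phi>)" by (rule size_class_norm_mult[OF size_class_moderate moderate_const a])
  have "neg_net (\<lambda>\<phi>. z * a \<phi>) \<longleftrightarrow> z = 0 \<or> neg_net a"
  proof
    assume n: "neg_net (\<lambda>\<phi>. z * a \<phi>)"
    show "z = 0 \<or> neg_net a"
      using size_class_norm_mult[OF size_class_negligible moderate_const n, of "1 / z"]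
      by (cases "z = 0") simp_all
  next
    assume "z = 0 \<or> neg_net a"
    then show "neg_net (\<lambda>\<phi>. z * a \<phi>)"
      using size_class_norm_mult[OF size_class_negligible moderate_const, of a z]
        size_class_0[OF size_class_negligible] by auto
  qed
  then show ?thesis
    using a za by (simp add: X num_def cclass_mult moderate_const cclass_zero cclass_eq_iff)
qed

lemma gfun_deriv_carrier: "I \<in> carrier (Ehat U) \<Longrightarrow> gfun_deriv U I \<in> carrier (Ehat U)"
  using carrier_Ehat[of I] by (auto simp: gfun_deriv_eclass controlled_nderiv)

lemma gval_carrier: "I \<in> carrier (Ehat U) \<Longrightarrow> gval U I x \<in> carrier (Chat U)"
  using carrier_Ehat[of I] by (auto simp: gval_eclass mod_net_value)

lemma gscale_num_carrier: "F \<in> carrier (Ehat U) \<Longrightarrow> num U z \<cdot>\<^bsub>U\<^esub> F \<in> carrier (Ehat U)"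
  using carrier_Ehat[of F] by (auto simp: num_gscale_eclass controlled_cmult)

lemma kernel_conv_nderiv:
  assumes h: "controlled P h" "causal_net h"
  shows "nderiv 1 (\<lambda>x. kernel_conv c l d m (h \<phi>) x + exp_kernel a l b m x) =
    (\<lambda>x. kernel_conv (c * l) l (d * m) m (h \<phi>) x + exp_kernel (a * l) l (b * m) m x + (c + d) * h \<phi> x)"
proof (rule nderiv_1I)
  fix x
  have "((\<lambda>x. kernel_conv c l d m (h \<phi>) x + exp_kernel a l b m x) has_vector_derivative
      (kernel_conv (c * l) l (d * m) m (h \<phi>) x + (c + d) * h \<phi> x) + exp_kernel (a * l) l (b * m) m x) (at x)"
    by (intro has_vector_derivative_add kernel_conv_has_vector_derivative[OF h] exp_kernel_has_vector_derivative)
  then show "((\<lambda>x. kernel_conv c l d m (h \<phi>) x + exp_kernel a l b m x) has_vector_derivative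
      kernel_conv (c * l) l (d * m) m (h \<phi>) x + exp_kernel (a * l) l (b * m) m x + (c + d) * h \<phi> x) (at x)"
    by (simp add: algebra_simps)
qed

lemma controlled_kernel_solution:
  assumes h: "controlled moderate h" "causal_net h" and ab: "mod_net a" "mod_net b"
  shows "controlled moderate (\<lambda>\<phi> x. kernel_conv c l d m (h \<phi>) x + exp_kernel (a \<phi>) l (b \<phi>) m x)"
  by (intro controlled_add controlled_kernel_conv controlled_exp_kernel_coeffs h ab) simp_all

lemma first_order_solution:
  fixes R K :: complex
  assumes R: "R \<noteq> 0" and K: "K = - R * l" and c: "R * c = 1"
    and h: "controlled moderate h" "causal_net h"
  shows "first_order_ivp R K (eclass U h) I \<longleftrightarrow>
    I = eclass U (\<lambda>\<phi> x. kernel_conv c l 0 0 (h \<phi>) x - kernel_conv c l 0 0 (h \<phi>) 0 * exp_kernel 1 l 0 0 x)"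
proof -
  define a where "a \<phi> = - kernel_conv c l 0 0 (h \<phi>) 0" for \<phi>
  have a: "mod_net a"
    using mod_net_value[OF controlled_kernel_conv[OF size_class_moderate h], of c l 0 0 0] by (simp add: a_def[abs_def])
  let ?y = "\<lambda>\<phi> x. kernel_conv c l 0 0 (h \<phi>) x + exp_kernel (a \<phi>) l 0 0 x"
  have "first_order_ivp R K (eclass U h) I \<longleftrightarrow> I = eclass U ?y"
  proof (rule first_order_ivp_iff[OF R K h(1)])
    show "controlled moderate ?y"
      by (rule controlled_kernel_solution[OF h a]) (simp add: moderate_const)
    fix \<phi>
    show "?y \<phi> 0 = 0" by (simp add: a_def exp_kernel_def)
    fix x
    have "R * (c * (l * z)) = l * z" for z using c by (metis mult.assoc mult.commute mult_1)
    moreover have "R * (c * z) = z" for z using c by (metis mult.assoc mult_1)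
    ultimately show "R * nderiv 1 (?y \<phi>) x + K * ?y \<phi> x = h \<phi> x"
      unfolding kernel_conv_nderiv[OF h] by (simp add: kernel_conv_def exp_kernel_def K algebra_simps)
  qed
  moreover have "?y = (\<lambda>\<phi> x. kernel_conv c l 0 0 (h \<phi>) x - kernel_conv c l 0 0 (h \<phi>) 0 * exp_kernel 1 l 0 0 x)"
    by (simp add: a_def exp_kernel_def fun_eq_iff)
  ultimately show ?thesis by simp
qed

text \<open>The conditions \<open>c + d = 0\<close> and \<open>L (c l + d m) = 1\<close> say that the causal kernel is continuous at the
  origin while \<open>L\<close> times its derivative jumps by 1: it is a fundamental solution. The coefficients
  \<open>a, b\<close> of the homogeneous part cancel the initial values of the convolution.\<close>

lemma second_order_solution:
  fixes L R K :: complex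
  assumes L: "L \<noteq> 0" and R: "R = - L * (l + m)" and K: "K = L * l * m"
    and cd: "c + d = 0" "L * (c * l + d * m) = 1"
    and h: "controlled moderate h" "causal_net h" and ab: "mod_net a" "mod_net b"
    and init: "\<And>\<phi>. a \<phi> + b \<phi> = - kernel_conv c l d m (h \<phi>) 0"
      "\<And>\<phi>. a \<phi> * l + b \<phi> * m = - kernel_conv (c * l) l (d * m) m (h \<phi>) 0"
  shows "second_order_ivp L R K (eclass U h) I \<longleftrightarrow> I = eclass U (\<lambda>\<phi> x. kernel_conv c l d m (h \<phi>) x + exp_kernel (a \<phi>) l (b \<phi>) m x)"
    (is "_ \<longleftrightarrow> I = eclass U ?y")
proof (rule second_order_ivp_iff[OF L R K h(1)])
  show "controlled moderate ?y" by (rule controlled_kernel_solution[OF h ab])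
  fix \<phi>
  show "?y \<phi> 0 = 0" using init(1)[of \<phi>] by (simp add: exp_kernel_def)
  have n1: "nderiv 1 (?y \<phi>) = (\<lambda>x. kernel_conv (c * l) l (d * m) m (h \<phi>) x + exp_kernel (a \<phi> * l) l (b \<phi> * m) m x)"
    unfolding kernel_conv_nderiv[OF h] by (simp add: cd(1))
  have n2: "nderiv 2 (?y \<phi>) = (\<lambda>x. kernel_conv (c * l * l) l (d * m * m) m (h \<phi>) x
      + exp_kernel (a \<phi> * l * l) l (b \<phi> * m * m) m x + (c * l + d * m) * h \<phi> x)"
    using nderiv_nderiv[of 1 1 "?y \<phi>"] unfolding n1 kernel_conv_nderiv[OF h] by (simp add: numeral_2_eq_2)
  show "nderiv 1 (?y \<phi>) 0 = 0" unfolding n1 using init(2)[of \<phi>] by (simp add: exp_kernel_def)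
  fix x
  have "L * nderiv 2 (?y \<phi>) x + R * nderiv 1 (?y \<phi>) x + K * ?y \<phi> x = L * (c * l + d * m) * h \<phi> x"
    unfolding n1 n2 R K by (simp add: kernel_conv_def exp_kernel_def algebra_simps)
  then show "L * nderiv 2 (?y \<phi>) x + R * nderiv 1 (?y \<phi>) x + K * ?y \<phi> x = h \<phi> x"
    using cd(2) by simp
qed

end

section \<open>The three circuits\<close>

lemma exp_kernel_scale: "exp_kernel (s * c) l (s * d) m t = s * exp_kernel c l d m t"
  by (simp add: exp_kernel_def algebra_simps)

lemma kernel_conv_scale: "kernel_conv (s * c) l (s * d) m h x = s * kernel_conv c l d m h x"
  by (simp add: kernel_conv_def algebra_simps)

text \<open>Euler's formulas, for the exponents \<open>-a \<plusminus> \<i> w\<close>.\<close>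

lemma exp_kernel_cos:
  "exp_kernel (1 / 2) (Complex (- a) w) (1 / 2) (Complex (- a) (- w)) t =
    of_real (exp (- a * t) * cos (w * t))"
  by (simp add: exp_kernel_def complex_eq_iff Re_exp Im_exp)

lemma exp_kernel_sin:
  "exp_kernel (- \<i> / 2) (Complex (- a) w) (\<i> / 2) (Complex (- a) (- w)) t =
    of_real (exp (- a * t) * sin (w * t))"
  by (simp add: exp_kernel_def complex_eq_iff Re_exp Im_exp)

lemma causal_dist_cos:
  "dist_of (\<lambda>t. of_real (heaviside t * exp (- a * t) * cos (w * t))) =
    causal_dist (1 / 2) (Complex (- a) w) (1 / 2) (Complex (- a) (- w))"
  unfolding causal_dist_def exp_kernel_cos by (simp add: mult.assoc)

lemma causal_dist_sin:
  "dist_of (\<lambda>t. of_real (s * heaviside t * exp (- a * t) * sin (w * t))) =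
    causal_dist (of_real s * (- \<i> / 2)) (Complex (- a) w) (of_real s * (\<i> / 2)) (Complex (- a) (- w))"
  unfolding causal_dist_def exp_kernel_scale exp_kernel_sin by (simp add: mult_ac)

lemma causal_dist_lincomb:
  "causal_dist (p * c + q * c') l (p * d + q * d') m \<phi> =
    p * causal_dist c l d m \<phi> + q * causal_dist c' l d' m \<phi>"
proof -
  have i: "integrable lborel (\<lambda>t. of_real (heaviside t) * (exp_kernel c l d m t * tf \<phi> t))" for c l d m
    by (intro integrable_heaviside_mult integrable_continuous_mult_tf continuous_exp_kernel)
  have eq: "causal_dist c l d m \<phi> = (LINT t|lborel. of_real (heaviside t) * (exp_kernel c l d m t * tf \<phi> t))"
    for c l d m by (simp add: causal_dist_def dist_of_def mult.assoc)
  have "causal_dist (p * c + q * c') l (p * d + q * d') m \<phi> =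
      (LINT t|lborel. p * (of_real (heaviside t) * (exp_kernel c l d m t * tf \<phi> t)) +
        q * (of_real (heaviside t) * (exp_kernel c' l d' m t * tf \<phi> t)))"
    unfolding eq by (simp add: exp_kernel_def algebra_simps)
  also have "\<dots> = p * causal_dist c l d m \<phi> + q * causal_dist c' l d' m \<phi>"
    unfolding eq using i by simp
  finally show ?thesis .
qed

context admissible
begin

lemma kirchhoff_ivp_iff:
  assumes "L \<noteq> 0"
  shows "kirchhoff_ivp U L R C V I \<longleftrightarrow> second_order_ivp L R (1 / C) (gfun_deriv U V) I"
proof (cases "I \<in> carrier (Ehat U)")
  case True
  then show ?thesis
    using num_mult_eq_zero_iff[OF gval_carrier[OF gfun_deriv_carrier[OF True]], of "of_real L" 0] assms
    by (simp add: kirchhoff_ivp_def)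
qed (simp add: kirchhoff_ivp_def)

lemma kirchhoff_ivp_L0_iff:
  "kirchhoff_ivp U 0 R C V I \<longleftrightarrow> first_order_ivp R (1 / C) (gfun_deriv U V) I"
proof -
  interpret cring "Ehat U" by (rule cring_Ehat)
  show ?thesis
  proof (cases "I \<in> carrier (Ehat U)")
    case True
    then show ?thesis
      using num_mult_eq_zero_iff[OF gval_carrier[OF gfun_deriv_carrier[OF True]], of 0 0]
      by (simp add: kirchhoff_ivp_def num_0_gscale gscale_num_carrier gfun_deriv_carrier)
  qed (simp add: kirchhoff_ivp_def)
qed

lemma undamped_term:
  assumes "I \<in> carrier (Ehat U)"
  shows "num U L \<cdot>\<^bsub>U\<^esub> gfun_deriv U (gfun_deriv U I) \<oplus>\<^bsub>Ehat U\<^esub> num U 0 \<cdot>\<^bsub>U\<^esub> gfun_deriv U I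
       \<oplus>\<^bsub>Ehat U\<^esub> num U K \<cdot>\<^bsub>U\<^esub> I =
     num U L \<cdot>\<^bsub>U\<^esub> gfun_deriv U (gfun_deriv U I) \<oplus>\<^bsub>Ehat U\<^esub> num U K \<cdot>\<^bsub>U\<^esub> I"
proof -
  interpret cring "Ehat U" by (rule cring_Ehat)
  show ?thesis using assms by (simp add: num_0_gscale gscale_num_carrier gfun_deriv_carrier)
qed

text \<open>The case of the conjugate roots \<open>-a \<plusminus> \<i> w\<close>, in real form. The kernel is
  \<open>H(t) exp (-a t) sin (w t) / (L w)\<close>.\<close>

lemma oscillator_solution:
  fixes L a w :: real and Rc Kc :: complex
  assumes L: "L \<noteq> 0" and w: "w \<noteq> 0" and Rc: "Rc = of_real (2 * L * a)"
    and Kc: "Kc = of_real (L * (a\<^sup>2 + w\<^sup>2))"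
    and h: "controlled moderate h" "causal_net h"
    and l: "l = Complex (- a) w" and m: "m = Complex (- a) (- w)"
    and c: "c = of_real (1 / (L * w)) * (- \<i> / 2)" and d: "d = of_real (1 / (L * w)) * (\<i> / 2)"
    and W: "W = (\<lambda>\<phi>. kernel_conv c l d m (h \<phi>))"
    and W': "W' = (\<lambda>\<phi>. kernel_conv (c * l) l (d * m) m (h \<phi>))"
  shows "second_order_ivp L Rc Kc (eclass U h) I \<longleftrightarrow> I = eclass U (\<lambda>\<phi> x. W \<phi> x - W \<phi> 0 * of_real (exp (- a * x) * cos (w * x))
        - (of_real a * W \<phi> 0 + W' \<phi> 0) / of_real w * of_real (exp (- a * x) * sin (w * x)))"
proof -
  have lm: "l + m = - 2 * of_real a" "l - m = 2 * \<i> * of_real w" "l * m = of_real (a\<^sup>2 + w\<^sup>2)"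
    by (simp_all add: l m complex_eq_iff power2_eq_square)
  define B where "B \<phi> = (of_real a * W \<phi> 0 + W' \<phi> 0) / of_real w" for \<phi>
  \<comment> \<open>coefficients of the two exponentials in \<open>- W 0 cos - B sin\<close>\<close>
  define p q where "p \<phi> = - W \<phi> 0 / 2 + B \<phi> * \<i> / 2" and "q \<phi> = - W \<phi> 0 / 2 - B \<phi> * \<i> / 2" for \<phi>
  have ctl: "controlled moderate W" "controlled moderate W'"
    unfolding W W' by (intro controlled_kernel_conv h size_class_moderate)+
  have mW: "mod_net (\<lambda>\<phi>. z * W \<phi> 0)" "mod_net (\<lambda>\<phi>. z * W' \<phi> 0)" for z
    by (intro size_class_norm_mult[OF size_class_moderate moderate_const] mod_net_value ctl)+
  have p: "mod_net p"
    using size_class_norm_add[OF size_class_moderate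
        mW(1)[of "- 1 / 2 + of_real a / of_real w * \<i> / 2"] mW(2)[of "1 / of_real w * \<i> / 2"]]
    by (simp add: p_def[abs_def] B_def add_divide_distrib distrib_left distrib_right algebra_simps)
  have q: "mod_net q"
    using size_class_norm_add[OF size_class_moderate
        mW(1)[of "- 1 / 2 - of_real a / of_real w * \<i> / 2"] mW(2)[of "- 1 / of_real w * \<i> / 2"]]
    by (simp add: q_def[abs_def] B_def add_divide_distrib distrib_left distrib_right algebra_simps)
  have cd: "c * l + d * m = of_real (1 / (L * w)) * (- \<i> / 2) * (l - m)"
    using L w by (simp add: c d field_simps)
  have "second_order_ivp L Rc Kc (eclass U h) I \<longleftrightarrow> I = eclass U (\<lambda>\<phi> x. kernel_conv c l d m (h \<phi>) x + exp_kernel (p \<phi>) l (q \<phi>) m x)"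
  proof (rule second_order_solution)
    show "complex_of_real L \<noteq> 0" using L by simp
    show "Rc = - complex_of_real L * (l + m)" by (simp add: Rc lm)
    show "Kc = complex_of_real L * l * m" by (simp add: Kc lm mult.assoc)
    show "c + d = 0" by (simp add: c d)
    show "complex_of_real L * (c * l + d * m) = 1" unfolding cd lm using L w by (simp add: field_simps)
    show "p \<phi> + q \<phi> = - kernel_conv c l d m (h \<phi>) 0" for \<phi>
      by (simp add: p_def q_def W field_simps)
    show "p \<phi> * l + q \<phi> * m = - kernel_conv (c * l) l (d * m) m (h \<phi>) 0" for \<phi>
    proof -
      have "p \<phi> * l + q \<phi> * m = - W \<phi> 0 / 2 * (l + m) + B \<phi> * \<i> / 2 * (l - m)"
        by (simp add: p_def q_def algebra_simps)
      also have "\<dots> = - W' \<phi> 0" unfolding lm B_def using w by (simp add: field_simps)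
      finally show ?thesis by (simp add: W')
    qed
  qed (fact h p q)+
  moreover have "kernel_conv c l d m (h \<phi>) x + exp_kernel (p \<phi>) l (q \<phi>) m x =
      W \<phi> x - W \<phi> 0 * of_real (exp (- a * x) * cos (w * x))
        - B \<phi> * of_real (exp (- a * x) * sin (w * x))" for \<phi> x
    unfolding exp_kernel_cos[symmetric] exp_kernel_sin[symmetric]
    by (simp add: W exp_kernel_def p_def q_def l m algebra_simps)
  ultimately show ?thesis unfolding B_def by (simp only:)
qed

text \<open>All that has to be known about the voltage: its derivative has a moderate causal representative on
  which every convolution of the theorem acts as an integral operator.\<close>

lemma span_hat_deriv_net:
  assumes "V \<in> span_hat U distributions_plus"
  obtains h where "controlled moderate h" "causal_net h" "gfun_deriv U V = eclass U h"
    "\<And>c l d m. gconv U (causal_dist c l d m) (eclass U h) = eclass U (\<lambda>\<phi>. kernel_conv c l d m (h \<phi>))"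
proof -
  obtain k a S where data: "span_data k a S" and V: "V = eclass U (span_net k a S)"
    by (rule span_hatE[OF assms])
  note D = span_net_deriv[OF data]
  show thesis
  proof (rule that)
    show "gfun_deriv U V = eclass U (span_net k a (\<lambda>n. dist_deriv (S n)))"
      unfolding V gfun_deriv_eclass[OF span_net_controlled[OF data]] D(1) ..
  qed (intro span_net_controlled span_net_causal gconv_causal_dist D(2))+
qed

lemma oscillation_eclass:
  assumes A: "mod_net A" and B: "mod_net B" and W: "controlled moderate W"
    and f: "smooth f" and g: "smooth g"
  shows "\<ominus>\<^bsub>Ehat U\<^esub> (cclass U A \<cdot>\<^bsub>U\<^esub> eclass U (\<lambda>\<phi>. f)) \<ominus>\<^bsub>Ehat U\<^esub> cclass U B \<cdot>\<^bsub>U\<^esub> eclass U (\<lambda>\<phi>. g)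
      \<oplus>\<^bsub>Ehat U\<^esub> eclass U W = eclass U (\<lambda>\<phi> x. W \<phi> x - A \<phi> * f x - B \<phi> * g x)"
proof -
  note fg = controlled_smooth_fun[OF f] controlled_smooth_fun[OF g]
  have t: "controlled moderate (\<lambda>\<phi> x. A \<phi> * f x)" "controlled moderate (\<lambda>\<phi> x. B \<phi> * g x)"
    by (intro controlled_scale size_class_moderate A B fg)+
  have t': "controlled moderate (\<lambda>\<phi> x. - (A \<phi> * f x))"
    using controlled_cmult[OF size_class_moderate t(1), where c = "- 1"] by simp
  show ?thesis
    unfolding gscale_eclass[OF A fg(1)] gscale_eclass[OF B fg(2)] eclass_a_inv[OF t(1)] eclass_diff[OF t' t(2)]
    using eclass_add[OF controlled_diff[OF size_class_moderate t' t(2)] W] by (simp add: algebra_simps)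
qed

lemma circuit_without_inductance:
  fixes R C :: real
  assumes R: "R > 0" and C: "C > 0" and V: "V \<in> span_hat U distributions_plus"
    and g: "g = dist_of (\<lambda>t. of_real (1 / R * heaviside t * exp (- t / (R * C))))"
    and e: "e = iota U (dist_of (\<lambda>t. of_real (exp (- t / (R * C)))))"
  shows "I \<in> carrier (Ehat U) \<and>
      num U R \<cdot>\<^bsub>U\<^esub> gfun_deriv U I \<oplus>\<^bsub>Ehat U\<^esub> num U (1 / C) \<cdot>\<^bsub>U\<^esub> I = gfun_deriv U V \<and>
      gval U I 0 = \<zero>\<^bsub>Chat U\<^esub> \<longleftrightarrow>
    I = gconv U g (gfun_deriv U V) \<ominus>\<^bsub>Ehat U\<^esub> gval U (gconv U g (gfun_deriv U V)) 0 \<cdot>\<^bsub>U\<^esub> e"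
proof -
  obtain h where h: "controlled moderate h" "causal_net h" and V': "gfun_deriv U V = eclass U h"
    and conv: "\<And>c l d m. gconv U (causal_dist c l d m) (eclass U h) = eclass U (\<lambda>\<phi>. kernel_conv c l d m (h \<phi>))"
    using span_hat_deriv_net[OF V] by metis
  define l where "l = complex_of_real (- 1 / (R * C))"
  define c where "c = complex_of_real (1 / R)"
  have ek: "exp_kernel z l 0 0 t = z * of_real (exp (- t / (R * C)))" for z t
    unfolding exp_kernel_def l_def of_real_mult[symmetric] exp_of_real by simp
  have g': "g = causal_dist c l 0 0"
    unfolding g causal_dist_def ek by (simp add: c_def mult_ac)
  have e': "e = eclass U (\<lambda>\<phi>. exp_kernel 1 l 0 0)"
    unfolding e iota_exp_kernel[symmetric] ek by simp
  let ?W = "\<lambda>\<phi>. kernel_conv c l 0 0 (h \<phi>)"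
  have W: "controlled moderate ?W" by (intro controlled_kernel_conv h size_class_moderate)
  have E: "controlled moderate (\<lambda>\<phi>. exp_kernel 1 l 0 0)" by (intro controlled_smooth_fun smooth_exp_kernel)
  have "gconv U g (gfun_deriv U V) \<ominus>\<^bsub>Ehat U\<^esub> gval U (gconv U g (gfun_deriv U V)) 0 \<cdot>\<^bsub>U\<^esub> e =
      eclass U (\<lambda>\<phi> x. ?W \<phi> x - ?W \<phi> 0 * exp_kernel 1 l 0 0 x)"
    unfolding g' V' conv e' using W E mod_net_value[OF W, of 0]
    by (simp add: gval_eclass gscale_eclass eclass_diff controlled_scale)
  moreover have "complex_of_real R \<noteq> 0" "complex_of_real (1 / C) = - complex_of_real R * l"
    "complex_of_real R * c = 1"
    using R C by (simp_all add: l_def c_def)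
  ultimately show ?thesis using first_order_solution[of "of_real R" "of_real (1 / C)" l c h I] h
    by (simp add: V')
qed


text \<open>With \<open>\<alpha> = R / (2 L)\<close> the characteristic roots are \<open>-\<alpha> \<plusminus> \<i> \<omega>\<close>, because \<open>L (\<alpha>\<^sup>2 + \<omega>\<^sup>2) = 1 / C\<close>. The
  identities between distributions reduce to comparing the coefficients of the two exponentials.\<close>

lemma damped_circuit:
  fixes L R C \<omega> :: real and G G' G'' Hcos Hsin :: "test_fun \<Rightarrow> complex"
  assumes L: "L > 0" and C: "C > 0" and damp: "R\<^sup>2 - 4 * L / C < 0"
    and V: "V \<in> span_hat U distributions_plus"
    and om: "\<omega> = 1 / (2 * L) * sqrt (4 * L / C - R\<^sup>2)"
    and Hcos: "Hcos = dist_of (\<lambda>t. of_real (heaviside t * exp (- (R / (2 * L)) * t) * cos (\<omega> * t)))"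
    and Hsin: "Hsin = dist_of (\<lambda>t. of_real (heaviside t * exp (- (R / (2 * L)) * t) * sin (\<omega> * t)))"
    and G: "G = dist_of (\<lambda>t. of_real
                  (1 / (L * \<omega>) * heaviside t * exp (- (R / (2 * L)) * t) * sin (\<omega> * t)))"
    and G': "G' = dist_deriv G" and G'': "G'' = dist_deriv G'"
    and ecos: "ecos = iota U (dist_of (\<lambda>t. of_real (exp (- (R / (2 * L)) * t) * cos (\<omega> * t))))"
    and esin: "esin = iota U (dist_of (\<lambda>t. of_real (exp (- (R / (2 * L)) * t) * sin (\<omega> * t))))"
    and V': "V' = gfun_deriv U V"
    and a: "a = gval U (gconv U G V') 0" and b: "b = gval U (gconv U G' V') 0"
  shows "I \<in> carrier (Ehat U) \<and>
              num U L \<cdot>\<^bsub>U\<^esub> gfun_deriv U (gfun_deriv U I) \<oplus>\<^bsub>Ehat U\<^esub> num U R \<cdot>\<^bsub>U\<^esub> gfun_deriv U I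
                \<oplus>\<^bsub>Ehat U\<^esub> num U (1 / C) \<cdot>\<^bsub>U\<^esub> I = V' \<and>
              gval U I 0 = \<zero>\<^bsub>Chat U\<^esub> \<and> gval U (gfun_deriv U I) 0 = \<zero>\<^bsub>Chat U\<^esub> \<longleftrightarrow>
              I = \<ominus>\<^bsub>Ehat U\<^esub> (a \<cdot>\<^bsub>U\<^esub> ecos)
                  \<ominus>\<^bsub>Ehat U\<^esub> (num U (1 / (2 * L * \<omega>)) \<otimes>\<^bsub>Chat U\<^esub>
                      (num U R \<otimes>\<^bsub>Chat U\<^esub> a \<oplus>\<^bsub>Chat U\<^esub> num U (2 * L) \<otimes>\<^bsub>Chat U\<^esub> b)) \<cdot>\<^bsub>U\<^esub> esin
                  \<oplus>\<^bsub>Ehat U\<^esub> gconv U G V'" (is ?solution)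
    and "gapprox U (gval U (iota U G) 0) (num U 0)" (is ?G_0)
    and "gapprox U (gval U (iota U G') 0) (num U (1 / (2 * L)))" (is ?G'_0)
    and "G' = (\<lambda>\<phi>. - (R / (2 * L)) * G \<phi> + 1 / L * Hcos \<phi>)" (is ?G')
    and "G'' = (\<lambda>\<phi>. 1 / L * dirac \<phi> - R / L * G' \<phi> - 1 / (L * C) * G \<phi>)" (is ?G'')
    and "G'' = (\<lambda>\<phi>. 1 / L * dirac \<phi> - R / L\<^sup>2 * Hcos \<phi>
                    + 1 / (L * \<omega>) * (R\<^sup>2 / (4 * L\<^sup>2) - \<omega>\<^sup>2) * Hsin \<phi>)" (is ?G''_2)
proof -
  define \<alpha> where "\<alpha> = R / (2 * L)"
  define l m where "l = Complex (- \<alpha>) \<omega>" and "m = Complex (- \<alpha>) (- \<omega>)"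
  define s where "s = complex_of_real (1 / (L * \<omega>))"
  define c d where "c = s * (- \<i> / 2)" and "d = s * (\<i> / 2)"
  have omega: "\<omega> > 0" using L damp by (simp add: om)
  have omega2: "L * (\<alpha>\<^sup>2 + \<omega>\<^sup>2) = 1 / C"
  proof -
    have "\<omega>\<^sup>2 = (4 * L / C - R\<^sup>2) / (4 * L\<^sup>2)"
      using damp by (simp add: om power_mult_distrib power_divide real_sqrt_pow2)
    then have "\<alpha>\<^sup>2 + \<omega>\<^sup>2 = (4 * L / C) / (4 * L\<^sup>2)"
      by (simp add: \<alpha>_def power_divide power_mult_distrib add_divide_distrib[symmetric])
    then show ?thesis using L C by (simp add: power2_eq_square)
  qed
  have lm: "l - m = 2 * \<i> * of_real \<omega>" by (simp add: l_def m_def complex_eq_iff)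
  have s\<omega>: "s * of_real \<omega> = 1 / of_real L" using L omega by (simp add: s_def)
  have c0: "c + d = 0" by (simp add: c_def d_def)
  have c1: "c * l + d * m = 1 / of_real L"
  proof -
    have "d = - c" by (simp add: c_def d_def)
    then have "c * l + d * m = s * (- \<i> / 2) * (l - m)" unfolding c_def[symmetric] by (simp add: algebra_simps)
    also have "\<dots> = s * of_real \<omega>" unfolding lm by simp
    finally show ?thesis by (simp add: s\<omega>)
  qed
  have Gd: "G = causal_dist c l d m"
    unfolding G causal_dist_sin c_def d_def s_def l_def m_def \<alpha>_def ..
  have Hcosd: "Hcos = causal_dist (1 / 2) l (1 / 2) m"
    unfolding Hcos causal_dist_cos l_def m_def \<alpha>_def ..
  have Hsind: "Hsin = causal_dist (- \<i> / 2) l (\<i> / 2) m"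
    using causal_dist_sin[of 1 \<alpha> \<omega>] unfolding Hsin l_def m_def \<alpha>_def by simp
  have G'd: "G' = causal_dist (c * l) l (d * m) m"
    unfolding G' Gd using dist_deriv_causal_dist[of c l d m] by (simp add: fun_eq_iff c0)
  have G''d: "G'' \<phi> = 1 / of_real L * dirac \<phi> + causal_dist (c * l * l) l (d * m * m) m \<phi>" for \<phi>
    unfolding G'' G'd dist_deriv_causal_dist c1 ..
  show ?G_0 unfolding Gd using gapprox_causal_dist[of c l d m] by (simp add: c0)
  show ?G'_0 unfolding G'd using gapprox_causal_dist[of "c * l" l "d * m" m] by (simp add: c1 mult.commute)
  have cl: "c * l = - of_real \<alpha> * c + 1 / of_real L * (1 / 2)" "d * m = - of_real \<alpha> * d + 1 / of_real L * (1 / 2)"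
    unfolding s\<omega>[symmetric] by (simp_all add: c_def d_def l_def m_def complex_eq_iff field_simps)
  show ?G'
  proof
    fix \<phi>
    show "G' \<phi> = - (R / (2 * L)) * G \<phi> + 1 / L * Hcos \<phi>"
      unfolding G'd Gd Hcosd cl causal_dist_lincomb by (simp add: \<alpha>_def)
  qed
  have root: "l * l = - of_real (R / L) * l + - of_real (1 / (L * C))"
    "m * m = - of_real (R / L) * m + - of_real (1 / (L * C))"
  proof -
    have "1 / (L * C) = L * (\<alpha>\<^sup>2 + \<omega>\<^sup>2) / L" unfolding omega2 by simp
    then have "1 / (L * C) = \<alpha>\<^sup>2 + \<omega>\<^sup>2" "R / L = 2 * \<alpha>" using L by (simp_all add: \<alpha>_def)
    then show "l * l = - of_real (R / L) * l + - of_real (1 / (L * C))"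
      "m * m = - of_real (R / L) * m + - of_real (1 / (L * C))"
      by (simp_all only: l_def m_def) (simp_all add: complex_eq_iff power2_eq_square)
  qed
  show ?G''
  proof
    fix \<phi>
    have "c * l * l = - of_real (R / L) * (c * l) + - of_real (1 / (L * C)) * c"
      "d * m * m = - of_real (R / L) * (d * m) + - of_real (1 / (L * C)) * d"
      unfolding mult.assoc root by (simp_all add: algebra_simps)
    then show "G'' \<phi> = 1 / L * dirac \<phi> - R / L * G' \<phi> - 1 / (L * C) * G \<phi>"
      unfolding G''d by (simp only: causal_dist_lincomb) (simp add: G'd Gd)
  qed
  show ?G''_2
  proof
    fix \<phi>
    have "c * l * l = - of_real (R / L\<^sup>2) * (1 / 2) + s * of_real (\<alpha>\<^sup>2 - \<omega>\<^sup>2) * (- \<i> / 2)"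
      "d * m * m = - of_real (R / L\<^sup>2) * (1 / 2) + s * of_real (\<alpha>\<^sup>2 - \<omega>\<^sup>2) * (\<i> / 2)"
    proof -
      have "R / L\<^sup>2 = 2 * \<alpha> / L" by (simp add: \<alpha>_def power2_eq_square)
      then have r: "complex_of_real (R / L\<^sup>2) = 2 * of_real \<alpha> * (s * of_real \<omega>)" by (simp add: s\<omega>)
      show "c * l * l = - of_real (R / L\<^sup>2) * (1 / 2) + s * of_real (\<alpha>\<^sup>2 - \<omega>\<^sup>2) * (- \<i> / 2)"
        "d * m * m = - of_real (R / L\<^sup>2) * (1 / 2) + s * of_real (\<alpha>\<^sup>2 - \<omega>\<^sup>2) * (\<i> / 2)"
        unfolding r by (simp_all add: c_def d_def l_def m_def complex_eq_iff power2_eq_square field_simps)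
    qed
    then show "G'' \<phi> = 1 / L * dirac \<phi> - R / L\<^sup>2 * Hcos \<phi>
                    + 1 / (L * \<omega>) * (R\<^sup>2 / (4 * L\<^sup>2) - \<omega>\<^sup>2) * Hsin \<phi>"
      unfolding G''d by (simp only: causal_dist_lincomb) (simp add: Hcosd Hsind s_def \<alpha>_def power_divide power_mult_distrib)
  qed
  obtain h where h: "controlled moderate h" "causal_net h" and Vh: "gfun_deriv U V = eclass U h"
    and conv: "\<And>c l d m. gconv U (causal_dist c l d m) (eclass U h) = eclass U (\<lambda>\<phi>. kernel_conv c l d m (h \<phi>))"
    using span_hat_deriv_net[OF V] by metis
  define W where "W = (\<lambda>\<phi>. kernel_conv c l d m (h \<phi>))"
  define W' where "W' = (\<lambda>\<phi>. kernel_conv (c * l) l (d * m) m (h \<phi>))"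
  have W: "controlled moderate W" "controlled moderate W'"
    unfolding W_def W'_def by (intro controlled_kernel_conv h size_class_moderate)+
  define Ec where "Ec = (\<lambda>t. complex_of_real (exp (- \<alpha> * t) * cos (\<omega> * t)))"
  define Es where "Es = (\<lambda>t. complex_of_real (exp (- \<alpha> * t) * sin (\<omega> * t)))"
  have Ek: "Ec = exp_kernel (1 / 2) l (1 / 2) m" "Es = exp_kernel (- \<i> / 2) l (\<i> / 2) m"
    unfolding Ec_def Es_def l_def m_def exp_kernel_cos[symmetric] exp_kernel_sin[symmetric] by simp_all
  have EE: "smooth Ec" "smooth Es" unfolding Ek by (rule smooth_exp_kernel)+
  have e: "ecos = eclass U (\<lambda>\<phi>. Ec)" "esin = eclass U (\<lambda>\<phi>. Es)"
    unfolding ecos esin \<alpha>_def[symmetric] Ec_def[symmetric] Es_def[symmetric] Ek iota_exp_kernel by simp_all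
  have ab: "a = cclass U (\<lambda>\<phi>. W \<phi> 0)" "b = cclass U (\<lambda>\<phi>. W' \<phi> 0)"
    unfolding a b V' Vh Gd G'd conv W_def[symmetric] W'_def[symmetric] by (simp_all add: gval_eclass W)
  define B where "B \<phi> = of_real (1 / (2 * L * \<omega>)) * (of_real R * W \<phi> 0 + of_real (2 * L) * W' \<phi> 0)" for \<phi>
  have m0: "mod_net (\<lambda>\<phi>. W \<phi> 0)" "mod_net (\<lambda>\<phi>. W' \<phi> 0)" by (intro mod_net_value W)+
  have m1: "mod_net (\<lambda>\<phi>. of_real R * W \<phi> 0)" "mod_net (\<lambda>\<phi>. of_real (2 * L) * W' \<phi> 0)"
    by (rule size_class_norm_mult[OF size_class_moderate moderate_const]; fact m0)+
  have m2: "mod_net (\<lambda>\<phi>. of_real R * W \<phi> 0 + of_real (2 * L) * W' \<phi> 0)"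
    by (rule size_class_norm_add[OF size_class_moderate m1])
  have m3: "mod_net B"
    unfolding B_def[abs_def] by (rule size_class_norm_mult[OF size_class_moderate moderate_const m2])
  have Bc: "num U (1 / (2 * L * \<omega>)) \<otimes>\<^bsub>Chat U\<^esub>
      (num U R \<otimes>\<^bsub>Chat U\<^esub> a \<oplus>\<^bsub>Chat U\<^esub> num U (2 * L) \<otimes>\<^bsub>Chat U\<^esub> b) = cclass U B"
    unfolding ab num_def B_def[abs_def]
    using m0 m1 m2 by (simp add: cclass_mult cclass_add moderate_const)
  have rhs: "\<ominus>\<^bsub>Ehat U\<^esub> (a \<cdot>\<^bsub>U\<^esub> ecos) \<ominus>\<^bsub>Ehat U\<^esub> cclass U B \<cdot>\<^bsub>U\<^esub> esin \<oplus>\<^bsub>Ehat U\<^esub> gconv U G V' =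
      eclass U (\<lambda>\<phi> x. W \<phi> x - W \<phi> 0 * Ec x - B \<phi> * Es x)"
    unfolding ab(1) e V' Vh Gd conv W_def[symmetric] by (rule oscillation_eclass[OF m0(1) m3 W(1) EE])
  have "(of_real \<alpha> * W \<phi> 0 + W' \<phi> 0) / of_real \<omega> = B \<phi>" for \<phi>
    using L omega by (simp add: B_def \<alpha>_def field_simps)
  then have fin: "(\<lambda>\<phi> x. W \<phi> x - W \<phi> 0 * of_real (exp (- \<alpha> * x) * cos (\<omega> * x))
        - (of_real \<alpha> * W \<phi> 0 + W' \<phi> 0) / of_real \<omega> * of_real (exp (- \<alpha> * x) * sin (\<omega> * x))) =
      (\<lambda>\<phi> x. W \<phi> x - W \<phi> 0 * Ec x - B \<phi> * Es x)"
    by (simp add: Ec_def Es_def)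
  show ?solution
    unfolding Bc rhs fin[symmetric] unfolding V' Vh
  proof (rule oscillator_solution[where h = h and l = l and m = m and c = c and d = d])
    show "complex_of_real R = of_real (2 * L * \<alpha>)" using L by (simp add: \<alpha>_def)
  qed (use L omega omega2 h in \<open>auto simp: l_def m_def c_def d_def s_def W_def W'_def\<close>)
qed

text \<open>The case \<open>\<alpha> = 0\<close>, except that \<open>G0\<close> is \<open>L\<close> times the fundamental solution, which accounts for the
  factors \<open>1 / L\<close>. The derivative of \<open>G0\<close> is an even kernel on the half line, hence the exact value
  1/2 at the origin.\<close>

lemma undamped_circuit:
  fixes L C \<omega> :: real and G0 G0' G0'' Hcos Hsin :: "test_fun \<Rightarrow> complex"
  assumes L: "L > 0" and C: "C > 0"
    and V: "V \<in> span_hat U distributions_plus"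
    and om: "\<omega> = 1 / sqrt (L * C)"
    and Hcos: "Hcos = dist_of (\<lambda>t. of_real (heaviside t * cos (\<omega> * t)))"
    and Hsin: "Hsin = dist_of (\<lambda>t. of_real (heaviside t * sin (\<omega> * t)))"
    and G0: "G0 = dist_of (\<lambda>t. of_real (1 / \<omega> * heaviside t * sin (\<omega> * t)))"
    and G0': "G0' = dist_deriv G0" and G0'': "G0'' = dist_deriv G0'"
    and cosine: "cosine = iota U (dist_of (\<lambda>t. of_real (cos (\<omega> * t))))"
    and sine: "sine = iota U (dist_of (\<lambda>t. of_real (sin (\<omega> * t))))"
    and V': "V' = gfun_deriv U V"
  shows "I \<in> carrier (Ehat U) \<and>
              num U L \<cdot>\<^bsub>U\<^esub> gfun_deriv U (gfun_deriv U I) \<oplus>\<^bsub>Ehat U\<^esub> num U (1 / C) \<cdot>\<^bsub>U\<^esub> I = V' \<and>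
              gval U I 0 = \<zero>\<^bsub>Chat U\<^esub> \<and> gval U (gfun_deriv U I) 0 = \<zero>\<^bsub>Chat U\<^esub> \<longleftrightarrow>
              I = \<ominus>\<^bsub>Ehat U\<^esub> ((num U (1 / L) \<otimes>\<^bsub>Chat U\<^esub> gval U (gconv U G0 V') 0) \<cdot>\<^bsub>U\<^esub> cosine)
                  \<ominus>\<^bsub>Ehat U\<^esub> (num U (1 / (L * \<omega>)) \<otimes>\<^bsub>Chat U\<^esub> gval U (gconv U G0' V') 0) \<cdot>\<^bsub>U\<^esub> sine
                  \<oplus>\<^bsub>Ehat U\<^esub> num U (1 / L) \<cdot>\<^bsub>U\<^esub> gconv U G0 V'" (is ?solution)
    and "gapprox U (gval U (iota U G0) 0) (num U 0)" (is ?G_0)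
    and "gval U (iota U G0') 0 = num U (1 / 2)" (is ?G'_0)
    and "G0' = Hcos" (is ?G')
    and "G0'' = (\<lambda>\<phi>. dirac \<phi> - \<omega>\<^sup>2 * G0 \<phi>)" (is ?G'')
    and "G0'' = (\<lambda>\<phi>. dirac \<phi> - \<omega> * Hsin \<phi>)" (is ?G''_2)
proof -
  define l m where "l = Complex (- 0) \<omega>" and "m = Complex (- 0) (- \<omega>)"
  define s where "s = complex_of_real (1 / \<omega>)"
  define c d where "c = s * (- \<i> / 2)" and "d = s * (\<i> / 2)"
  have omega: "\<omega> > 0" using L C by (simp add: om)
  have omega2: "L * (0\<^sup>2 + \<omega>\<^sup>2) = 1 / C"
    using L C by (simp add: om power_divide field_simps)
  have s\<omega>: "s * of_real \<omega> = 1" using omega by (simp add: s_def)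
  have c0: "c + d = 0" by (simp add: c_def d_def)
  have cl: "c * l = 1 / 2" "d * m = 1 / 2"
    using omega by (simp_all add: c_def d_def s_def l_def m_def complex_eq_iff)
  have Gd: "G0 = causal_dist c l d m"
    using causal_dist_sin[of "1 / \<omega>" 0 \<omega>] unfolding G0 c_def d_def s_def l_def m_def by simp
  have Hcosd: "Hcos = causal_dist (1 / 2) l (1 / 2) m"
    using causal_dist_cos[of 0 \<omega>] unfolding Hcos l_def m_def by simp
  have Hsind: "Hsin = causal_dist (- \<i> / 2) l (\<i> / 2) m"
    using causal_dist_sin[of 1 0 \<omega>] unfolding Hsin l_def m_def by simp
  have G'd: "G0' = causal_dist (1 / 2) l (1 / 2) m"
    unfolding G0' Gd using dist_deriv_causal_dist[of c l d m] by (simp add: fun_eq_iff c0 cl)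
  have G''d: "G0'' \<phi> = dirac \<phi> + causal_dist (1 / 2 * l) l (1 / 2 * m) m \<phi>" for \<phi>
    unfolding G0'' G'd dist_deriv_causal_dist by simp
  show ?G_0 unfolding Gd using gapprox_causal_dist[of c l d m] by (simp add: c0)
  show ?G'_0 unfolding G'd
    using gval_even_causal_dist[of "1 / 2" "1 / 2" m l] by (simp add: l_def m_def complex_eq_iff)
  show ?G' by (simp add: G'd Hcosd)
  show ?G''
  proof
    fix \<phi>
    have "1 / 2 * l = - of_real (\<omega>\<^sup>2) * c + 0 * 0" "1 / 2 * m = - of_real (\<omega>\<^sup>2) * d + 0 * 0"
      using omega by (simp_all add: c_def d_def s_def l_def m_def complex_eq_iff power2_eq_square)
    then show "G0'' \<phi> = dirac \<phi> - \<omega>\<^sup>2 * G0 \<phi>"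
      unfolding G''d Gd by (simp only: causal_dist_lincomb) simp
  qed
  show ?G''_2
  proof
    fix \<phi>
    have "1 / 2 * l = - of_real \<omega> * (- \<i> / 2) + 0 * 0" "1 / 2 * m = - of_real \<omega> * (\<i> / 2) + 0 * 0"
      by (simp_all add: l_def m_def complex_eq_iff)
    then show "G0'' \<phi> = dirac \<phi> - \<omega> * Hsin \<phi>"
      unfolding G''d by (simp only: causal_dist_lincomb) (simp add: Hsind)
  qed
  obtain h where h: "controlled moderate h" "causal_net h" and Vh: "gfun_deriv U V = eclass U h"
    and conv: "\<And>c l d m. gconv U (causal_dist c l d m) (eclass U h) = eclass U (\<lambda>\<phi>. kernel_conv c l d m (h \<phi>))"
    using span_hat_deriv_net[OF V] by metis
  define W where "W = (\<lambda>\<phi>. kernel_conv c l d m (h \<phi>))"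
  define W' where "W' = (\<lambda>\<phi>. kernel_conv (1 / 2) l (1 / 2) m (h \<phi>))"
  have W: "controlled moderate W" "controlled moderate W'"
    unfolding W_def W'_def by (intro controlled_kernel_conv h size_class_moderate)+
  define Ec where "Ec = (\<lambda>t. complex_of_real (cos (\<omega> * t)))"
  define Es where "Es = (\<lambda>t. complex_of_real (sin (\<omega> * t)))"
  have Ek: "Ec = exp_kernel (1 / 2) l (1 / 2) m" "Es = exp_kernel (- \<i> / 2) l (\<i> / 2) m"
    using exp_kernel_cos[of 0 \<omega>] exp_kernel_sin[of 0 \<omega>] unfolding Ec_def Es_def l_def m_def by (simp_all add: fun_eq_iff)
  have EE: "smooth Ec" "smooth Es" unfolding Ek by (rule smooth_exp_kernel)+
  have e: "cosine = eclass U (\<lambda>\<phi>. Ec)" "sine = eclass U (\<lambda>\<phi>. Es)"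
    unfolding cosine sine Ec_def[symmetric] Es_def[symmetric] Ek iota_exp_kernel by simp_all
  define A where "A \<phi> = of_real (1 / L) * W \<phi> 0" for \<phi>
  define B where "B \<phi> = of_real (1 / (L * \<omega>)) * W' \<phi> 0" for \<phi>
  have m0: "mod_net (\<lambda>\<phi>. W \<phi> 0)" "mod_net (\<lambda>\<phi>. W' \<phi> 0)" by (intro mod_net_value W)+
  have m1: "mod_net A" "mod_net B"
    unfolding A_def[abs_def] B_def[abs_def]
    by (rule size_class_norm_mult[OF size_class_moderate moderate_const]; fact m0)+
  have AB: "num U (1 / L) \<otimes>\<^bsub>Chat U\<^esub> gval U (gconv U G0 V') 0 = cclass U A"
    "num U (1 / (L * \<omega>)) \<otimes>\<^bsub>Chat U\<^esub> gval U (gconv U G0' V') 0 = cclass U B"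
    unfolding V' Vh Gd G'd conv W_def[symmetric] W'_def[symmetric] gval_eclass[OF W(1)] gval_eclass[OF W(2)]
      num_def A_def[abs_def] B_def[abs_def]
    using m0 by (simp_all add: cclass_mult moderate_const)
  have LW: "controlled moderate (\<lambda>\<phi> x. of_real (1 / L) * W \<phi> x)"
    by (rule controlled_cmult[OF size_class_moderate W(1)])
  have gW: "num U (1 / L) \<cdot>\<^bsub>U\<^esub> gconv U G0 V' = eclass U (\<lambda>\<phi> x. of_real (1 / L) * W \<phi> x)"
    unfolding V' Vh Gd conv W_def[symmetric] using num_gscale_eclass[OF W(1), of "of_real (1 / L)"] by simp
  have rhs: "\<ominus>\<^bsub>Ehat U\<^esub> (cclass U A \<cdot>\<^bsub>U\<^esub> cosine) \<ominus>\<^bsub>Ehat U\<^esub> cclass U B \<cdot>\<^bsub>U\<^esub> sine \<oplus>\<^bsub>Ehat U\<^esub>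
      num U (1 / L) \<cdot>\<^bsub>U\<^esub> gconv U G0 V' =
      eclass U (\<lambda>\<phi> x. of_real (1 / L) * W \<phi> x - A \<phi> * Ec x - B \<phi> * Es x)"
    unfolding e gW by (rule oscillation_eclass[OF m1 LW EE])
  let ?c = "of_real (1 / (L * \<omega>)) * (- \<i> / 2)" and ?d = "of_real (1 / (L * \<omega>)) * (\<i> / 2)"
  let ?W = "\<lambda>\<phi>. kernel_conv ?c l ?d m (h \<phi>)"
  let ?W' = "\<lambda>\<phi>. kernel_conv (?c * l) l (?d * m) m (h \<phi>)"
  have sc: "?c = of_real (1 / L) * c" "?d = of_real (1 / L) * d"
    using L omega by (simp_all add: c_def d_def s_def)
  have WW: "?W \<phi> x = of_real (1 / L) * W \<phi> x" "?W' \<phi> x = of_real (1 / L) * W' \<phi> x" for \<phi> x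
    unfolding sc mult.assoc cl kernel_conv_scale W_def W'_def by (rule refl)+
  have fin: "(\<lambda>\<phi> x. ?W \<phi> x - ?W \<phi> 0 * of_real (exp (- 0 * x) * cos (\<omega> * x))
        - (of_real 0 * ?W \<phi> 0 + ?W' \<phi> 0) / of_real \<omega> * of_real (exp (- 0 * x) * sin (\<omega> * x))) =
      (\<lambda>\<phi> x. of_real (1 / L) * W \<phi> x - A \<phi> * Ec x - B \<phi> * Es x)"
    unfolding WW by (simp add: Ec_def Es_def A_def B_def fun_eq_iff)
  have sol: "second_order_ivp L 0 (of_real (1 / C)) (eclass U h) I \<longleftrightarrow>
      I = eclass U (\<lambda>\<phi> x. of_real (1 / L) * W \<phi> x - A \<phi> * Ec x - B \<phi> * Es x)"
    unfolding fin[symmetric]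
    by (rule oscillator_solution[OF _ _ _ _ h l_def m_def refl refl refl refl])
      (use L omega omega2 in auto)
  show ?solution
    unfolding AB rhs unfolding V' Vh sol[symmetric]
    by (cases "I \<in> carrier (Ehat U)") (simp_all add: undamped_term)
qed

end

theorem lemma10:
  fixes U :: "test_fun filter" and L R C :: real and V :: gen_fun
    and E :: "gen_fun ring" (structure) and K :: "gen_num ring"
  assumes U: "admissible_ultrafilter U"
    and E: "E = Ehat U" and K: "K = Chat U"
    and L: "L \<ge> 0" and R: "R \<ge> 0" and C: "C > 0" and LR: "L\<^sup>2 + R\<^sup>2 \<noteq> 0"
    and V: "V \<in> span_hat U distributions_plus"
  shows
    "(L = 0 \<longrightarrow>
       (let g = dist_of (\<lambda>t. of_real (1 / R * heaviside t * exp (- t / (R * C))));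
            e = iota U (dist_of (\<lambda>t. of_real (exp (- t / (R * C)))));
            V' = gfun_deriv U V;
            ivp = (\<lambda>I. I \<in> carrier E \<and>
              num U R \<cdot>\<^bsub>U\<^esub> gfun_deriv U I \<oplus> num U (1 / C) \<cdot>\<^bsub>U\<^esub> I = V' \<and>
              gval U I 0 = \<zero>\<^bsub>K\<^esub>)
        in (\<forall>I. kirchhoff_ivp U L R C V I \<longleftrightarrow> ivp I) \<and>
           (\<forall>I. ivp I \<longleftrightarrow>
              I = gconv U g V' \<ominus> gval U (gconv U g V') 0 \<cdot>\<^bsub>U\<^esub> e)))
     \<and>
     (R\<^sup>2 - 4 * L / C < 0 \<longrightarrow>
       (let \<omega> = 1 / (2 * L) * sqrt (4 * L / C - R\<^sup>2);
            Hcos = dist_of (\<lambda>t. of_real (heaviside t * exp (- (R / (2 * L)) * t) * cos (\<omega> * t)));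
            Hsin = dist_of (\<lambda>t. of_real (heaviside t * exp (- (R / (2 * L)) * t) * sin (\<omega> * t)));
            G = dist_of (\<lambda>t. of_real
                  (1 / (L * \<omega>) * heaviside t * exp (- (R / (2 * L)) * t) * sin (\<omega> * t)));
            G' = dist_deriv G;
            G'' = dist_deriv G';
            ecos = iota U (dist_of (\<lambda>t. of_real (exp (- (R / (2 * L)) * t) * cos (\<omega> * t))));
            esin = iota U (dist_of (\<lambda>t. of_real (exp (- (R / (2 * L)) * t) * sin (\<omega> * t))));
            V' = gfun_deriv U V;
            a = gval U (gconv U G V') 0;
            b = gval U (gconv U G' V') 0;
            ivp = (\<lambda>I. I \<in> carrier E \<and>
              num U L \<cdot>\<^bsub>U\<^esub> gfun_deriv U (gfun_deriv U I) \<oplus> num U R \<cdot>\<^bsub>U\<^esub> gfun_deriv U I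
                \<oplus> num U (1 / C) \<cdot>\<^bsub>U\<^esub> I = V' \<and>
              gval U I 0 = \<zero>\<^bsub>K\<^esub> \<and> gval U (gfun_deriv U I) 0 = \<zero>\<^bsub>K\<^esub>)
        in (\<forall>I. kirchhoff_ivp U L R C V I \<longleftrightarrow> ivp I) \<and>
           (\<forall>I. ivp I \<longleftrightarrow>
              I = \<ominus> (a \<cdot>\<^bsub>U\<^esub> ecos)
                  \<ominus> (num U (1 / (2 * L * \<omega>)) \<otimes>\<^bsub>K\<^esub>
                      (num U R \<otimes>\<^bsub>K\<^esub> a \<oplus>\<^bsub>K\<^esub> num U (2 * L) \<otimes>\<^bsub>K\<^esub> b)) \<cdot>\<^bsub>U\<^esub> esin
                  \<oplus> gconv U G V') \<and>
           gapprox U (gval U (iota U G) 0) (num U 0) \<and>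
           gapprox U (gval U (iota U G') 0) (num U (1 / (2 * L))) \<and>
           G' = (\<lambda>\<phi>. - (R / (2 * L)) * G \<phi> + 1 / L * Hcos \<phi>) \<and>
           G'' = (\<lambda>\<phi>. 1 / L * dirac \<phi> - R / L * G' \<phi> - 1 / (L * C) * G \<phi>) \<and>
           G'' = (\<lambda>\<phi>. 1 / L * dirac \<phi> - R / L\<^sup>2 * Hcos \<phi>
                    + 1 / (L * \<omega>) * (R\<^sup>2 / (4 * L\<^sup>2) - \<omega>\<^sup>2) * Hsin \<phi>)))
     \<and>
     (R = 0 \<and> L > 0 \<longrightarrow>
       (let \<omega> = 1 / sqrt (L * C);
            Hcos = dist_of (\<lambda>t. of_real (heaviside t * cos (\<omega> * t)));
            Hsin = dist_of (\<lambda>t. of_real (heaviside t * sin (\<omega> * t)));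
            G0 = dist_of (\<lambda>t. of_real (1 / \<omega> * heaviside t * sin (\<omega> * t)));
            G0' = dist_deriv G0;
            G0'' = dist_deriv G0';
            cosine = iota U (dist_of (\<lambda>t. of_real (cos (\<omega> * t))));
            sine = iota U (dist_of (\<lambda>t. of_real (sin (\<omega> * t))));
            V' = gfun_deriv U V;
            ivp = (\<lambda>I. I \<in> carrier E \<and>
              num U L \<cdot>\<^bsub>U\<^esub> gfun_deriv U (gfun_deriv U I) \<oplus> num U (1 / C) \<cdot>\<^bsub>U\<^esub> I = V' \<and>
              gval U I 0 = \<zero>\<^bsub>K\<^esub> \<and> gval U (gfun_deriv U I) 0 = \<zero>\<^bsub>K\<^esub>)
        in (\<forall>I. kirchhoff_ivp U L R C V I \<longleftrightarrow> ivp I) \<and>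
           (\<forall>I. ivp I \<longleftrightarrow>
              I = \<ominus> ((num U (1 / L) \<otimes>\<^bsub>K\<^esub> gval U (gconv U G0 V') 0) \<cdot>\<^bsub>U\<^esub> cosine)
                  \<ominus> (num U (1 / (L * \<omega>)) \<otimes>\<^bsub>K\<^esub> gval U (gconv U G0' V') 0) \<cdot>\<^bsub>U\<^esub> sine
                  \<oplus> num U (1 / L) \<cdot>\<^bsub>U\<^esub> gconv U G0 V') \<and>
           gapprox U (gval U (iota U G0) 0) (num U 0) \<and>
           gval U (iota U G0') 0 = num U (1 / 2) \<and>
           G0' = Hcos \<and>
           G0'' = (\<lambda>\<phi>. dirac \<phi> - \<omega>\<^sup>2 * G0 \<phi>) \<and>
           G0'' = (\<lambda>\<phi>. dirac \<phi> - \<omega> * Hsin \<phi>)))"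
proof -
  interpret admissible U using U by (rule admissible.intro)
  have L_pos: "L > 0" if "R\<^sup>2 - 4 * L / C < 0"
    using that L by (cases "L = 0") auto
  have R_pos: "R > 0" if "L = 0" using LR R that by (cases "R = 0") auto
  note resistive = circuit_without_inductance[OF R_pos C V refl refl]
    and damped = damped_circuit[OF L_pos C _ V refl refl refl refl refl refl refl refl refl refl refl]
    and undamped = undamped_circuit[OF _ C V refl refl refl refl refl refl refl refl refl]
  show ?thesis
    unfolding E K Let_def
  \<comment> \<open>cases 1, 3 and 10 are the reductions of the Kirchhoff problem\<close>
  proof (intro conjI impI allI, goal_cases)
    case (1 I) then show ?case by (simp only: kirchhoff_ivp_L0_iff)
  next
    case (2 I) then show ?case by (rule resistive)
  next
    case (3 I) then show ?case using L_pos by (intro kirchhoff_ivp_iff) auto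
  next
    case (4 I) then show ?case by (intro damped(1))
  next
    case 5 then show ?case by (intro damped(2))
  next
    case 6 then show ?case by (intro damped(3))
  next
    case 7 then show ?case by (intro damped(4))
  next
    case 8 then show ?case by (intro damped(5))
  next
    case 9 then show ?case by (intro damped(6))
  next
    case (10 I) then show ?case using undamped_term[of I "of_real L" "of_real (1 / C)"]
      by (auto simp: kirchhoff_ivp_iff)
  next
    case (11 I) then show ?case by (intro undamped(1)) simp
  next
    case 12 then show ?case by (intro undamped(2)) simp
  next
    case 13 then show ?case by (intro undamped(3)) simp
  next
    case 14 then show ?case by (intro undamped(4)) simp
  next
    case 15 then show ?case by (intro undamped(5)) simp
  next
    case 16 then show ?case by (intro undamped(6)) simp
  qed
qed

end
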